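(* Let $n > 1$ be an integer and let $M$ be an $n \times n$ cubic sign matrix, i.e. a complex matrix with $0$'s along the diagonal and third roots of unity off the diagonal. Then the following are equivalent: (a) The matrix $M$ is symmetric. (b) There exist distinct prime ideals $\mathfrak{p}_1, \dots, \mathfrak{p}_n$ of $\mathbb{Q}(\sqrt{-3})$, none dividing $3$, such that $M$ is the cubic residue matrix associated to $\mathfrak{p}_1, \dots, \mathfrak{p}_n$.
   Context: Prime ideals of $K = \mathbb{Q}(\sqrt{-3})$ means nonzero prime ideals of its ring of integers $\mathcal{O}_K = \mathbb{Z}\left[\frac{-1+\sqrt{-3}}{2}\right]$, with $K$ viewed inside $\mathbb{C}$. "Third root of unity" means any complex number $\zeta$ with $\zeta^3 = 1$ (including $1$). Every prime ideal $\mathfrak{p}$ of $K$ not dividing $3$ is principal and has a unique generator $\pi$ with $\pi \equiv 1 \pmod{3\mathcal{O}_K}$, called its 3-primary generator. For distinct prime ideals $\mathfrak{p}_i, \mathfrak{p}_j$ not dividing $3$ with 3-primary generators $\pi_i, \pi_j$, the cubic residue symbol $\left(\frac{\pi_i}{\pi_j}\right)_3$ is the unique third root of unity in $K$ with $$\left(\frac{\pi_i}{\pi_j}\right)_3 \equiv \pi_i^{(N\pi_j - 1)/3} \pmod{(\pi_j)},$$ where $N$ denotes the norm from $\mathbb{Q}(\sqrt{-3})$ to $\mathbb{Q}$; also $\left(\frac{\pi_i}{\pi_i}\right)_3 = 0$. The cubic residue matrix associated to distinct prime ideals $\mathfrak{p}_1, \dots, \mathfrak{p}_n$ of $\mathbb{Q}(\sqrt{-3})$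 not dividing $3$ is the $n \times n$ matrix whose $(i,j)$-entry is $\left(\frac{\pi_i}{\pi_j}\right)_3$, where $\pi_k$ is the 3-primary generator of $\mathfrak{p}_k$ for $1 \le k \le n$. *)

theory Defs
  imports
    Complex_Main
    "HOL-Computational_Algebra.Polynomial"
    "HOL-Algebra.Ideal_Product"
    "Jordan_Normal_Form.Matrix"
begin

section \<open>The field \<open>K = \<rat>(\<surd>-3)\<close> and its ring of integers\<close>

definition field_K :: "complex set" where
  "field_K = {of_rat a + of_rat b * csqrt (-3) | a b. True}"

definition ring_of_integers :: "complex ring" (\<open>\<O>\<^sub>K\<close>) where
  "\<O>\<^sub>K = \<lparr>carrier = {z \<in> field_K. algebraic_int z}, mult = (*), one = 1, zero = 0, add = (+)\<rparr>"

text \<open>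
  The nontrivial automorphism of \<open>K\<close> is complex conjugation, so the norm of \<open>z \<in> K\<close> is the
  product of \<open>z\<close> and \<open>cnj z\<close>, a nonnegative rational number.
\<close>
definition norm_K :: "complex \<Rightarrow> real" where
  "norm_K z = Re (z * cnj z)"

definition cong_K :: "complex \<Rightarrow> complex \<Rightarrow> complex set \<Rightarrow> bool" where
  "cong_K x y I \<longleftrightarrow> x \<in> carrier \<O>\<^sub>K \<and> y \<in> carrier \<O>\<^sub>K \<and> x - y \<in> I"

definition prime_ideal_K :: "complex set \<Rightarrow> bool" where
  "prime_ideal_K P \<longleftrightarrow> primeideal P \<O>\<^sub>K \<and> P \<noteq> {0}"

definition ideal_dvd_K :: "complex set \<Rightarrow> complex set \<Rightarrow> bool" where
  "ideal_dvd_K I J \<longleftrightarrow> (\<exists>I'. ideal I' \<O>\<^sub>K \<and> J = I \<cdot>\<^bsub>\<O>\<^sub>K\<^esub> I')"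


section \<open>Cubic residue matrices\<close>

text \<open>
  For a prime ideal not dividing \<open>3\<close> the description below is satisfied by exactly one element.
\<close>
definition primary_generator :: "complex set \<Rightarrow> complex" where
  "primary_generator P =
     (THE \<pi>. \<pi> \<in> carrier \<O>\<^sub>K \<and> P = PIdl\<^bsub>\<O>\<^sub>K\<^esub> \<pi> \<and> cong_K \<pi> 1 (PIdl\<^bsub>\<O>\<^sub>K\<^esub> 3))"

text \<open>
  The arguments are meant to be 3-primary generators of prime ideals not dividing \<open>3\<close>. Then
  \<open>norm_K \<pi>\<close> is a positive integer congruent to \<open>1\<close> modulo \<open>3\<close>, so the floor in the exponent
  only converts the type; the third root of unity is unique because distinct third roots of unity
  are incongruent modulo any prime not dividing \<open>3\<close>.
\<close>
definition cubic_residue_symbol :: "complex \<Rightarrow> complex \<Rightarrow> complex" where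
  "cubic_residue_symbol \<alpha> \<pi> =
     (if \<alpha> = \<pi> then 0
      else THE \<zeta>. \<zeta> \<in> field_K \<and> \<zeta> ^ 3 = 1 \<and>
             cong_K \<zeta> (\<alpha> ^ nat \<lfloor>(norm_K \<pi> - 1) / 3\<rfloor>) (PIdl\<^bsub>\<O>\<^sub>K\<^esub> \<pi>))"

text \<open>Indices run from \<open>0\<close> to \<open>n - 1\<close>, following the convention for matrices.\<close>
definition cubic_residue_matrix :: "nat \<Rightarrow> (nat \<Rightarrow> complex set) \<Rightarrow> complex mat" where
  "cubic_residue_matrix n P =
     mat n n (\<lambda>(i, j). cubic_residue_symbol (primary_generator (P i)) (primary_generator (P j)))"

definition cubic_sign_matrix :: "nat \<Rightarrow> complex mat \<Rightarrow> bool" where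
  "cubic_sign_matrix n M \<longleftrightarrow> M \<in> carrier_mat n n \<and>
     (\<forall>i<n. \<forall>j<n. if i = j then M $$ (i, j) = 0 else (M $$ (i, j)) ^ 3 = 1)"


section \<open>\<open>\<O>\<^sub>K\<close> is the commutative ring \<open>\<int>[(-1 + \<surd>-3) / 2]\<close>\<close>

definition omega_K :: complex where
  "omega_K = (-1 + csqrt (-3)) / 2"

definition Z_omega :: "complex set" where
  "Z_omega = {of_int a + of_int b * omega_K | a b. True}"

lemma csqrt_minus_3_square: "csqrt (-3) * csqrt (-3) = -3"
  by (metis power2_csqrt power2_eq_square)

lemma cnj_csqrt_minus_3: "cnj (csqrt (-3)) = - csqrt (-3)"
  by (rule complex_eqI) (auto simp: csqrt.simps)

lemma omega_K_square: "omega_K * omega_K = -1 - omega_K"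
  using csqrt_minus_3_square by (simp add: omega_K_def field_simps)

lemma Z_omega_I: "of_int a + of_int b * omega_K \<in> Z_omega" unfolding Z_omega_def by blast

lemma Z_omega_int: "of_int a \<in> Z_omega" using Z_omega_I[of a 0] by simp

lemma Z_omega_add:
  assumes "x \<in> Z_omega" "y \<in> Z_omega"
  shows "x + y \<in> Z_omega"
proof -
  obtain a b c d where "x = of_int a + of_int b * omega_K" "y = of_int c + of_int d * omega_K"
    using assms unfolding Z_omega_def by blast
  then have "x + y = of_int (a + c) + of_int (b + d) * omega_K" by (simp add: algebra_simps)
  then show ?thesis using Z_omega_I by metis
qed

lemma Z_omega_mult:
  assumes "x \<in> Z_omega" "y \<in> Z_omega"
  shows "x * y \<in> Z_omega"
proof -
  obtain a b c d where "x = of_int a + of_int b * omega_K" "y = of_int c + of_int d * omega_K"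
    using assms unfolding Z_omega_def by blast
  then have "x * y = of_int a * of_int c + (of_int a * of_int d + of_int b * of_int c) * omega_K
      + of_int b * of_int d * (omega_K * omega_K)"
    by (simp add: algebra_simps)
  then have "x * y = of_int (a * c - b * d) + of_int (a * d + b * c - b * d) * omega_K"
    unfolding omega_K_square by (simp add: algebra_simps)
  then show ?thesis using Z_omega_I by metis
qed

lemma Z_omega_sum: "(\<And>i. i \<in> A \<Longrightarrow> f i \<in> Z_omega) \<Longrightarrow> sum f A \<in> Z_omega"
  using Z_omega_int[of 0] by (induction A rule: infinite_finite_induct) (auto intro: Z_omega_add)

lemma Z_omega_power: "x \<in> Z_omega \<Longrightarrow> x ^ k \<in> Z_omega"
  using Z_omega_int[of 1] by (induction k) (auto intro: Z_omega_mult)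

lemma norm_K_of_rat: "norm_K (of_rat a + of_rat b * csqrt (-3)) = of_rat (a\<^sup>2 + 3 * b\<^sup>2)"
proof -
  have c: "cnj (of_rat q) = of_rat q" for q
    by (cases q) (simp add: of_rat_rat)
  have "(of_rat a + of_rat b * csqrt (-3)) * cnj (of_rat a + of_rat b * csqrt (-3))
      = of_rat a * of_rat a - of_rat b * of_rat b * (csqrt (-3) * csqrt (-3))"
    by (simp add: cnj_csqrt_minus_3 c algebra_simps)
  also have "\<dots> = of_rat (a\<^sup>2 + 3 * b\<^sup>2)"
    unfolding csqrt_minus_3_square by (simp add: of_rat_add of_rat_mult power2_eq_square)
  also have "\<dots> = complex_of_real (of_rat (a\<^sup>2 + 3 * b\<^sup>2))"
    by (cases "a\<^sup>2 + 3 * b\<^sup>2") (simp add: of_rat_rat)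
  finally show ?thesis unfolding norm_K_def by simp
qed

lemma norm_K_in_Ints:
  assumes "x \<in> Z_omega"
  shows "norm_K x \<in> \<int>"
proof -
  obtain a b where x: "x = of_int a + of_int b * omega_K" using assms unfolding Z_omega_def by blast
  have "x = of_rat (of_int a - of_int b / 2) + of_rat (of_int b / 2) * csqrt (-3)"
    by (simp add: x omega_K_def of_rat_diff of_rat_divide of_rat_mult field_simps)
  then have "norm_K x = of_rat ((of_int a - of_int b / 2)\<^sup>2 + 3 * (of_int b / 2)\<^sup>2)"
    by (simp only: norm_K_of_rat)
  also have "(of_int a - of_int b / 2)\<^sup>2 + 3 * (of_int b / 2)\<^sup>2 = (of_int (a * a - a * b + b * b) :: rat)"
    by (simp add: power2_eq_square field_simps)
  finally show ?thesis by (simp only: of_rat_of_int_eq Ints_of_int)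
qed

lemma norm_K_mult: "norm_K (x * y) = norm_K x * norm_K y"
  unfolding norm_K_def by (simp add: complex_eq_iff algebra_simps)

lemma norm_K_power: "norm_K (x ^ k) = norm_K x ^ k"
  by (induction k) (auto simp: norm_K_mult, simp add: norm_K_def)

lemma rat_in_Ints_if_bounded_denominators:
  fixes q :: rat
  assumes C: "C > (0::int)" and b: "\<And>k. of_int C * q ^ k \<in> \<int>"
  shows "q \<in> \<int>"
proof -
  obtain m n where mn: "quotient_of q = (m, n)" by fastforce
  have n: "n > 0" "coprime m n" "q = of_int m / of_int n"
    using mn quotient_of_denom_pos quotient_of_coprime quotient_of_div by auto
  have d: "n ^ k dvd C" for k
  proof -
    obtain t where "of_int C * q ^ k = of_int t" using b Ints_cases by metis
    then have "of_int (C * m ^ k) = (of_int (t * n ^ k) :: rat)"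
      using n by (simp add: power_divide field_simps)
    then have "C * m ^ k = t * n ^ k" by linarith
    then have "n ^ k dvd C * m ^ k" by simp
    then show ?thesis using n(2)
      by (meson coprime_commute coprime_dvd_mult_left_iff coprime_power_left_iff coprime_power_right_iff)
  qed
  have "n = 1"
  proof (rule ccontr)
    assume "n \<noteq> 1"
    then have n2: "2 \<le> n" using n by simp
    have "n ^ nat C \<le> C" using d C zdvd_imp_le by blast
    moreover have "(2::int) ^ nat C \<le> n ^ nat C" using n2 by (intro power_mono) auto
    moreover have "int (nat C) < int (2 ^ nat C)" using of_nat_less_two_power
      by (metis of_nat_less_iff less_exp)
    ultimately show False using C by simp
  qed
  then show ?thesis using n by simp
qed

lemma field_K_common_denominator:
  assumes "z \<in> field_K"
  shows "\<exists>D::int. D > 0 \<and> of_int D * z \<in> Z_omega"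
proof -
  obtain a b where z: "z = of_rat a + of_rat b * csqrt (-3)"
    using assms unfolding field_K_def by blast
  obtain m n where mn: "quotient_of a = (m, n)" by fastforce
  obtain r t where rt: "quotient_of b = (r, t)" by fastforce
  have n: "n > 0" "a = of_int m / of_int n"
    using mn quotient_of_denom_pos quotient_of_div by auto
  have t: "t > 0" "b = of_int r / of_int t"
    using rt quotient_of_denom_pos quotient_of_div by auto
  have "of_int (n * t) * z = of_int (m * t + r * n) + of_int (2 * r * n) * omega_K"
    unfolding z n(2) t(2) using n(1) t(1) by (simp add: omega_K_def of_rat_divide field_simps)
  then have "of_int (n * t) * z \<in> Z_omega" using Z_omega_I by metis
  then show ?thesis using n(1) t(1) by (intro exI[of _ "n * t"]) auto
qed

lemma algebraic_int_powers_bounded_denominators: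
  assumes "z \<in> field_K" "algebraic_int z"
  shows "\<exists>C::int. C > 0 \<and> (\<forall>k. of_int C * z ^ k \<in> Z_omega)"
proof -
  obtain D :: int where D: "D > 0" "of_int D * z \<in> Z_omega"
    using field_K_common_denominator[OF assms(1)] by blast
  obtain p where p: "lead_coeff p = 1" "\<And>i. coeff p i \<in> \<int>" "poly p z = 0"
    using assms(2) by (auto elim!: algebraic_int.cases)
  define d where "d = degree p"
  have "of_int (D ^ d) * z ^ k \<in> Z_omega" for k
  proof (induction k rule: less_induct)
    case (less k)
    show ?case
    proof (cases "k \<le> d")
      case True
      then have "of_int (D ^ d) * z ^ k = of_int (D ^ (d - k)) * (of_int D * z) ^ k"
        by (simp add: power_mult_distrib flip: power_add mult.assoc)
      then show ?thesis using Z_omega_int Z_omega_power[OF D(2)] Z_omega_mult by metis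
    next
      case False
      have "(\<Sum>i<d. coeff p i * z ^ i) + z ^ d = 0"
        using p(1,3) by (simp add: poly_altdef d_def lessThan_Suc_atMost[symmetric])
      then have "z ^ d = - (\<Sum>i<d. coeff p i * z ^ i)" by (simp add: add_eq_0_iff)
      moreover have "z ^ k = z ^ d * z ^ (k - d)" using False by (simp flip: power_add)
      ultimately have "of_int (D ^ d) * z ^ k
          = (\<Sum>i<d. - coeff p i * (of_int (D ^ d) * z ^ (i + (k - d))))"
        by (simp add: sum_distrib_left sum_distrib_right sum_negf power_add algebra_simps)
      also have "\<dots> \<in> Z_omega"
      proof (rule Z_omega_sum, rule Z_omega_mult)
        fix i assume "i \<in> {..<d}"
        then show "of_int (D ^ d) * z ^ (i + (k - d)) \<in> Z_omega"
          using False by (intro less) auto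
        show "- coeff p i \<in> Z_omega" using p(2) Ints_minus Ints_cases Z_omega_int by metis
      qed
      finally show ?thesis .
    qed
  qed
  then show ?thesis using D(1) by (intro exI[of _ "D ^ d"]) auto
qed

lemma norm_in_Ints_if_bounded_denominators:
  assumes "C > (0::int)" "\<And>k. of_int C * (of_rat a + of_rat b * csqrt (-3)) ^ k \<in> Z_omega"
  shows "a\<^sup>2 + 3 * b\<^sup>2 \<in> \<int>"
proof (rule rat_in_Ints_if_bounded_denominators)
  show "C * C > 0" using assms(1) by simp
  fix k
  have c: "norm_K (of_int C) = of_int (C * C)"
    using norm_K_of_rat[of "of_int C" 0] by (simp add: power2_eq_square of_rat_mult)
  have "norm_K (of_int C * (of_rat a + of_rat b * csqrt (-3)) ^ k)
      = of_rat (of_int (C * C) * (a\<^sup>2 + 3 * b\<^sup>2) ^ k)"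
    unfolding norm_K_mult norm_K_power norm_K_of_rat c
    by (simp add: of_rat_mult of_rat_power)
  then have "(of_rat (of_int (C * C) * (a\<^sup>2 + 3 * b\<^sup>2) ^ k) :: real) \<in> \<int>"
    using norm_K_in_Ints[OF assms(2)[of k]] by (simp only:)
  then obtain t where "(of_rat (of_int (C * C) * (a\<^sup>2 + 3 * b\<^sup>2) ^ k) :: real) = of_int t"
    by (elim Ints_cases)
  then have "of_int (C * C) * (a\<^sup>2 + 3 * b\<^sup>2) ^ k = of_int t"
    by (metis of_rat_eq_iff of_rat_of_int_eq)
  then show "of_int (C * C) * (a\<^sup>2 + 3 * b\<^sup>2) ^ k \<in> \<int>" by simp
qed

lemma rat_in_Ints_if_square_in_Ints:
  fixes q :: rat
  assumes "q\<^sup>2 \<in> \<int>"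
  shows "q \<in> \<int>"
proof -
  obtain m n where mn: "quotient_of q = (m, n)" by fastforce
  have n: "n > 0" "coprime m n" "q = of_int m / of_int n"
    using mn quotient_of_denom_pos quotient_of_coprime quotient_of_div by auto
  obtain t where "q\<^sup>2 = of_int t" using assms Ints_cases by metis
  then have "of_int (m * m) = (of_int (t * (n * n)) :: rat)"
    using n by (simp add: power2_eq_square field_simps)
  then have "m * m = t * (n * n)" by linarith
  then have "n dvd m * m" by simp
  then have "n dvd 1" using n(2)
    by (metis coprime_commute coprime_dvd_mult_left_iff coprime_absorb_left)
  then have "n = 1" using n(1) by simp
  then show ?thesis using n by simp
qed

theorem carrier_ring_of_integers: "carrier \<O>\<^sub>K = Z_omega"
proof (rule Set.set_eqI, rule iffI)
  fix z assume "z \<in> carrier \<O>\<^sub>K"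
  then have z: "z \<in> field_K" "algebraic_int z" by (auto simp: ring_of_integers_def)
  obtain a b where zab: "z = of_rat a + of_rat b * csqrt (-3)"
    using z(1) unfolding field_K_def by blast
  obtain C where C: "C > 0" "\<And>k. of_int C * z ^ k \<in> Z_omega"
    using algebraic_int_powers_bounded_denominators[OF z] by blast
  have "of_int C * (of_rat (a + 1) + of_rat b * csqrt (-3)) ^ k \<in> Z_omega" for k
  proof -
    have "of_int C * (of_rat (a + 1) + of_rat b * csqrt (-3)) ^ k = of_int C * (z + 1) ^ k"
      by (simp add: zab of_rat_add algebra_simps)
    also have "\<dots> = (\<Sum>i\<le>k. of_int (int (k choose i)) * (of_int C * z ^ i))"
      unfolding binomial_ring sum_distrib_left by (intro sum.cong) auto
    also have "\<dots> \<in> Z_omega"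
      using C(2) Z_omega_int Z_omega_mult Z_omega_sum by (metis (no_types, lifting))
    finally show ?thesis .
  qed
  from norm_in_Ints_if_bounded_denominators[OF C(1) this] obtain m' where m': "(a + 1)\<^sup>2 + 3 * b\<^sup>2 = of_int m'"
    by (elim Ints_cases)
  from norm_in_Ints_if_bounded_denominators[OF C(1) C(2)[unfolded zab]] obtain m where m: "a\<^sup>2 + 3 * b\<^sup>2 = of_int m"
    by (elim Ints_cases)
  define u where "u = m' - m - 1"
  have u: "2 * a = of_int u"
    using m m' unfolding u_def by (simp add: power2_eq_square algebra_simps)
  have b36: "(6 * b)\<^sup>2 = of_int (3 * (4 * m - u * u))"
    using m u by (simp add: power2_eq_square algebra_simps flip: m u)
  then obtain w where w: "6 * b = of_int w"
    using rat_in_Ints_if_square_in_Ints Ints_of_int Ints_cases by metis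
  have "of_int (w * w) = (of_int (3 * (4 * m - u * u)) :: rat)"
    using b36 w by (simp add: power2_eq_square)
  then have ww: "w * w = 3 * (4 * m - u * u)" by linarith
  then have "3 dvd w * w" by simp
  then have "3 dvd w"
    using prime_dvd_mult_iff[of "3::int" w w] by simp
  then obtain v where v: "w = 3 * v" by (elim dvdE)
  have "3 * (v * v) = 4 * m - u * u" using ww v by simp
  then have "even (3 * (v * v) + u * u)" by simp
  then have "even (u + v)" by auto
  then obtain c where c: "u + v = 2 * c" by (elim evenE)
  have ha: "a = of_int c - of_int v / 2"
  proof -
    have "2 * a = of_int (2 * c - v)" using u c by (metis add_diff_cancel_right')
    then show ?thesis by simp
  qed
  have hb: "b = of_int v / 2" using w v by simp
  have "z = of_int c + of_int v * omega_K"
    by (simp add: zab ha hb omega_K_def of_rat_diff of_rat_divide of_rat_mult field_simps)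
  then show "z \<in> Z_omega" using Z_omega_I by blast
next
  fix z assume "z \<in> Z_omega"
  then obtain a b where z: "z = of_int a + of_int b * omega_K" unfolding Z_omega_def by blast
  have 1: "z = of_rat (of_int a - of_int b / 2) + of_rat (of_int b / 2) * csqrt (-3)"
    by (simp add: z omega_K_def of_rat_diff of_rat_divide of_rat_mult field_simps)
  then have K: "z \<in> field_K" unfolding field_K_def by blast
  have "z * z - of_int (2 * a - b) * z + of_int (a * a - a * b + b * b)
      = of_int (b * b) * (omega_K * omega_K + omega_K + 1)"
    by (simp add: z algebra_simps)
  then have "z * z - of_int (2 * a - b) * z + of_int (a * a - a * b + b * b) = 0"
    by (simp add: omega_K_square)
  then have "poly [: of_int (a * a - a * b + b * b), - of_int (2 * a - b), 1 :] z = 0"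
    by (simp add: algebra_simps)
  then have "algebraic_int z"
    by (rule algebraic_int.intros[rotated 2]) (auto simp: coeff_pCons split: nat.splits)
  with K show "z \<in> carrier \<O>\<^sub>K" by (simp add: ring_of_integers_def)
qed

lemma cring_ring_of_integers: "cring \<O>\<^sub>K"
proof (rule cringI)
  have neg: "x \<in> Z_omega \<Longrightarrow> - x \<in> Z_omega" for x
    using Z_omega_mult[OF Z_omega_int[of "-1"]] by fastforce
  have s: "mult \<O>\<^sub>K = (*)" "one \<O>\<^sub>K = 1" "zero \<O>\<^sub>K = 0" "add \<O>\<^sub>K = (+)"
    by (auto simp: ring_of_integers_def)
  show "abelian_group \<O>\<^sub>K"
    using Z_omega_add Z_omega_int[of 0] neg
    by (intro abelian_groupI) (auto simp: s carrier_ring_of_integers intro!: bexI[of _ "- _"])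
  show "comm_monoid \<O>\<^sub>K"
    using Z_omega_mult Z_omega_int[of 1] by (intro comm_monoidI) (auto simp: s carrier_ring_of_integers)
qed (auto simp: ring_of_integers_def algebra_simps)

end

theory Submission
  imports Defs "HOL-Complex_Analysis.Complex_Analysis" "HOL-Library.Poly_Mapping"
begin

text \<open>
  If \<open>M\<close> is a cubic residue matrix, its symmetry is cubic reciprocity. For the character \<open>\<chi>\<close> modulo
  a primary prime \<open>p\<close>, the sum of \<open>\<chi>(x\<^sub>1) \<cdots> \<chi>(x\<^sub>n)\<close> over \<open>x\<^sub>1 + \<cdots> + x\<^sub>n = a\<close> equals \<open>(N(p) J)\<^sup>k \<chi>(a)\<close>
  for \<open>n = 3 k + 1\<close>, where the Jacobi sum \<open>J\<close> is \<open>- p\<close>; for \<open>n\<close> a power of a rational prime \<open>l\<close> it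
  is congruent to \<open>1\<close> modulo \<open>l\<close> at \<open>a = n\<close>, by the Frobenius map of the group ring. With \<open>n = N(q)\<close>
  this evaluates \<open>N(p) p\<close> at the character modulo \<open>q\<close>, and exchanging \<open>p\<close> and \<open>q\<close> gives reciprocity.

  Conversely, the primes are chosen one after the other: a new prime with prescribed cubic characters
  modulo the previous ones exists by Dirichlet's argument, and reciprocity supplies the transposed
  entries. The series of the nonprincipal characters do not vanish at \<open>1\<close> because cubic
  characters are never real: a zero would come with a zero of the conjugate series, and two zeros
  outweigh the simple pole of the principal series.
\<close>

section \<open>Eisenstein integers\<close>

text \<open>The arithmetic is done in a type of integer pairs, where divisibility and remainders are
  at hand, and is carried to the complex field by an embedding only at the end. Congruences in the
  group ring of the additive group keep all values in Z[\<omega>], whereas Gauss sums need further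
  roots of unity. The price is that evaluating the character modulo p at N(q) requires p not to
  divide N(q). For distinct primary primes this fails exactly when they are conjugate, and there
  both symbols are shown to be 1 through the trace of p. An ideal prime to 3 is represented by its
  primary generator, so L-series become lattice sums of periodic functions supported on 1 + 3
  Z[\<omega>]. Grouping the lattice into cells continues them to Re s > 1/2 only; this is enough,
  since only the behaviour near s = 1 matters. Orders of vanishing are read off as limits of (s - 1)
  times logarithmic derivatives, so Euler products are replaced by the identity log = \<Lambda> *
  1.\<close>

datatype eis = Eis (eis1: int) (eis2: int)

lemma eis_eqI: "eis1 x = eis1 y \<Longrightarrow> eis2 x = eis2 y \<Longrightarrow> x = y"
  by (cases x; cases y) auto

lemma eis_eq_iff: "x = y \<longleftrightarrow> eis1 x = eis1 y \<and> eis2 x = eis2 y"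
  by (cases x; cases y) auto

instantiation eis :: idom
begin

definition zero_eis where "zero_eis = Eis 0 0"
definition one_eis where "one_eis = Eis 1 0"
definition plus_eis where "x + y = Eis (eis1 x + eis1 y) (eis2 x + eis2 y)"
definition uminus_eis where "- x = Eis (- eis1 x) (- eis2 x)"
definition minus_eis where "x - y = Eis (eis1 x - eis1 y) (eis2 x - eis2 y)"
text \<open>\<open>Eis a b\<close> stands for a + b \<omega> with \<omega> a primitive cube root of
  unity, so products are reduced by \<omega>^2 = -1 - \<omega>.\<close>

definition times_eis where
  "x * y = Eis (eis1 x * eis1 y - eis2 x * eis2 y)
               (eis1 x * eis2 y + eis2 x * eis1 y - eis2 x * eis2 y)"

lemma eis_simps [simp]:
  "eis1 0 = 0" "eis2 0 = 0" "eis1 1 = 1" "eis2 1 = 0"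
  "eis1 (x + y) = eis1 x + eis1 y" "eis2 (x + y) = eis2 x + eis2 y"
  "eis1 (x - y) = eis1 x - eis1 y" "eis2 (x - y) = eis2 x - eis2 y"
  "eis1 (- x) = - eis1 x" "eis2 (- x) = - eis2 x"
  "eis1 (x * y) = eis1 x * eis1 y - eis2 x * eis2 y"
  "eis2 (x * y) = eis1 x * eis2 y + eis2 x * eis1 y - eis2 x * eis2 y"
  by (simp_all add: zero_eis_def one_eis_def plus_eis_def uminus_eis_def minus_eis_def times_eis_def)

lemma eis_sq_pos: "a * a - a * b + b * b = 0 \<longleftrightarrow> a = 0 \<and> b = (0::int)"
proof
  assume "a * a - a * b + b * b = 0"
  then have "(2 * a - b) * (2 * a - b) + 3 * (b * b) = 0" by (simp add: algebra_simps)
  moreover have "(2 * a - b) * (2 * a - b) \<ge> 0" "b * b \<ge> 0" by auto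
  ultimately have "b * b = 0" "(2 * a - b) * (2 * a - b) = 0" by linarith+
  then show "a = 0 \<and> b = 0" by auto
qed auto

instance
proof
  fix x y :: eis
  assume xy: "x \<noteq> 0" "y \<noteq> 0"
  \<comment> \<open>The norm form, still as an integer: it is multiplicative and vanishes only at 0,
    which rules out zero divisors.\<close>
  define n where "n = (\<lambda>z. eis1 z * eis1 z - eis1 z * eis2 z + eis2 z * eis2 z)"
  have "n (x * y) = n x * n y" by (simp add: n_def algebra_simps)
  moreover have "n z = 0 \<longleftrightarrow> z = 0" for z
    unfolding n_def eis_sq_pos by (auto intro: eis_eqI)
  ultimately show "x * y \<noteq> 0" using xy by (metis mult_eq_0_iff)
qed (auto simp: eis_eq_iff algebra_simps)

end

lemma eis_of_nat [simp]: "eis1 (of_nat n) = int n" "eis2 (of_nat n) = 0"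
  by (induction n) auto

lemma eis_of_int [simp]: "eis1 (of_int n) = n" "eis2 (of_int n) = 0"
  by (cases n; simp)+

lemma eis_numeral [simp]: "eis1 (numeral n) = numeral n" "eis2 (numeral n) = 0"
  using eis_of_nat[of "numeral n"] by simp_all

instance eis :: ring_char_0
proof
  show "inj (of_nat :: nat \<Rightarrow> eis)" by (auto simp: inj_def eis_eq_iff)
qed

text \<open>The conjugate of \<omega> is \<omega>^2 = -1 - \<omega>.\<close>

definition eis_cnj :: "eis \<Rightarrow> eis" where
  "eis_cnj x = Eis (eis1 x - eis2 x) (- eis2 x)"

lemma eis_cnj_simps [simp]: "eis1 (eis_cnj x) = eis1 x - eis2 x" "eis2 (eis_cnj x) = - eis2 x"
  by (simp_all add: eis_cnj_def)

lemma eis_cnj_hom [simp]: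
  "eis_cnj (x + y) = eis_cnj x + eis_cnj y" "eis_cnj (x - y) = eis_cnj x - eis_cnj y"
  "eis_cnj (x * y) = eis_cnj x * eis_cnj y" "eis_cnj (- x) = - eis_cnj x"
  "eis_cnj 0 = 0" "eis_cnj 1 = 1" "eis_cnj (eis_cnj x) = x"
  "eis_cnj (of_nat n) = of_nat n" "eis_cnj (of_int i) = of_int i"
  by (auto simp: eis_eq_iff algebra_simps)

lemma eis_cnj_power [simp]: "eis_cnj (x ^ n) = eis_cnj x ^ n"
  by (induction n) auto

lemma eis_cnj_sum: "eis_cnj (sum f A) = (\<Sum>x\<in>A. eis_cnj (f x))"
  by (induction A rule: infinite_finite_induct) auto

lemma eis_cnj_eq_iff [simp]: "eis_cnj x = eis_cnj y \<longleftrightarrow> x = y"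
  by (metis eis_cnj_hom(7))

lemma eis_cnj_eq_0_iff [simp]: "eis_cnj x = 0 \<longleftrightarrow> x = 0"
  using eis_cnj_eq_iff[of x 0] by simp

lemma eis_cnj_dvd_iff [simp]: "eis_cnj x dvd eis_cnj y \<longleftrightarrow> x dvd y"
  by (metis dvd_def eis_cnj_hom(3,7))

text \<open>The form a^2 - a b + b^2 is x times its conjugate. Natural numbers as values let it
  serve as Euclidean size and in exponents.\<close>

definition eis_norm :: "eis \<Rightarrow> nat" where
  "eis_norm x = nat (eis1 x * eis1 x - eis1 x * eis2 x + eis2 x * eis2 x)"

lemma eis_norm_nonneg: "eis1 x * eis1 x - eis1 x * eis2 x + eis2 x * eis2 x \<ge> 0"
proof -
  have "4 * (eis1 x * eis1 x - eis1 x * eis2 x + eis2 x * eis2 x)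
      = (2 * eis1 x - eis2 x) * (2 * eis1 x - eis2 x) + 3 * (eis2 x * eis2 x)"
    by (simp add: algebra_simps)
  also have "\<dots> \<ge> 0" by (intro add_nonneg_nonneg mult_nonneg_nonneg zero_le_square) auto
  finally show ?thesis by simp
qed

lemma int_eis_norm: "int (eis_norm x) = eis1 x * eis1 x - eis1 x * eis2 x + eis2 x * eis2 x"
  using eis_norm_nonneg[of x] by (simp add: eis_norm_def)

lemma eis_norm_mult [simp]: "eis_norm (x * y) = eis_norm x * eis_norm y"
  by (simp add: int_eis_norm algebra_simps flip: of_nat_eq_iff[where ?'a = int])

lemma eis_norm_eq_0_iff [simp]: "eis_norm x = 0 \<longleftrightarrow> x = 0"
proof -
  have "eis_norm x = 0 \<longleftrightarrow> int (eis_norm x) = 0" by simp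
  also have "\<dots> \<longleftrightarrow> x = 0" unfolding int_eis_norm eis_sq_pos by (auto intro: eis_eqI)
  finally show ?thesis .
qed

lemma eis_norm_0_1 [simp]: "eis_norm 0 = 0" "eis_norm 1 = 1"
  by (auto simp: eis_norm_def)

lemma eis_norm_pos: "x \<noteq> 0 \<Longrightarrow> eis_norm x > 0"
  by (metis eis_norm_eq_0_iff gr0I)

lemma eis_norm_power [simp]: "eis_norm (x ^ n) = eis_norm x ^ n"
  by (induction n) auto

lemma eis_norm_cnj [simp]: "eis_norm (eis_cnj x) = eis_norm x"
  by (simp add: int_eis_norm algebra_simps flip: of_nat_eq_iff[where ?'a = int])

lemma eis_norm_minus [simp]: "eis_norm (- x) = eis_norm x"
  by (simp add: int_eis_norm algebra_simps flip: of_nat_eq_iff[where ?'a = int])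

lemma eis_norm_of_nat [simp]: "eis_norm (of_nat n) = n\<^sup>2"
  by (simp add: int_eis_norm power2_eq_square algebra_simps flip: of_nat_eq_iff[where ?'a = int])

lemma eis_mult_cnj: "x * eis_cnj x = of_nat (eis_norm x)"
  by (simp add: eis_eq_iff int_eis_norm algebra_simps)

lemma eis_of_nat_dvd_iff: "of_nat n dvd x \<longleftrightarrow> int n dvd eis1 x \<and> int n dvd eis2 x"
proof
  assume "int n dvd eis1 x \<and> int n dvd eis2 x"
  then obtain a b where "eis1 x = int n * a" "eis2 x = int n * b" by (auto elim!: dvdE)
  then have "x = of_nat n * Eis a b" by (simp add: eis_eq_iff)
  then show "of_nat n dvd x" by simp
qed (auto elim!: dvdE)

lemma eis_of_nat_dvd_of_nat_iff [simp]: "(of_nat n :: eis) dvd of_nat m \<longleftrightarrow> n dvd m"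
  by (simp add: eis_of_nat_dvd_iff)

lemma eis_norm_dvd: "x dvd y \<Longrightarrow> eis_norm x dvd eis_norm y"
  by (auto elim!: dvdE)

lemma eis_dvd_norm: "x dvd of_nat (eis_norm x)"
  by (metis dvd_triv_left eis_mult_cnj)

section \<open>Euclidean division and prime elements\<close>

instantiation eis :: euclidean_ring_cancel
begin

text \<open>Both coordinates of the quotient are rounded down; the remainder still has smaller norm.\<close>
definition divide_eis :: "eis \<Rightarrow> eis \<Rightarrow> eis" where
  "x div y = Eis (eis1 (x * eis_cnj y) div int (eis_norm y)) (eis2 (x * eis_cnj y) div int (eis_norm y))"

definition modulo_eis :: "eis \<Rightarrow> eis \<Rightarrow> eis" where
  "modulo_eis x y = x - x div y * y"

definition euclidean_size_eis :: "eis \<Rightarrow> nat" where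
  "euclidean_size_eis = eis_norm"

lemma eis_div_aux:
  fixes x y :: eis
  assumes "y \<noteq> 0"
  shows "eis_norm (x - x div y * y) < eis_norm y" "(x + c * y) div y = c + x div y"
    "c \<noteq> 0 \<Longrightarrow> (c * x) div (c * y) = x div y"
proof -
  define n where "n = int (eis_norm y)"
  have n: "n > 0" using assms by (simp add: n_def eis_norm_pos)
  define z where "z = x * eis_cnj y"
  define r where "r = x - x div y * y"
  have yy: "eis_cnj y * y = of_int n" by (simp add: n_def eis_mult_cnj mult.commute)
  have "r * eis_cnj y = z - x div y * of_int n"
    unfolding r_def z_def yy[symmetric] by (simp add: algebra_simps)
  also have "\<dots> = Eis (eis1 z mod n) (eis2 z mod n)"
    by (simp add: eis_eq_iff divide_eis_def n_def[symmetric] z_def[symmetric] minus_div_mult_eq_mod)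
  finally have rc: "r * eis_cnj y = Eis (eis1 z mod n) (eis2 z mod n)" .
  have "int (eis_norm r * eis_norm y) = int (eis_norm (r * eis_cnj y))" by simp
  also have "\<dots> = (eis1 z mod n) * (eis1 z mod n)
      - (eis1 z mod n) * (eis2 z mod n) + (eis2 z mod n) * (eis2 z mod n)"
    unfolding rc int_eis_norm by simp
  also have "\<dots> < n * n"
  proof -
    \<comment> \<open>On the square 0 \<le> a, b < n the form a^2 - a b + b^2 is at most max(a,
      b)^2, because a b is at least the square of the smaller coordinate. This is why rounding down
      is enough.\<close>
    define a b where "a = eis1 z mod n" and "b = eis2 z mod n"
    have ab: "0 \<le> a" "a < n" "0 \<le> b" "b < n" using n by (auto simp: a_def b_def)
    have "a * a - a * b + b * b < n * n"
    proof (cases "a \<le> b")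
      case True
      then have "a * a \<le> a * b" using ab by (intro mult_left_mono) auto
      moreover have "b * b < n * n" using ab by (intro mult_strict_mono) auto
      ultimately show ?thesis by linarith
    next
      case False
      then have "b * b \<le> a * b" using ab by (intro mult_right_mono) auto
      moreover have "a * a < n * n" using ab by (intro mult_strict_mono) auto
      ultimately show ?thesis by linarith
    qed
    then show ?thesis by (simp add: a_def b_def)
  qed
  finally have "int (eis_norm r) * n < n * n" by (simp add: n_def)
  then show "eis_norm (x - x div y * y) < eis_norm y" using n by (simp add: r_def n_def)
  have "(x + c * y) * eis_cnj y = z + c * of_int n"
    unfolding z_def yy[symmetric] by (simp add: algebra_simps)
  then show "(x + c * y) div y = c + x div y"
    using n unfolding divide_eis_def n_def[symmetric] z_def[symmetric]
    by (simp add: eis_eq_iff)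
  assume "c \<noteq> 0"
  then have c: "int (eis_norm c) > 0" using eis_norm_pos by simp
  have "(c * x) * eis_cnj (c * y) = of_nat (eis_norm c) * z"
    unfolding eis_mult_cnj[symmetric] z_def by (simp add: algebra_simps)
  then show "(c * x) div (c * y) = x div y"
    using c unfolding divide_eis_def z_def[symmetric] \<open>(c * x) * eis_cnj (c * y) = of_nat (eis_norm c) * z\<close>
    by auto
qed

instance
proof
  fix x y c d :: eis
  show "x * y div y = x" if "y \<noteq> 0"
    using eis_div_aux(2)[OF that, of 0 x] by (simp add: divide_eis_def eis_eq_iff)
  show "x div 0 = 0" by (simp add: divide_eis_def eis_eq_iff)
  show "x div y * y + x mod y = x" by (simp add: modulo_eis_def)
  show "euclidean_size (0::eis) = 0" by (simp add: euclidean_size_eis_def)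
  show "euclidean_size (x mod y) < euclidean_size y" if "y \<noteq> 0"
    using eis_div_aux(1)[OF that] by (simp add: euclidean_size_eis_def modulo_eis_def)
  show "euclidean_size x \<le> euclidean_size (x * y)" if "y \<noteq> 0"
    using eis_norm_pos[OF that] by (simp add: euclidean_size_eis_def)
  show "(x + c * y) div y = c + x div y" if "y \<noteq> 0" using eis_div_aux(2)[OF that] .
  show "(c * x) div (c * y) = x div y" if "c \<noteq> 0"
    using that eis_div_aux(3) by (cases "y = 0") (auto simp: divide_eis_def eis_eq_iff)
qed

end

lemma eis_norm_mod: "y \<noteq> 0 \<Longrightarrow> eis_norm (x mod y) < eis_norm y"
  using mod_size_less[of y x] by (simp add: euclidean_size_eis_def)

lemma eis_is_unit_iff: "is_unit x \<longleftrightarrow> eis_norm x = 1"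
proof
  assume "is_unit x"
  then have "eis_norm x dvd eis_norm 1" by (rule eis_norm_dvd)
  then show "eis_norm x = 1" by simp
next
  assume "eis_norm x = 1"
  then show "is_unit x" using eis_dvd_norm[of x] by simp
qed

lemma eis_bezout:
  fixes x y :: eis
  obtains d u v where "d dvd x" "d dvd y" "d = u * x + v * y"
proof (induction "eis_norm y" arbitrary: x y thesis rule: less_induct)
  case less
  show ?case
  proof (cases "y = 0")
    case True
    then show ?thesis using less.prems[of x 1 0] by simp
  next
    case False
    obtain d u v where d: "d dvd y" "d dvd x mod y" "d = u * y + v * (x mod y)"
      using less.hyps[OF eis_norm_mod[OF False]] by blast
    have "d dvd x" using d(1,2) by (simp add: dvd_mod_iff)
    moreover have "d = v * x + (u - v * (x div y)) * y"
      unfolding d(3) modulo_eis_def by (simp add: algebra_simps)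
    ultimately show ?thesis using less.prems d(1) by blast
  qed
qed

lemma eis_irreducible_imp_prime_elem:
  fixes p :: eis
  assumes "irreducible p"
  shows "prime_elem p"
proof (rule prime_elemI)
  show "p \<noteq> 0" "\<not> is_unit p" using assms by (auto simp: irreducible_def)
  fix a b assume ab: "p dvd a * b"
  obtain d u v where d: "d dvd p" "d dvd a" "d = u * p + v * a"
    using eis_bezout by blast
  obtain e where e: "p = d * e" using d(1) by blast
  then have "is_unit d \<or> is_unit e" using irreducibleD[OF assms] by blast
  then show "p dvd a \<or> p dvd b"
  proof
    assume "is_unit d"
    have "p dvd u * p * b + v * (a * b)" using ab by simp
    also have "u * p * b + v * (a * b) = d * b" unfolding d(3) by (simp add: algebra_simps)
    finally show ?thesis using \<open>is_unit d\<close> by (simp add: dvd_mult_unit_iff')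
  next
    assume "is_unit e"
    then have "p dvd d" using e by simp
    then show ?thesis using d(2) dvd_trans by blast
  qed
qed

lemma eis_prime_divisor_exists:
  fixes x :: eis
  assumes "x \<noteq> 0" "\<not> is_unit x"
  obtains p where "prime_elem p" "p dvd x"
  using assms
proof (induction "eis_norm x" arbitrary: x thesis rule: less_induct)
  case less
  show ?case
  proof (cases "irreducible x")
    case True
    then show ?thesis using less.prems(1)[of x] eis_irreducible_imp_prime_elem by simp
  next
    case False
    then obtain a b where ab: "x = a * b" "\<not> is_unit a" "\<not> is_unit b"
      using less.prems(2,3) unfolding irreducible_def by blast
    have "a \<noteq> 0" "b \<noteq> 0" using ab less.prems by auto
    moreover have "eis_norm b > 1"
      using \<open>b \<noteq> 0\<close> ab(3) eis_norm_pos[of b] by (simp add: eis_is_unit_iff)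
    ultimately have "eis_norm a < eis_norm x" using ab(1) eis_norm_pos[of a] by simp
    then obtain p where "prime_elem p" "p dvd a"
      using less.hyps[of a] \<open>a \<noteq> 0\<close> ab(2) by blast
    then show ?thesis using less.prems(1)[of p] ab(1) by simp
  qed
qed

lemma eis_inverse_mod_prime:
  fixes p x :: eis
  assumes "prime_elem p" "\<not> p dvd x"
  obtains y where "p dvd x * y - 1"
proof -
  obtain d u v where d: "d dvd p" "d dvd x" "d = u * p + v * x"
    using eis_bezout by blast
  obtain e where e: "p = d * e" using d(1) by blast
  have "\<not> is_unit e" using d(2) e assms(2) by (metis dvd_mult_unit_iff dvd_refl dvd_trans)
  then have "is_unit d"
    using irreducibleD[OF prime_elem_imp_irreducible[OF assms(1)] e] by blast
  then obtain w where w: "d * w = 1" by (metis dvdE)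
  have "x * (v * w) - 1 = p * (- u * w)"
    using w unfolding d(3) by (simp add: algebra_simps eq_diff_eq)
  then show ?thesis using that by (metis dvd_triv_left)
qed

section \<open>Primary elements and primary primes\<close>

definition primary :: "eis \<Rightarrow> bool" where
  "primary x \<longleftrightarrow> 3 dvd x - 1"

lemma eis_3_dvd_iff: "(3::eis) dvd x \<longleftrightarrow> 3 dvd eis1 x \<and> 3 dvd eis2 x"
  using eis_of_nat_dvd_iff[of 3 x] by simp

lemma primary_iff: "primary x \<longleftrightarrow> eis1 x mod 3 = 1 \<and> eis2 x mod 3 = 0"
  unfolding primary_def eis_3_dvd_iff by (simp add: mod_eq_dvd_iff dvd_eq_mod_eq_0) presburger

lemma primary_1 [simp]: "primary 1" by (simp add: primary_def)

lemma primary_mult: "primary x \<Longrightarrow> primary y \<Longrightarrow> primary (x * y)"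
proof -
  assume "primary x" "primary y"
  then have "3 dvd (x - 1) * y + (y - 1)" unfolding primary_def by (intro dvd_add dvd_mult2)
  then show ?thesis by (simp add: primary_def algebra_simps)
qed

lemma primary_power: "primary x \<Longrightarrow> primary (x ^ n)"
  by (induction n) (auto intro: primary_mult)

lemma primary_cnj: "primary x \<Longrightarrow> primary (eis_cnj x)"
  unfolding primary_iff by (simp; presburger)

lemma primary_nonzero: "primary x \<Longrightarrow> x \<noteq> 0"
  by (auto simp: primary_iff)

lemma primary_mult_cancel: "primary x \<Longrightarrow> primary (x * y) \<Longrightarrow> primary y"
proof -
  assume "primary x" "primary (x * y)"
  then have "3 dvd (x * y - 1) - (x - 1) * y" unfolding primary_def by (metis dvd_diff dvd_mult2)
  also have "(x * y - 1) - (x - 1) * y = y - 1" by (simp add: algebra_simps)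
  finally show ?thesis by (simp add: primary_def)
qed

lemma primary_unit_eq_1:
  assumes "primary x" "is_unit x"
  shows "x = 1"
proof -
  define a b where "a = eis1 x" and "b = eis2 x"
  have n: "a * a - a * b + b * b = 1"
    using assms(2) int_eis_norm[of x] by (simp add: eis_is_unit_iff a_def b_def)
  then have "(2 * a - b) * (2 * a - b) + 3 * (b * b) = 4" by (simp add: algebra_simps)
  moreover have "(2 * a - b) * (2 * a - b) \<ge> 0" by auto
  ultimately have "b * b \<le> 1" by linarith
  then have "\<bar>b\<bar> \<le> 1" using abs_square_le_1[of b] by (simp add: power2_eq_square)
  moreover have "b mod 3 = 0" using assms(1) by (simp add: primary_iff b_def)
  ultimately have b: "b = 0" by presburger
  then have "\<bar>a\<bar> = 1" using n by (simp add: abs_square_eq_1 flip: power2_eq_square)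
  moreover have "a mod 3 = 1" using assms(1) by (simp add: primary_iff a_def)
  ultimately have "a = 1" by presburger
  then show ?thesis using b by (simp add: eis_eq_iff a_def b_def)
qed

lemma primary_associated_eq:
  assumes "primary x" "primary y" "x dvd y" "y dvd x"
  shows "x = y"
proof -
  obtain u where u: "y = x * u" using assms(3) by blast
  have "is_unit u" using u assms(4) primary_nonzero[OF assms(1)]
    by (metis dvd_times_left_cancel_iff mult.right_neutral)
  moreover have "primary u" using primary_mult_cancel assms(1,2) u by blast
  ultimately show ?thesis using primary_unit_eq_1 u by simp
qed

text \<open>Modulo 3 the norm form is the square of a + b: the prime 3 ramifies.\<close>

lemma eis_norm_mod_3: "3 dvd int (eis_norm x) \<longleftrightarrow> 3 dvd eis1 x + eis2 x"
proof -
  have "int (eis_norm x) = (eis1 x + eis2 x) * (eis1 x + eis2 x) - 3 * (eis1 x * eis2 x)"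
    by (simp add: int_eis_norm algebra_simps)
  then have "3 dvd int (eis_norm x) \<longleftrightarrow> 3 dvd (eis1 x + eis2 x) * (eis1 x + eis2 x)"
    by (simp add: dvd_diff_left_iff)
  also have "\<dots> \<longleftrightarrow> 3 dvd eis1 x + eis2 x"
    by (subst prime_dvd_mult_iff) auto
  finally show ?thesis .
qed

text \<open>There are six units and six invertible classes modulo 3, and the units represent these
  classes. The cases run through the classes and multiply by the inverse unit.\<close>

lemma primary_associate_exists:
  assumes "\<not> 3 dvd eis_norm x"
  obtains u where "is_unit u" "primary (u * x)"
proof -
  define a b where "a = eis1 x mod 3" and "b = eis2 x mod 3"
  have n: "\<not> 3 dvd eis1 x + eis2 x"
    using assms eis_norm_mod_3[of x] by (metis of_nat_dvd_iff of_nat_numeral)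
  have P: "\<exists>u. is_unit u \<and> primary (u * x)"
    if "eis_norm v = 1" "(eis1 (v * x)) mod 3 = 1" "(eis2 (v * x)) mod 3 = 0" for v
    using that by (intro exI[of _ v]) (simp only: eis_is_unit_iff primary_iff)
  have "(a + b) mod 3 \<noteq> 0" unfolding a_def b_def mod_add_eq using n by (simp add: dvd_eq_mod_eq_0)
  then have "a + b \<noteq> 0 \<and> a + b \<noteq> 3" by auto
  moreover have "0 \<le> a \<and> a < 3 \<and> 0 \<le> b \<and> b < 3" by (simp add: a_def b_def)
  ultimately have "a = 1 \<and> b = 0 \<or> a = 0 \<and> b = 1 \<or> a = 1 \<and> b = 1 \<or> a = 2 \<and> b = 0
    \<or> a = 0 \<and> b = 2 \<or> a = 2 \<and> b = 2" by presburger
  then consider "a = 1" "b = 0" | "a = 0" "b = 1" | "a = 1" "b = 1" | "a = 2" "b = 0"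
    | "a = 0" "b = 2" | "a = 2" "b = 2" by blast
  then have "\<exists>u. is_unit u \<and> primary (u * x)"
  proof cases
    case 1 then show ?thesis unfolding a_def b_def by (intro P[of "Eis 1 0"]; simp add: eis_norm_def)
  next
    case 2 then show ?thesis unfolding a_def b_def
      by (intro P[of "Eis (-1) (-1)"]) (simp_all add: eis_norm_def, presburger+)
  next
    case 3 then show ?thesis unfolding a_def b_def
      by (intro P[of "Eis 0 (-1)"]) (simp_all add: eis_norm_def, presburger+)
  next
    case 4 then show ?thesis unfolding a_def b_def
      by (intro P[of "Eis (-1) 0"]) (simp_all add: eis_norm_def, presburger+)
  next
    case 5 then show ?thesis unfolding a_def b_def
      by (intro P[of "Eis 1 1"]) (simp_all add: eis_norm_def, presburger+)
  next
    case 6 then show ?thesis unfolding a_def b_def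
      by (intro P[of "Eis 0 1"]) (simp_all add: eis_norm_def, presburger+)
  qed
  then show ?thesis using that by blast
qed

lemma primary_norm: "primary x \<Longrightarrow> eis_norm x mod 3 = 1"
proof -
  assume "primary x"
  then have "eis1 x mod 3 = 1" "eis2 x mod 3 = 0" by (auto simp: primary_iff)
  define a b where "a = eis1 x div 3" and "b = eis2 x div 3"
  have "eis1 x = 3 * a + 1" "eis2 x = 3 * b"
    using \<open>eis1 x mod 3 = 1\<close> \<open>eis2 x mod 3 = 0\<close> unfolding a_def b_def by presburger+
  then have "int (eis_norm x) = 3 * (3 * a * a + 2 * a - 3 * a * b - b + 3 * b * b) + 1"
    by (simp add: int_eis_norm algebra_simps)
  then have "int (eis_norm x) mod 3 = 1" by presburger
  then show ?thesis by presburger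
qed

text \<open>These elements stand for the prime ideals not dividing 3, one generator for
  each.\<close>

definition pprime :: "eis \<Rightarrow> bool" where
  "pprime p \<longleftrightarrow> prime_elem p \<and> primary p"

lemma pprime_prime_elem: "pprime p \<Longrightarrow> prime_elem p" and pprime_primary: "pprime p \<Longrightarrow> primary p"
  by (auto simp: pprime_def)

lemma prime_elem_dvd_prime_elem:
  fixes p q :: "'a :: algebraic_semidom"
  shows "prime_elem p \<Longrightarrow> prime_elem q \<Longrightarrow> p dvd q \<Longrightarrow> q dvd p"
  by (metis irreducibleD' prime_elem_imp_irreducible prime_elem_not_unit)

lemma pprime_dvd_pprime: "pprime p \<Longrightarrow> pprime q \<Longrightarrow> p dvd q \<Longrightarrow> p = q"
  using prime_elem_dvd_prime_elem primary_associated_eq unfolding pprime_def by blast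

lemma pprime_cnj: "pprime p \<Longrightarrow> pprime (eis_cnj p)"
proof -
  assume p: "pprime p"
  have "prime_elem (eis_cnj p)"
  proof (rule prime_elemI)
    show "eis_cnj p \<noteq> 0" using p by (auto simp: pprime_def)
    show "\<not> is_unit (eis_cnj p)" using p eis_cnj_dvd_iff[of p 1] by (auto simp: pprime_def)
    fix a b assume "eis_cnj p dvd a * b"
    then have "p dvd eis_cnj a * eis_cnj b"
      using eis_cnj_dvd_iff[of p "eis_cnj (a * b)"] by simp
    then have "p dvd eis_cnj a \<or> p dvd eis_cnj b"
      using p by (simp add: pprime_def prime_elem_dvd_mult_iff)
    then show "eis_cnj p dvd a \<or> eis_cnj p dvd b"
      using eis_cnj_dvd_iff[of p "eis_cnj a"] eis_cnj_dvd_iff[of p "eis_cnj b"] by simp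
  qed
  then show ?thesis using p by (auto simp: pprime_def primary_cnj)
qed

text \<open>Norm 4, attained by -2, is just large enough to keep 0 and the three cube roots of unity
  apart modulo \<open>p\<close>.\<close>

lemma pprime_norm_ge_4: "pprime p \<Longrightarrow> eis_norm p \<ge> 4"
proof -
  assume p: "pprime p"
  then have "eis_norm p \<noteq> 1" "eis_norm p \<noteq> 0"
    using prime_elem_not_unit[of p] eis_is_unit_iff[of p] by (auto simp: pprime_def)
  moreover have "eis_norm p mod 3 = 1" using p primary_norm by (simp add: pprime_def)
  ultimately show ?thesis by presburger
qed

lemma pprime_divisor_exists:
  assumes "primary x" "x \<noteq> 1"
  obtains p where "pprime p" "p dvd x"
proof -
  obtain q where q: "prime_elem q" "q dvd x"
    using eis_prime_divisor_exists assms primary_unit_eq_1 primary_nonzero by metis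
  have "\<not> 3 dvd eis_norm x" using primary_norm[OF assms(1)] by presburger
  then have "\<not> 3 dvd eis_norm q" using eis_norm_dvd[OF q(2)] dvd_trans by blast
  then obtain u where u: "is_unit u" "primary (u * q)" using primary_associate_exists by blast
  then have "pprime (u * q)" using q(1) by (simp add: pprime_def prime_elem_mult_unit_left)
  moreover have "u * q dvd x" using u(1) q(2) by (simp add: mult_unit_dvd_iff')
  ultimately show ?thesis using that by blast
qed

text \<open>A primary element is a product of primary primes with no unit left over, because 1 is
  the only primary unit. Counting prime power divisors uses factorisation in this form.\<close>

lemma primary_induct [consumes 1, case_names one mult]:
  assumes "primary x" "P 1" "\<And>p y. pprime p \<Longrightarrow> primary y \<Longrightarrow> P y \<Longrightarrow> P (p * y)"
  shows "P x"
  using assms(1)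
proof (induction "eis_norm x" arbitrary: x rule: less_induct)
  case less
  show ?case
  proof (cases "x = 1")
    case False
    obtain p where p: "pprime p" "p dvd x" using pprime_divisor_exists less.prems False by blast
    then obtain y where y: "x = p * y" by blast
    have "primary y" using primary_mult_cancel pprime_primary p(1) less.prems y by blast
    moreover have "eis_norm y < eis_norm x"
      using pprime_norm_ge_4[OF p(1)] eis_norm_pos[OF primary_nonzero[OF \<open>primary y\<close>]] y by simp
    ultimately show ?thesis using less.hyps assms(3) p(1) y by blast
  qed (use assms(2) in simp)
qed

lemma pprime_not_dvd_3: "pprime p \<Longrightarrow> \<not> p dvd 3"
proof
  assume p: "pprime p" "p dvd 3"
  then have "p dvd p - 3 * ((p - 1) div 3)" by simp
  moreover have "p - 3 * ((p - 1) div 3) = 1"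
    using p(1) by (simp add: pprime_def primary_def)
  ultimately show False using p(1) prime_elem_not_unit by (auto simp: pprime_def)
qed

text \<open>Some rational prime factor l of the norm is divisible by \<open>p\<close>, and then N(p)
  divides N(l) = l^2.\<close>

lemma pprime_rational_prime:
  assumes "pprime p"
  obtains l e where "prime l" "p dvd of_nat l" "e > 0" "eis_norm p = l ^ e" "l \<noteq> 3" "l ^ 2 mod 3 = 1"
proof -
  have "eis_norm p \<noteq> 0" using pprime_norm_ge_4[OF assms] by linarith
  have ex: "\<exists>l. prime l \<and> p dvd of_nat l" if "n \<noteq> 0" "p dvd of_nat n" for n
    using that
  proof (induction n rule: prime_divisors_induct)
    case (unit n) then show ?case using assms prime_elem_not_unit by (auto simp: pprime_def)
  next
    case (factor q n)
    then show ?case using assms by (auto simp: pprime_def prime_elem_dvd_mult_iff)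
  qed auto
  obtain l where l: "prime l" "p dvd of_nat l" using ex[OF \<open>eis_norm p \<noteq> 0\<close> eis_dvd_norm] by blast
  then have "eis_norm p dvd l ^ 2" using eis_norm_dvd[OF l(2)] by simp
  then obtain e where e: "eis_norm p = l ^ e" using l(1) divides_primepow_nat by blast
  have "e > 0" using pprime_norm_ge_4[OF assms] e by (cases e) auto
  have l3: "l \<noteq> 3" using l(2) pprime_not_dvd_3[OF assms] by auto
  have "\<not> 3 dvd l" using l3 l(1) primes_dvd_imp_eq[of 3 l] by auto
  then have "l mod 3 = 1 \<or> l mod 3 = 2" by presburger
  then have "(l mod 3) ^ 2 mod 3 = 1" by auto
  then have "l ^ 2 mod 3 = 1" by (simp add: power_mod)
  then show ?thesis using that l e \<open>e > 0\<close> l3 by blast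
qed

section \<open>Residue systems\<close>

text \<open>The residue ring is modelled by the remainders of Euclidean division, and functions on
  it by \<open>periodic\<close> functions on all of \<open>eis\<close>.\<close>

definition reps :: "eis \<Rightarrow> eis set" where
  "reps m = range (\<lambda>x. x mod m)"

definition periodic :: "eis \<Rightarrow> (eis \<Rightarrow> 'a) \<Rightarrow> bool" where
  "periodic m f \<longleftrightarrow> (\<forall>x y. m dvd x - y \<longrightarrow> f x = f y)"

lemma periodicD: "periodic m f \<Longrightarrow> m dvd x - y \<Longrightarrow> f x = f y"
  by (simp add: periodic_def)

lemma periodic_mod: "periodic m f \<Longrightarrow> f (x mod m) = f x"
  by (metis mod_eq_dvd_iff mod_mod_trivial periodicD)

lemma periodic_dvd: "periodic m f \<Longrightarrow> m dvd n \<Longrightarrow> periodic n f"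
  unfolding periodic_def using dvd_trans by blast

lemma mod_in_reps [simp]: "x mod m \<in> reps m"
  by (simp add: reps_def)

lemma reps_mod: "x \<in> reps m \<Longrightarrow> x mod m = x"
  by (auto simp: reps_def)

lemma reps_eqI: "x \<in> reps m \<Longrightarrow> y \<in> reps m \<Longrightarrow> m dvd x - y \<Longrightarrow> x = y"
  by (metis mod_eq_dvd_iff reps_mod)

lemma mod_eis_of_nat:
  "x mod of_nat n = Eis (eis1 x mod int n) (eis2 x mod int n)"
proof (cases "n = 0")
  case False
  then show ?thesis
    by (simp add: modulo_eis_def divide_eis_def eis_eq_iff power2_eq_square minus_div_mult_eq_mod)
qed (simp add: eis_eq_iff)

lemma reps_of_nat: "n > 0 \<Longrightarrow> reps (of_nat n) = (\<lambda>(a, b). Eis a b) ` ({0..<int n} \<times> {0..<int n})"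
proof -
  assume n: "n > 0"
  have "Eis a b \<in> reps (of_nat n)" if "a \<in> {0..<int n}" "b \<in> {0..<int n}" for a b
    using that mod_in_reps[of "Eis a b" "of_nat n"] unfolding mod_eis_of_nat by simp
  then show ?thesis using n by (auto simp: reps_def mod_eis_of_nat image_iff)
qed

lemma finite_reps: "m \<noteq> 0 \<Longrightarrow> finite (reps m)"
proof -
  assume "m \<noteq> 0"
  then have n: "eis_norm m > 0" by (rule eis_norm_pos)
  have "x mod m \<in> (\<lambda>x. x mod m) ` reps (of_nat (eis_norm m))" for x
    using eis_dvd_norm[of m] by (intro image_eqI[of _ _ "x mod of_nat (eis_norm m)"]) (simp_all add: mod_mod_cancel)
  then have "reps m \<subseteq> (\<lambda>x. x mod m) ` reps (of_nat (eis_norm m))" by (auto simp: reps_def)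
  then show ?thesis by (rule finite_subset) (simp add: reps_of_nat[OF n])
qed

lemma bij_reps:
  assumes "m \<noteq> 0" "\<And>x y. m dvd h x - h y \<Longrightarrow> m dvd x - y"
  shows "bij_betw (\<lambda>x. h x mod m) (reps m) (reps m)"
proof -
  have inj: "inj_on (\<lambda>x. h x mod m) (reps m)"
    using assms(2) reps_eqI by (auto simp: inj_on_def mod_eq_dvd_iff)
  moreover have "(\<lambda>x. h x mod m) ` reps m \<subseteq> reps m" by auto
  ultimately show ?thesis
    using endo_inj_surj[OF finite_reps[OF assms(1)]] by (simp add: bij_betw_def)
qed

lemma sum_reps_bij:
  assumes "m \<noteq> 0" "periodic m f" "\<And>x y. m dvd h x - h y \<Longrightarrow> m dvd x - y"
  shows "(\<Sum>x\<in>reps m. f (h x)) = (\<Sum>x\<in>reps m. f x)"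
proof -
  have "(\<Sum>x\<in>reps m. f (h x)) = (\<Sum>x\<in>reps m. f (h x mod m))"
    using assms(2) by (simp add: periodic_mod)
  also have "\<dots> = (\<Sum>x\<in>reps m. f x)"
    using sum.reindex_bij_betw[OF bij_reps[OF assms(1,3)]] .
  finally show ?thesis .
qed

lemma sum_reps_shift: "m \<noteq> 0 \<Longrightarrow> periodic m f \<Longrightarrow> (\<Sum>x\<in>reps m. f (x + c)) = (\<Sum>x\<in>reps m. f x)"
  by (rule sum_reps_bij) (auto simp: algebra_simps)

lemma dvd_mult_invertible:
  fixes m :: "'a :: comm_ring_1"
  assumes "m dvd c * d - 1" "m dvd c * x"
  shows "m dvd x"
proof -
  have "m dvd (c * x) * d - (c * d - 1) * x" using assms by (intro dvd_diff) auto
  then show ?thesis by (simp add: algebra_simps)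
qed

lemma sum_reps_mult:
  assumes "m \<noteq> 0" "periodic m f" "m dvd c * d - 1"
  shows "(\<Sum>x\<in>reps m. f (c * x)) = (\<Sum>x\<in>reps m. f x)"
proof (rule sum_reps_bij[OF assms(1,2)])
  fix x y assume "m dvd c * x - c * y"
  then have "m dvd c * (x - y)" by (simp only: right_diff_distrib)
  then show "m dvd x - y" by (rule dvd_mult_invertible[OF assms(3)])
qed

text \<open>Residues modulo a b are written with two digits, r + a q. Unlike the Chinese remainder
  theorem this also covers factors with a common divisor, such as an element and its
  conjugate.\<close>

lemma sum_reps_product:
  assumes "a \<noteq> 0" "b \<noteq> 0" "periodic (a * b) f"
  shows "(\<Sum>x\<in>reps (a * b). f x) = (\<Sum>q\<in>reps b. \<Sum>r\<in>reps a. f (r + a * q))"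
proof -
  have "bij_betw (\<lambda>(q, r). (r + a * q) mod (a * b)) (reps b \<times> reps a) (reps (a * b))"
  proof (rule bij_betwI[where g = "\<lambda>x. ((x div a) mod b, x mod a)"])
    show "(\<lambda>x. (x div a mod b, x mod a)) \<in> reps (a * b) \<rightarrow> reps b \<times> reps a" by auto
  next
    fix z assume "z \<in> reps b \<times> reps a"
    then obtain q r where z: "z = (q, r)" "q mod b = q" "r mod a = r" by (auto simp: reps_mod)
    define y where "y = (r + a * q) mod (a * b)"
    have "y mod a = r" using z by (simp add: y_def mod_mod_cancel)
    obtain k where k: "r + a * q = y + a * b * k"
      unfolding y_def by (metis mod_div_mult_eq mult.commute)
    have "r div a = 0"
      using z(3) assms(1) by (metis add_cancel_right_left div_mult_mod_eq mult_eq_0_iff)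
    then have "(r + a * q) div a = q" using assms(1) by simp
    moreover have "(y + a * b * k) div a = y div a + b * k"
      using assms(1) by (simp add: mult.assoc add.commute)
    ultimately have "y div a mod b = q" using k z(2) by (metis mod_mult_self2)
    then show "(\<lambda>x. (x div a mod b, x mod a)) ((\<lambda>(q, r). (r + a * q) mod (a * b)) z) = z"
      using z \<open>y mod a = r\<close> by (simp add: y_def)
  next
    fix x assume "x \<in> reps (a * b)"
    then have x: "x mod (a * b) = x" by (rule reps_mod)
    have "a * b dvd a * ((x div a) mod b) - a * (x div a)"
      using assms by (simp add: dvd_times_left_cancel_iff mod_eq_dvd_iff[symmetric] flip: right_diff_distrib)
    also have "\<dots> = (x mod a + a * ((x div a) mod b)) - x"
      by (simp add: algebra_simps minus_mult_div_eq_mod[symmetric])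
    finally have "(x mod a + a * ((x div a) mod b)) mod (a * b) = x mod (a * b)"
      by (simp add: mod_eq_dvd_iff)
    then show "(\<lambda>(q, r). (r + a * q) mod (a * b)) (x div a mod b, x mod a) = x" using x by simp
  qed auto
  from sum.reindex_bij_betw[OF this, of f]
  have "(\<Sum>x\<in>reps (a * b). f x) = (\<Sum>z\<in>reps b \<times> reps a. f ((\<lambda>(q, r). (r + a * q) mod (a * b)) z))"
    by simp
  also have "\<dots> = (\<Sum>(q, r)\<in>reps b \<times> reps a. f (r + a * q))"
    by (intro sum.cong) (auto simp: periodic_mod[OF assms(3)])
  finally show ?thesis by (simp add: sum.cartesian_product)
qed

text \<open>Modulo m times its conjugate, a rational integer, residues can be counted by
  coordinates. The two factors have equally many residues, by conjugation, so the count is a square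
  whose root is wanted.\<close>

lemma card_reps: "m \<noteq> 0 \<Longrightarrow> card (reps m) = eis_norm m"
proof -
  assume m: "m \<noteq> 0"
  have "bij_betw (\<lambda>x. eis_cnj x mod eis_cnj m) (reps m) (reps (eis_cnj m))"
  proof (rule bij_betwI[where g = "\<lambda>x. eis_cnj x mod m"])
    have *: "eis_cnj (eis_cnj x mod eis_cnj m) mod m = x"
      if "x mod m = x" for x m
    proof -
      have "eis_cnj m dvd eis_cnj x mod eis_cnj m - eis_cnj x" by (simp flip: mod_eq_dvd_iff)
      then have "m dvd eis_cnj (eis_cnj x mod eis_cnj m) - x"
        using eis_cnj_dvd_iff[of m "eis_cnj (eis_cnj x mod eis_cnj m) - x"] by simp
      then show ?thesis using that by (simp flip: mod_eq_dvd_iff)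
    qed
    show "x \<in> reps m \<Longrightarrow> eis_cnj (eis_cnj x mod eis_cnj m) mod m = x" for x
      using * reps_mod by blast
    show "x \<in> reps (eis_cnj m) \<Longrightarrow> eis_cnj (eis_cnj x mod m) mod eis_cnj m = x" for x
      using *[of x "eis_cnj m"] reps_mod by simp
  qed auto
  then have "card (reps (eis_cnj m)) = card (reps m)" by (metis bij_betw_same_card)
  moreover have "card (reps (m * eis_cnj m)) = card (reps m) * card (reps (eis_cnj m))"
    using sum_reps_product[of m "eis_cnj m" "\<lambda>_. 1 :: nat"] m
    by (simp add: periodic_def)
  moreover have "card (reps (m * eis_cnj m)) = eis_norm m * eis_norm m"
    unfolding eis_mult_cnj reps_of_nat[OF eis_norm_pos[OF m]]
    by (subst card_image) (auto simp: inj_on_def card_cartesian_product)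
  ultimately have "card (reps m) ^ 2 = eis_norm m ^ 2" by (simp add: power2_eq_square)
  then show ?thesis by (simp add: power2_eq_iff_nonneg)
qed

lemma sum_reps_delta:
  assumes "m \<noteq> 0" "periodic m f"
  shows "(\<Sum>x\<in>reps m. if m dvd x - a then f x else 0) = f a"
proof -
  have "(\<Sum>x\<in>reps m. if m dvd x - a then f x else 0) = (\<Sum>x\<in>reps m. if x = a mod m then f x else 0)"
    by (intro sum.cong refl if_cong) (metis mod_eq_dvd_iff reps_mod mod_mod_trivial)
  also have "\<dots> = f a" using finite_reps[OF assms(1)] periodic_mod[OF assms(2)] by simp
  finally show ?thesis .
qed

lemma sum_reps_mult_cong:
  assumes "m \<noteq> 0" "\<And>x y. m dvd x - y \<Longrightarrow> m dvd f x - f y" "m dvd c * d - 1"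
  shows "m dvd (\<Sum>x\<in>reps m. f (c * x)) - (\<Sum>x\<in>reps m. f x)"
proof -
  have "(\<Sum>x\<in>reps m. f (c * x) mod m) = (\<Sum>x\<in>reps m. f x mod m)"
    using assms(2) by (intro sum_reps_mult[OF assms(1) _ assms(3)]) (simp add: periodic_def mod_eq_dvd_iff)
  then have "(\<Sum>x\<in>reps m. f (c * x)) mod m = (\<Sum>x\<in>reps m. f x) mod m"
    by (metis mod_sum_eq)
  then show ?thesis by (simp add: mod_eq_dvd_iff)
qed

lemma dvd_power_diff: "(m::'a::comm_ring_1) dvd x - y \<Longrightarrow> m dvd x ^ n - y ^ n"
  by (metis dvd_trans dvd_triv_left power_diff_sumr2)

lemma dvd_mult_diff: "(m::'a::comm_ring_1) dvd x - y \<Longrightarrow> m dvd u - v \<Longrightarrow> m dvd x * u - y * v"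
proof -
  assume "m dvd x - y" "m dvd u - v"
  then have "m dvd (x - y) * u + y * (u - v)" by (intro dvd_add) auto
  then show ?thesis by (simp add: algebra_simps)
qed

lemma dvd_diff_trans: "(m::'a::comm_ring_1) dvd x - y \<Longrightarrow> m dvd y - z \<Longrightarrow> m dvd x - z"
  using dvd_add[of m "x - y" "y - z"] by simp

lemma dvd_diff_sym: "(m::'a::comm_ring_1) dvd x - y \<Longrightarrow> m dvd y - x"
  by (metis dvd_minus_iff minus_diff_eq)

section \<open>The cubic residue character\<close>

lemma pprime_nonzero: "pprime p \<Longrightarrow> p \<noteq> 0"
  by (auto simp: pprime_def)

lemma pprime_dvd_mult_iff: "pprime p \<Longrightarrow> p dvd x * y \<longleftrightarrow> p dvd x \<or> p dvd y"
  by (simp add: pprime_def prime_elem_dvd_mult_iff)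

lemma pprime_dvd_power_iff: "pprime p \<Longrightarrow> n > 0 \<Longrightarrow> p dvd x ^ n \<longleftrightarrow> p dvd x"
  by (simp add: pprime_def prime_elem_dvd_power_iff)

lemma pprime_not_dvd_1: "pprime p \<Longrightarrow> \<not> p dvd 1"
  using prime_elem_not_unit by (auto simp: pprime_def)

lemma prime_elem_dvd_prod:
  fixes p :: eis
  shows "finite A \<Longrightarrow> prime_elem p \<Longrightarrow> p dvd prod f A \<Longrightarrow> \<exists>x\<in>A. p dvd f x"
proof (induction A rule: finite_induct)
  case empty
  then show ?case by (metis prime_elem_not_unit prod.empty)
next
  case (insert x F)
  have "p dvd f x * prod f F" using insert.prems(2) unfolding prod.insert[OF insert.hyps] .
  then have "p dvd f x \<or> p dvd prod f F" unfolding prime_elem_dvd_mult_iff[OF insert.prems(1)] .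
  then show ?case using insert by blast
qed

lemma eis_fermat:
  assumes "pprime p" "\<not> p dvd x"
  shows "p dvd x ^ (eis_norm p - 1) - 1"
proof -
  define R where "R = reps p - {0}"
  have p0: "p \<noteq> 0" using assms pprime_nonzero by simp
  have fin: "finite (reps p)" using finite_reps[OF p0] .
  have 0: "0 \<in> reps p" using mod_in_reps[of 0 p] by simp
  have c: "card R = eis_norm p - 1" using 0 fin card_reps[OF p0] by (simp add: R_def)
  have nd: "\<not> p dvd y" if "y \<in> R" for y
    using that reps_eqI[of y p 0] 0 by (auto simp: R_def)
  have bij: "bij_betw (\<lambda>y. (x * y) mod p) (reps p) (reps p)"
    using assms pprime_dvd_mult_iff[OF assms(1)] by (intro bij_reps[OF p0]) (auto simp flip: right_diff_distrib)
  then have "bij_betw (\<lambda>y. (x * y) mod p) R (reps p - {(x * 0) mod p})"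
    unfolding R_def using 0 by (intro bij_betw_DiffI) (auto simp: bij_betw_def)
  then have bij: "bij_betw (\<lambda>y. (x * y) mod p) R R" by (simp add: R_def)
  have "(\<Prod>y\<in>R. y) = (\<Prod>y\<in>R. (x * y) mod p)"
    using prod.reindex_bij_betw[OF bij, of "\<lambda>y. y"] by simp
  then have "(\<Prod>y\<in>R. y) mod p = (\<Prod>y\<in>R. x * y) mod p" by (metis mod_prod_eq)
  also have "(\<Prod>y\<in>R. x * y) = x ^ (eis_norm p - 1) * (\<Prod>y\<in>R. y)"
    by (simp add: prod.distrib c)
  finally have "p dvd x ^ (eis_norm p - 1) * (\<Prod>y\<in>R. y) - (\<Prod>y\<in>R. y)"
    by (metis mod_eq_dvd_iff)
  then have "p dvd (x ^ (eis_norm p - 1) - 1) * (\<Prod>y\<in>R. y)"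
    by (simp add: algebra_simps)
  moreover have "\<not> p dvd (\<Prod>y\<in>R. y)"
    using nd prime_elem_dvd_prod[OF _ pprime_prime_elem[OF assms(1)], of R] fin by (auto simp: R_def)
  ultimately show ?thesis using assms(1) by (simp add: pprime_dvd_mult_iff)
qed

text \<open>Lagrange's bound without passing to the residue field: a root is split off over the
  Eisenstein integers up to the constant \<open>poly q r\<close>, which \<open>p\<close> divides,
  and the quotient is again monic.\<close>

lemma card_roots_mod_prime:
  fixes q :: "eis poly"
  assumes "pprime p" "lead_coeff q = 1"
  shows "card {x \<in> reps p. p dvd poly q x} \<le> degree q"
  using assms(2)
proof (induction "degree q" arbitrary: q)
  case 0
  then have "q = 1" by (metis degree_eq_zeroE lead_coeff_pCons(2) pCons_one)
  then show ?case using pprime_not_dvd_1[OF assms(1)] by simp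
next
  case (Suc n)
  show ?case
  proof (cases "{x \<in> reps p. p dvd poly q x} = {}")
    case False
    then obtain r where r: "r \<in> reps p" "p dvd poly q r" by auto
    define s where "s = synthetic_div q r"
    have q: "q = [:- r, 1:] * s + [:poly q r:]" unfolding s_def by (rule synthetic_div_correct'[symmetric])
    have d: "degree s = n" using Suc(2) by (simp add: s_def degree_synthetic_div)
    have l: "lead_coeff s = 1"
    proof -
      have "coeff q (Suc n) = coeff s n"
        using d by (subst q) (simp add: coeff_pCons coeff_eq_0)
      then show ?thesis using d Suc(2,3) by simp
    qed
    have "{x \<in> reps p. p dvd poly q x} \<subseteq> insert r {x \<in> reps p. p dvd poly s x}"
    proof (rule subsetI)
      fix x assume x: "x \<in> {x \<in> reps p. p dvd poly q x}"
      have "poly q x = (x - r) * poly s x + poly q r" by (subst q) (simp add: algebra_simps)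
      then have "p dvd (x - r) * poly s x" using x r(2) by (metis (no_types, lifting) dvd_add_left_iff mem_Collect_eq)
      then have "p dvd x - r \<or> p dvd poly s x" using assms(1) by (simp add: pprime_dvd_mult_iff)
      then show "x \<in> insert r {x \<in> reps p. p dvd poly s x}" using x r(1) reps_eqI by auto
    qed
    then have "card {x \<in> reps p. p dvd poly q x} \<le> card (insert r {x \<in> reps p. p dvd poly s x})"
      using finite_reps[OF pprime_nonzero[OF assms(1)]] by (intro card_mono) auto
    also have "\<dots> \<le> Suc (card {x \<in> reps p. p dvd poly s x})" 
      using finite_reps[OF pprime_nonzero[OF assms(1)]] by (simp add: card_insert_if) 
    also have "\<dots> \<le> Suc n" using Suc(1)[of s] d l by simp
    finally show ?thesis using Suc(2) by simp
  next
    case True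
    then show ?thesis by (metis card.empty le0)
  qed
qed

text \<open>Takes the place of a primitive root: X^j - 1 has at most j roots, fewer than there are
  nonzero residues.\<close>

lemma exists_power_not_1:
  assumes "pprime p" "0 < j" "j < eis_norm p - 1"
  obtains c where "\<not> p dvd c" "\<not> p dvd c ^ j - 1"
proof -
  define q :: "eis poly" where "q = monom 1 j - 1"
  have q: "degree q = j" "lead_coeff q = 1"
  proof -
    have "degree (monom 1 j + - (1 :: eis poly)) = degree (monom 1 j :: eis poly)"
      using assms(2) by (intro degree_add_eq_left) (simp add: degree_monom_eq)
    then show "degree q = j" by (simp add: q_def degree_monom_eq)
    then show "lead_coeff q = 1" using assms(2) by (simp add: q_def)
  qed
  have p0: "p \<noteq> 0" using assms pprime_nonzero by simp
  have 0: "0 \<in> reps p" using mod_in_reps[of 0 p] by simp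
  have "\<not> reps p - {0} \<subseteq> {x \<in> reps p. p dvd poly q x}"
  proof
    assume "reps p - {0} \<subseteq> {x \<in> reps p. p dvd poly q x}"
    then have "card (reps p - {0}) \<le> card {x \<in> reps p. p dvd poly q x}"
      using finite_reps[OF p0] by (intro card_mono) auto
    also have "\<dots> \<le> j" using card_roots_mod_prime[OF assms(1) q(2)] q(1) by simp
    finally show False using 0 finite_reps[OF p0] card_reps[OF p0] assms(3) by simp
  qed
  then obtain c where "c \<in> reps p" "c \<noteq> 0" "\<not> p dvd poly q c" by auto
  moreover have "\<not> p dvd c" using reps_eqI[of c p 0] 0 calculation by auto
  ultimately show ?thesis using that by (simp add: q_def poly_monom)
qed

lemma dvd_power_sum:
  assumes "pprime p" "j < eis_norm p - 1"
  shows "p dvd (\<Sum>x\<in>reps p. x ^ j)"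
proof (cases "j = 0")
  case True
  \<comment> \<open>With \<open>0 ^ 0 = 1\<close> the sum is the number of residues, N(p), which is
    a multiple of \<open>p\<close>.\<close>
  then show ?thesis using eis_dvd_norm card_reps[OF pprime_nonzero[OF assms(1)]] by simp
next
  case False
  then obtain c where c: "\<not> p dvd c" "\<not> p dvd c ^ j - 1" using exists_power_not_1 assms by blast
  obtain d where d: "p dvd c * d - 1" using eis_inverse_mod_prime[of p c] c assms(1) pprime_def by blast
  have "p dvd (\<Sum>x\<in>reps p. (c * x) ^ j) - (\<Sum>x\<in>reps p. x ^ j)"
    by (rule sum_reps_mult_cong[OF pprime_nonzero[OF assms(1)] dvd_power_diff d])
  also have "(\<Sum>x\<in>reps p. (c * x) ^ j) = c ^ j * (\<Sum>x\<in>reps p. x ^ j)"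
    by (simp add: power_mult_distrib sum_distrib_left)
  finally have "p dvd (c ^ j - 1) * (\<Sum>x\<in>reps p. x ^ j)"
    by (simp add: algebra_simps)
  then show ?thesis using assms(1) c(2) by (simp add: pprime_dvd_mult_iff)
qed

section \<open>Cube roots of unity and the cubic symbol\<close>

definition eis_omega :: eis where "eis_omega = Eis 0 1"

lemma eis_omega_cube: "eis_omega ^ 3 = 1"
  by (simp add: eis_omega_def eis_eq_iff eval_nat_numeral)

lemma eis_omega_sq: "eis_omega\<^sup>2 = - 1 - eis_omega"
  by (simp add: eis_omega_def eis_eq_iff eval_nat_numeral)

lemma eis_cube_minus_1:
  "x ^ 3 - 1 = (x - 1) * ((x - eis_omega) * (x - eis_omega\<^sup>2))"
proof -
  have "eis_omega * eis_omega = - 1 - eis_omega" using eis_omega_sq by (simp add: power2_eq_square)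
  then have "(x - eis_omega) * (x - eis_omega\<^sup>2) = x * x + x + 1"
    unfolding eis_omega_sq by (simp add: algebra_simps)
  then show ?thesis by (simp add: power3_eq_cube algebra_simps)
qed

lemma eis_cube_roots: "z ^ 3 = 1 \<longleftrightarrow> z = 1 \<or> z = eis_omega \<or> z = eis_omega\<^sup>2"
  using eis_cube_minus_1[of z] by (metis eq_iff_diff_eq_0 mult_eq_0_iff)

lemma eis_cube_root_cases:
  assumes "z ^ 3 = 1 \<or> z = 0"
  shows "z = Eis 0 0 \<or> z = Eis 1 0 \<or> z = Eis 0 1 \<or> z = Eis (-1) (-1)"
  using assms unfolding eis_cube_roots eis_omega_sq by (auto simp: eis_omega_def eis_eq_iff)

text \<open>Differences of the four values 0, 1, \<omega>, \<omega>^2 have norm 0, 1 or 3, so a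
  modulus of norm at least 4 cannot divide a nonzero one.\<close>

lemma cube_roots_cong_eq:
  assumes "4 \<le> eis_norm m" "z ^ 3 = 1 \<or> z = 0" "w ^ 3 = 1 \<or> w = 0" "m dvd z - w"
  shows "z = w"
proof -
  have "eis_norm (z - w) \<le> 3"
    using eis_cube_root_cases[OF assms(2)] eis_cube_root_cases[OF assms(3)]
    by (elim disjE) (simp_all add: eis_norm_def)
  moreover have "eis_norm m dvd eis_norm (z - w)" using assms(4) by (rule eis_norm_dvd)
  ultimately have "eis_norm (z - w) = 0" using assms(1) dvd_imp_le[of "eis_norm m" "eis_norm (z - w)"] by force
  then show ?thesis by simp
qed

text \<open>The symbol of \<open>x\<close> over \<open>p\<close>, with the modulus as first argument
  and extended by 0 to multiples of \<open>p\<close>. Its values are Eisenstein integers, so that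
  they can be compared modulo other primes as well.\<close>

definition cubic_char :: "eis \<Rightarrow> eis \<Rightarrow> eis" where
  "cubic_char p x = (if p dvd x then 0
     else THE z. z ^ 3 = 1 \<and> p dvd z - x ^ ((eis_norm p - 1) div 3))"

lemma pprime_norm_eq: "pprime p \<Longrightarrow> eis_norm p = 3 * ((eis_norm p - 1) div 3) + 1"
  using primary_norm[of p] by (simp add: pprime_def) presburger

lemma cubic_char_unique:
  assumes "pprime p" "z ^ 3 = 1" "p dvd z - x ^ ((eis_norm p - 1) div 3)" "\<not> p dvd x"
  shows "cubic_char p x = z"
  unfolding cubic_char_def if_not_P[OF assms(4)]
proof (rule the_equality)
  fix w assume w: "w ^ 3 = 1 \<and> p dvd w - x ^ ((eis_norm p - 1) div 3)"
  have "p dvd w - z"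
    by (rule dvd_diff_trans[OF conjunct2[OF w] dvd_diff_sym[OF assms(3)]])
  then show "w = z" using cube_roots_cong_eq pprime_norm_ge_4[OF assms(1)] w assms(2) by blast
qed (use assms in auto)

lemma cubic_char_cases:
  assumes "pprime p"
  shows "p dvd x \<Longrightarrow> cubic_char p x = 0"
    and "\<not> p dvd x \<Longrightarrow> cubic_char p x ^ 3 = 1"
    and "p dvd cubic_char p x - x ^ ((eis_norm p - 1) div 3)"
proof -
  define k where "k = (eis_norm p - 1) div 3"
  have N: "eis_norm p = 3 * k + 1" using pprime_norm_eq[OF assms] k_def by simp
  then have "k > 0" using pprime_norm_ge_4[OF assms] by simp
  show "p dvd x \<Longrightarrow> cubic_char p x = 0" by (simp add: cubic_char_def)
  have *: "cubic_char p x ^ 3 = 1 \<and> p dvd cubic_char p x - x ^ k" if "\<not> p dvd x"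
  proof -
    \<comment> \<open>Fermat makes x^k a root of X^3 - 1 modulo \<open>p\<close>. This polynomial
      splits over Z[\<omega>], hence x^k is congruent to a genuine cube root of unity.\<close>
    have "p dvd (x ^ k) ^ 3 - 1"
      using eis_fermat[OF assms that] N by (simp add: mult.commute flip: power_mult)
    also have "(x ^ k) ^ 3 - 1 = (x ^ k - 1) * ((x ^ k - eis_omega) * (x ^ k - eis_omega\<^sup>2))"
      by (rule eis_cube_minus_1)
    finally obtain z where "z ^ 3 = 1" "p dvd x ^ k - z"
      unfolding pprime_dvd_mult_iff[OF assms] using eis_cube_roots by blast
    then show ?thesis using cubic_char_unique[OF assms, of z x] dvd_diff_sym[of p "x ^ k" z] that
      by (metis k_def)
  qed
  then show "\<not> p dvd x \<Longrightarrow> cubic_char p x ^ 3 = 1" by simp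
  show "p dvd cubic_char p x - x ^ ((eis_norm p - 1) div 3)"
    using * \<open>k > 0\<close> by (cases "p dvd x") (auto simp: cubic_char_def k_def pprime_dvd_power_iff[OF assms])
qed

lemma cubic_char_eqI:
  assumes "pprime p" "z ^ 3 = 1 \<or> z = 0" "p dvd z - x ^ ((eis_norm p - 1) div 3)"
  shows "cubic_char p x = z"
proof -
  have "p dvd cubic_char p x - x ^ ((eis_norm p - 1) div 3)" by (rule cubic_char_cases(3)[OF assms(1)])
  then have "p dvd cubic_char p x - z"
    by (rule dvd_diff_trans[OF _ dvd_diff_sym[OF assms(3)]])
  then show ?thesis
    using cube_roots_cong_eq[OF pprime_norm_ge_4[OF assms(1)]] cubic_char_cases(1,2)[OF assms(1)] assms(2) by blast
qed

lemma cubic_char_values: "pprime p \<Longrightarrow> cubic_char p x ^ 3 = 1 \<or> cubic_char p x = 0"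
  using cubic_char_cases by blast

lemma cubic_char_eq_0_iff: "pprime p \<Longrightarrow> cubic_char p x = 0 \<longleftrightarrow> p dvd x"
  using cubic_char_cases(1,2)[of p x] by (cases "p dvd x") auto

lemma cubic_char_mult:
  assumes "pprime p"
  shows "cubic_char p (x * y) = cubic_char p x * cubic_char p y"
proof (rule cubic_char_eqI[OF assms])
  show "(cubic_char p x * cubic_char p y) ^ 3 = 1 \<or> cubic_char p x * cubic_char p y = 0"
    using cubic_char_values[OF assms] by (metis mult_eq_0_iff mult_1 power_mult_distrib)
  show "p dvd cubic_char p x * cubic_char p y - (x * y) ^ ((eis_norm p - 1) div 3)"
    unfolding power_mult_distrib by (intro dvd_mult_diff cubic_char_cases(3)[OF assms])
qed

lemma cubic_char_periodic:
  assumes "pprime p"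
  shows "periodic p (cubic_char p)"
  unfolding periodic_def
proof (intro allI impI)
  fix x y assume xy: "p dvd x - y"
  show "cubic_char p x = cubic_char p y"
    using cubic_char_values[OF assms]
      dvd_diff_trans[OF cubic_char_cases(3)[OF assms, of y] dvd_power_diff[OF dvd_diff_sym[OF xy]]]
    by (rule cubic_char_eqI[OF assms])
qed

lemma cubic_char_1 [simp]: "pprime p \<Longrightarrow> cubic_char p 1 = 1"
  by (rule cubic_char_eqI) auto

lemma cubic_char_power: "pprime p \<Longrightarrow> cubic_char p (x ^ n) = cubic_char p x ^ n"
  by (induction n) (auto simp: cubic_char_mult)

lemma cubic_char_minus [simp]:
  assumes "pprime p"
  shows "cubic_char p (- x) = cubic_char p x"
proof -
  have "cubic_char p (- 1) = cubic_char p ((- 1) ^ 3)" by simp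
  also have "\<dots> = cubic_char p (-1) ^ 3" by (rule cubic_char_power[OF assms])
  also have "\<dots> = 1" using cubic_char_cases(2)[OF assms, of "-1"] pprime_not_dvd_1[OF assms] by simp
  finally show ?thesis using cubic_char_mult[OF assms, of "-1" x] by simp
qed

lemma cube_root_cnj: "z ^ 3 = 1 \<or> z = 0 \<Longrightarrow> eis_cnj z = z\<^sup>2"
  using eis_cube_root_cases[of z] by (elim disjE) (auto simp: eis_eq_iff power2_eq_square)

lemma cubic_char_cnj_value: "pprime p \<Longrightarrow> eis_cnj (cubic_char p x) = cubic_char p x ^ 2"
  using cube_root_cnj cubic_char_values by blast

lemma cubic_char_cnj:
  assumes "pprime p"
  shows "cubic_char (eis_cnj p) (eis_cnj x) = eis_cnj (cubic_char p x)"
proof (rule cubic_char_eqI[OF pprime_cnj[OF assms]])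
  show "eis_cnj (cubic_char p x) ^ 3 = 1 \<or> eis_cnj (cubic_char p x) = 0"
    using cubic_char_values[OF assms, of x] by (auto simp flip: eis_cnj_power)
  show "eis_cnj p dvd eis_cnj (cubic_char p x) - eis_cnj x ^ ((eis_norm (eis_cnj p) - 1) div 3)"
    using cubic_char_cases(3)[OF assms, of x]
    by (simp flip: eis_cnj_power eis_cnj_hom(2))
qed

lemma cubic_char_nontrivial:
  assumes "pprime p"
  obtains c where "\<not> p dvd c" "cubic_char p c \<noteq> 1"
proof -
  have "0 < (eis_norm p - 1) div 3" "(eis_norm p - 1) div 3 < eis_norm p - 1"
    using pprime_norm_ge_4[OF assms] by auto
  then obtain c where c: "\<not> p dvd c" "\<not> p dvd c ^ ((eis_norm p - 1) div 3) - 1"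
    using exists_power_not_1[OF assms] by blast
  then have "cubic_char p c \<noteq> 1"
    using dvd_diff_sym[OF cubic_char_cases(3)[OF assms, of c]] by auto
  then show ?thesis using that c by blast
qed

lemma sum_cubic_char: 
  assumes "pprime p"
  shows "(\<Sum>x\<in>reps p. cubic_char p x) = 0"
proof -
  obtain c where c: "\<not> p dvd c" "cubic_char p c \<noteq> 1" using cubic_char_nontrivial[OF assms] .
  obtain d where d: "p dvd c * d - 1" using eis_inverse_mod_prime[of p c] c assms pprime_def by blast
  have "(\<Sum>x\<in>reps p. cubic_char p (c * x)) = (\<Sum>x\<in>reps p. cubic_char p x)"
    by (rule sum_reps_mult[OF pprime_nonzero[OF assms] cubic_char_periodic[OF assms] d])
  then have "cubic_char p c * (\<Sum>x\<in>reps p. cubic_char p x) = (\<Sum>x\<in>reps p. cubic_char p x)"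
    by (simp add: cubic_char_mult[OF assms] sum_distrib_left)
  then show ?thesis using c(2) by (metis mult_cancel_right1 mult.commute)
qed

section \<open>Cubic reciprocity\<close>

lemma of_nat_dvd_mono: "m dvd n \<Longrightarrow> of_nat m dvd (of_nat n :: 'a :: comm_semiring_1)"
  by (auto elim!: dvdE)

lemma freshman_dvd:
  fixes x y :: "'a :: comm_ring_1"
  assumes "prime l"
  shows "of_nat l dvd (x + y) ^ l - (x ^ l + y ^ l)"
proof -
  have l: "l > 0" using assms prime_gt_0_nat by blast
  have "(x + y) ^ l = (\<Sum>k\<le>l. of_nat (l choose k) * x ^ k * y ^ (l - k))" by (rule binomial_ring)
  also have "{..l} = insert 0 (insert l {1..<l})" using l by auto
  also have "(\<Sum>k\<in>\<dots>. of_nat (l choose k) * x ^ k * y ^ (l - k))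
      = y ^ l + x ^ l + (\<Sum>k\<in>{1..<l}. of_nat (l choose k) * x ^ k * y ^ (l - k))"
    using l by simp
  finally have "(x + y) ^ l - (x ^ l + y ^ l) = (\<Sum>k\<in>{1..<l}. of_nat (l choose k) * x ^ k * y ^ (l - k))"
    by simp
  also have "of_nat l dvd \<dots>"
  proof (rule dvd_sum)
    fix k assume k: "k \<in> {1..<l}"
    have "l dvd l choose k" using k assms by (intro dvd_choose_prime) auto
    then show "of_nat l dvd of_nat (l choose k) * x ^ k * y ^ (l - k)"
      by (metis dvd_mult2 of_nat_dvd_mono)
  qed
  finally show ?thesis .
qed

lemma freshman_sum_dvd:
  fixes f :: "'b \<Rightarrow> 'a :: comm_ring_1"
  assumes "prime l" "finite A"
  shows "of_nat l dvd (\<Sum>x\<in>A. f x) ^ l ^ e - (\<Sum>x\<in>A. f x ^ l ^ e)"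
proof (induction e)
  case (Suc e)
  have 1: "of_nat l dvd (\<Sum>x\<in>A. g x) ^ l - (\<Sum>x\<in>A. g x ^ l)" for g :: "'b \<Rightarrow> 'a"
    using assms(2)
  proof (induction A rule: finite_induct)
    case empty
    then show ?case using assms(1) prime_gt_0_nat by (simp add: power_0_left)
  next
    case (insert a A)
    have "of_nat l dvd ((g a + sum g A) ^ l - (g a ^ l + sum g A ^ l)) + (sum g A ^ l - (\<Sum>x\<in>A. g x ^ l))"
      by (rule dvd_add[OF freshman_dvd[OF assms(1)] insert.IH])
    then show ?case using insert.hyps by (simp add: algebra_simps)
  qed
  have "of_nat l dvd ((\<Sum>x\<in>A. f x) ^ l ^ e) ^ l - (\<Sum>x\<in>A. f x ^ l ^ e) ^ l"
    by (rule dvd_power_diff[OF Suc.IH])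
  from dvd_diff_trans[OF this 1] show ?case
    by (simp add: mult.commute flip: power_mult)
qed simp

text \<open>The type \<open>eis \<Rightarrow>\<^sub>0 eis\<close> is the group ring of the additive
  group of Z[\<omega>] with coefficients in Z[\<omega>]. This is the coefficient at the class of
  \<open>a\<close> after projecting the group to its residues modulo \<open>p\<close>.\<close>

definition coset_sum :: "eis \<Rightarrow> eis \<Rightarrow> (eis \<Rightarrow>\<^sub>0 eis) \<Rightarrow> eis" where
  "coset_sum p a F = (\<Sum>x\<in>Poly_Mapping.keys F. if p dvd x - a then Poly_Mapping.lookup F x else 0)"

lemma coset_sum_superset:
  "finite A \<Longrightarrow> Poly_Mapping.keys F \<subseteq> A \<Longrightarrow> coset_sum p a F = (\<Sum>x\<in>A. if p dvd x - a then Poly_Mapping.lookup F x else 0)"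
  unfolding coset_sum_def by (rule sum.mono_neutral_left) (auto simp: in_keys_iff)

lemma coset_sum_add: "coset_sum p a (F + G) = coset_sum p a F + coset_sum p a G"
proof -
  define A where "A = Poly_Mapping.keys F \<union> Poly_Mapping.keys G"
  have "finite A" "Poly_Mapping.keys F \<subseteq> A" "Poly_Mapping.keys G \<subseteq> A" "Poly_Mapping.keys (F + G) \<subseteq> A"
    using keys_add[of F G] by (auto simp: A_def)
  then show ?thesis
    by (simp add: coset_sum_superset lookup_add if_distrib flip: sum.distrib cong: if_cong)
qed

lemma coset_sum_0 [simp]: "coset_sum p a 0 = 0"
  by (simp add: coset_sum_def)

lemma coset_sum_sum: "coset_sum p a (sum F I) = (\<Sum>i\<in>I. coset_sum p a (F i))"
  by (induction I rule: infinite_finite_induct) (auto simp: coset_sum_add)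

lemma coset_sum_single: "coset_sum p a (Poly_Mapping.single y c) = (if p dvd y - a then c else 0)"
  by (cases "c = 0") (auto simp: coset_sum_def)

lemma poly_mapping_sum_singles: "F = (\<Sum>k\<in>Poly_Mapping.keys F. Poly_Mapping.single k (Poly_Mapping.lookup F k))"
proof (rule poly_mapping_eqI)
  fix k
  show "Poly_Mapping.lookup F k = Poly_Mapping.lookup (\<Sum>k\<in>Poly_Mapping.keys F. Poly_Mapping.single k (Poly_Mapping.lookup F k)) k"
    by (simp add: lookup_sum lookup_single when_def in_keys_iff)
qed

lemma coset_sum_single_times:
  "coset_sum p a (Poly_Mapping.single y c * F) = c * coset_sum p (a - y) F"
proof -
  have "coset_sum p a (Poly_Mapping.single y c * F)
      = coset_sum p a (\<Sum>k\<in>Poly_Mapping.keys F. Poly_Mapping.single (y + k) (c * Poly_Mapping.lookup F k))"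
    by (subst poly_mapping_sum_singles[of F]) (simp add: sum_distrib_left mult_single)
  also have "\<dots> = (\<Sum>k\<in>Poly_Mapping.keys F. c * (if p dvd k - (a - y) then Poly_Mapping.lookup F k else 0))"
    unfolding coset_sum_sum coset_sum_single by (intro sum.cong) (auto simp: algebra_simps)
  finally show ?thesis by (simp add: coset_sum_def sum_distrib_left)
qed

section \<open>Convolutions and Jacobi sums\<close>

definition conv :: "eis \<Rightarrow> (eis \<Rightarrow> eis) \<Rightarrow> (eis \<Rightarrow> eis) \<Rightarrow> eis \<Rightarrow> eis" where
  "conv p f g a = (\<Sum>x\<in>reps p. f x * g (a - x))"

lemma conv_scale: "conv p f (\<lambda>x. c * g x) a = c * conv p f g a"
  by (simp add: conv_def sum_distrib_left mult_ac)

lemma conv_left_commute: "conv p f (conv p g h) a = conv p g (conv p f h) a"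
  unfolding conv_def sum_distrib_left
  by (subst sum.swap) (simp add: algebra_simps)

text \<open>\<open>jacobi_conv p n a\<close> is the sum of \<open>\<chi>(x\<^sub>1) \<cdots> \<chi>(x\<^sub>n)\<close> over all \<open>x\<^sub>1 + \<cdots> + x\<^sub>n \<equiv> a\<close> modulo \<open>p\<close>.\<close>
primrec jacobi_conv :: "eis \<Rightarrow> nat \<Rightarrow> eis \<Rightarrow> eis" where
  "jacobi_conv p 0 = (\<lambda>a. if p dvd a then 1 else 0)"
| "jacobi_conv p (Suc n) = conv p (cubic_char p) (jacobi_conv p n)"

definition jacobi_sum :: "eis \<Rightarrow> eis" where
  "jacobi_sum p = conv p (cubic_char p) (cubic_char p) 1"

lemma jacobi_conv_coset_sum:
  "jacobi_conv p n a = coset_sum p a ((\<Sum>x\<in>reps p. Poly_Mapping.single x (cubic_char p x)) ^ n)"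
proof (induction n arbitrary: a)
  case 0
  then show ?case
    using coset_sum_single[of p a 0 1] by simp
next
  case (Suc n)
  then show ?case
    by (simp add: conv_def sum_distrib_right coset_sum_sum coset_sum_single_times)
qed

lemma single_power: "Poly_Mapping.single x c ^ n = Poly_Mapping.single (of_nat n * x :: eis) (c ^ n :: eis)"
  by (induction n) (simp_all add: mult_single algebra_simps)

lemma of_nat_dvd_coset_sum: "of_nat l dvd F \<Longrightarrow> of_nat l dvd coset_sum p a F"
proof -
  assume "of_nat l dvd F"
  then obtain G where "F = of_nat l * G" by blast
  then have "F = Poly_Mapping.single 0 (of_nat l) * G" by simp
  then show ?thesis by (simp only: coset_sum_single_times dvd_triv_left)
qed

text \<open>The Frobenius congruence in the group ring of \<open>\<int>[\<omega>]\<close> replaces Gauss sums.\<close>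
lemma jacobi_conv_prime_power:
  assumes "pprime p" "prime l" "\<not> p dvd of_nat l"
  shows "of_nat l dvd jacobi_conv p (l ^ e) (of_nat (l ^ e)) - 1"
proof -
  define n where "n = l ^ e"
  have p0: "p \<noteq> 0" using assms(1) by (rule pprime_nonzero)
  have pn: "\<not> p dvd of_nat n"
    using assms(1,3) pprime_not_dvd_1[OF assms(1)] pprime_dvd_power_iff[OF assms(1)]
    by (cases "e = 0") (auto simp: n_def)
  define G where "G = (\<Sum>x\<in>reps p. Poly_Mapping.single x (cubic_char p x))"
  define H where "H = (\<Sum>x\<in>reps p. Poly_Mapping.single (of_nat n * x) (cubic_char p x ^ n))"
  have "of_nat l dvd G ^ n - H"
    using freshman_sum_dvd[OF assms(2) finite_reps[OF p0], of "\<lambda>x. Poly_Mapping.single x (cubic_char p x)" e]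
    by (simp add: n_def single_power G_def H_def)
  then have "of_nat l dvd coset_sum p (of_nat n) (G ^ n - H)" by (rule of_nat_dvd_coset_sum)
  also have "coset_sum p (of_nat n) (G ^ n - H) = coset_sum p (of_nat n) (G ^ n) - coset_sum p (of_nat n) H"
    by (metis add_diff_cancel coset_sum_add diff_add_cancel)
  \<comment> \<open>As \<open>p\<close> does not divide n, the element n x lies in the class of n
    only for x congruent to 1, and there the character is 1. This explains the choice of n as the
    target of the sum.\<close>
  also have "coset_sum p (of_nat n) H = (\<Sum>x\<in>reps p. if p dvd x - 1 then cubic_char p x ^ n else 0)"
  proof -
    have "p dvd of_nat n * x - of_nat n \<longleftrightarrow> p dvd x - 1" for x
      using pprime_dvd_mult_iff[OF assms(1), of "of_nat n" "x - 1"] pn by (simp add: algebra_simps)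
    then show ?thesis by (simp add: H_def coset_sum_sum coset_sum_single)
  qed
  also have "\<dots> = cubic_char p 1 ^ n"
    using cubic_char_periodic[OF assms(1)] by (intro sum_reps_delta[OF p0]) (auto simp: periodic_def)
  finally show ?thesis using assms(1) by (simp add: jacobi_conv_coset_sum G_def n_def)
qed

lemma sum_cubic_char_sq:
  assumes "pprime p"
  shows "(\<Sum>x\<in>reps p. cubic_char p x ^ 2) = 0"
  using sum_cubic_char[OF assms] cubic_char_cnj_value[OF assms] eis_cnj_sum[of "cubic_char p" "reps p"] by simp

lemma cubic_char_pow4: "pprime p \<Longrightarrow> cubic_char p x ^ 4 = cubic_char p x"
  using cubic_char_values[of p x] power_add[of "cubic_char p x" 3 1] by auto

lemma periodic_conv_aux:
  assumes "periodic p f" "periodic p g"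
  shows "periodic p (\<lambda>x. f x * g (a - x))"
  unfolding periodic_def
proof (intro allI impI)
  fix x y assume xy: "p dvd x - y"
  then have "p dvd (a - y) - (a - x)" by simp
  then show "f x * g (a - x) = f y * g (a - y)"
    using periodicD[OF assms(1) xy] periodicD[OF assms(2)] by metis
qed

lemma periodic_power: "periodic p f \<Longrightarrow> periodic p (\<lambda>x. f x ^ n)"
  by (simp add: periodic_def)

text \<open>Scaling the variable by \<open>a\<close> pulls out \<chi>(a)^2. For p | a the sum
  becomes that of the nontrivial character \<chi>^2, and both sides are 0.\<close>

lemma conv_char_char:
  assumes "pprime p"
  shows "conv p (cubic_char p) (cubic_char p) a = jacobi_sum p * cubic_char p a ^ 2"
proof (cases "p dvd a")
  case True
  have "conv p (cubic_char p) (cubic_char p) a = (\<Sum>x\<in>reps p. cubic_char p x ^ 2)"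
    unfolding conv_def
  proof (intro sum.cong refl)
    fix x
    have "cubic_char p (a - x) = cubic_char p (- x)"
      using True by (intro periodicD[OF cubic_char_periodic[OF assms]]) simp
    then show "cubic_char p x * cubic_char p (a - x) = cubic_char p x ^ 2"
      using assms by (simp add: power2_eq_square)
  qed
  then show ?thesis
    using sum_cubic_char_sq[OF assms] cubic_char_cases(1)[OF assms True] by simp
next
  case False
  obtain b where b: "p dvd a * b - 1" using eis_inverse_mod_prime[of p a] False assms pprime_def by blast
  have "conv p (cubic_char p) (cubic_char p) a = (\<Sum>x\<in>reps p. cubic_char p (a * x) * cubic_char p (a - a * x))"
    unfolding conv_def
    by (rule sum_reps_mult[symmetric, OF pprime_nonzero[OF assms] _ b])
       (intro periodic_conv_aux cubic_char_periodic assms)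
  also have "\<dots> = (\<Sum>x\<in>reps p. cubic_char p a ^ 2 * (cubic_char p x * cubic_char p (1 - x)))"
  proof (intro sum.cong refl)
    fix x
    have "cubic_char p (a - a * x) = cubic_char p a * cubic_char p (1 - x)"
      by (simp add: algebra_simps flip: cubic_char_mult[OF assms])
    then show "cubic_char p (a * x) * cubic_char p (a - a * x)
        = cubic_char p a ^ 2 * (cubic_char p x * cubic_char p (1 - x))"
      by (simp add: cubic_char_mult[OF assms] power2_eq_square)
  qed
  finally show ?thesis by (simp add: jacobi_sum_def conv_def sum_distrib_left mult.commute)
qed

text \<open>The value off 0 is found indirectly. Scaling shows it to be constant there, the value at
  0 counts the nonzero residues, and all values add up to 0 because character sums vanish. This
  leaves (N - 1)(T 1 + 1) = 0.\<close>

lemma conv_char_char_sq: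
  assumes "pprime p"
  shows "conv p (cubic_char p) (\<lambda>x. cubic_char p x ^ 2) a
    = (if p dvd a then of_nat (eis_norm p) - 1 else - 1)"
proof -
  define ch where "ch = cubic_char p"
  define T where "T = conv p ch (\<lambda>x. ch x ^ 2)"
  define N where "N = (of_nat (eis_norm p) :: eis)"
  have p0: "p \<noteq> 0" using assms by (rule pprime_nonzero)
  have per: "periodic p ch" unfolding ch_def by (rule cubic_char_periodic[OF assms])
  have T0: "T a = N - 1" if "p dvd a" for a
  proof -
    have "T a = (\<Sum>x\<in>reps p. 1 - (if p dvd x - 0 then 1 else 0))"
      unfolding T_def conv_def
    proof (intro sum.cong refl)
      fix x
      have "ch (a - x) = ch x"
        using periodicD[OF per, of "a - x" "- x"] that assms by (simp add: ch_def)
      then have "ch x * ch (a - x) ^ 2 = ch x ^ 3" by (simp add: eval_nat_numeral)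
      then show "ch x * ch (a - x) ^ 2 = 1 - (if p dvd x - 0 then 1 else 0)"
        using cubic_char_cases(1,2)[OF assms, of x] by (simp add: ch_def)
    qed
    also have "\<dots> = N - 1"
      unfolding sum_subtractf sum_reps_delta[OF p0, of "\<lambda>_. 1", unfolded periodic_def, simplified]
      using card_reps[OF p0] sum_reps_delta[OF p0, of "\<lambda>_. 1 :: eis" 0] by (simp add: periodic_def N_def)
    finally show ?thesis .
  qed
  have T1: "T a = T 1" if na: "\<not> p dvd a" for a
  proof -
    obtain b where b: "p dvd a * b - 1" using eis_inverse_mod_prime[of p a] na assms pprime_def by blast
    have "T a = (\<Sum>x\<in>reps p. ch (a * x) * ch (a - a * x) ^ 2)"
      unfolding T_def conv_def
      by (rule sum_reps_mult[symmetric, OF p0 _ b]) (intro periodic_conv_aux[of p ch "\<lambda>x. ch x ^ 2"] periodic_power per)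
    also have "\<dots> = (\<Sum>x\<in>reps p. ch x * ch (1 - x) ^ 2)"
    proof (intro sum.cong refl)
      fix x
      have "ch (a - a * x) = ch a * ch (1 - x)"
        by (simp add: ch_def algebra_simps flip: cubic_char_mult[OF assms])
      then have "ch (a * x) * ch (a - a * x) ^ 2 = ch a ^ 3 * (ch x * ch (1 - x) ^ 2)"
        by (simp add: ch_def cubic_char_mult[OF assms] eval_nat_numeral)
      then show "ch (a * x) * ch (a - a * x) ^ 2 = ch x * ch (1 - x) ^ 2"
        using cubic_char_cases(2)[OF assms na] by (simp add: ch_def)
    qed
    finally show ?thesis by (simp add: T_def conv_def)
  qed
  have "(\<Sum>a\<in>reps p. T a) = (\<Sum>x\<in>reps p. ch x * (\<Sum>a\<in>reps p. ch (a + - x) ^ 2))"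
    unfolding T_def conv_def by (subst sum.swap) (simp add: sum_distrib_left)
  also have "\<dots> = (\<Sum>x\<in>reps p. ch x * (\<Sum>a\<in>reps p. ch a ^ 2))"
    by (intro sum.cong refl arg_cong2[where f = "(*)"] sum_reps_shift[OF p0] periodic_power per)
  also have "\<dots> = 0" using sum_cubic_char_sq[OF assms] by (simp add: ch_def)
  finally have 1: "(\<Sum>a\<in>reps p. T a) = 0" .
  have "(\<Sum>a\<in>reps p. T a) = (\<Sum>a\<in>reps p. T 1 + (if p dvd a - 0 then N - 1 - T 1 else 0))"
    using T0 T1 by (intro sum.cong) auto
  also have "\<dots> = N * T 1 + (N - 1 - T 1)"
    unfolding sum.distrib using card_reps[OF p0] sum_reps_delta[OF p0, of "\<lambda>_. N - 1 - T 1" 0]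
    by (simp add: periodic_def N_def)
  also have "\<dots> = (N - 1) * (T 1 + 1)" by (simp add: algebra_simps)
  finally have "(N - 1) * (T 1 + 1) = 0" using 1 by simp
  moreover have "N \<noteq> 1" using pprime_norm_ge_4[OF assms] by (simp add: N_def)
  ultimately have "T 1 = - 1" by (simp add: add_eq_0_iff2)
  then show ?thesis using T0 T1 unfolding T_def ch_def N_def by auto
qed

lemma conv_cnj: "conv p (\<lambda>x. eis_cnj (f x)) (\<lambda>x. eis_cnj (g x)) a = eis_cnj (conv p f g a)"
  by (simp add: conv_def eis_cnj_sum)

text \<open>The second factor is c times n [p | x] - 1; its constant part is annihilated, since the
  character sums to 0.\<close>

lemma conv_char_const:
  assumes "pprime p"
  shows "conv p (cubic_char p) (\<lambda>a. c * (if p dvd a then n - 1 else - 1)) a = c * n * cubic_char p a"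
proof -
  have p0: "p \<noteq> 0" using assms by (rule pprime_nonzero)
  have "conv p (cubic_char p) (\<lambda>a. c * (if p dvd a then n - 1 else - 1)) a
     = (\<Sum>x\<in>reps p. (if p dvd x - a then c * n * cubic_char p x else 0) - c * cubic_char p x)"
    unfolding conv_def
    by (intro sum.cong) (auto simp: algebra_simps dvd_diff_commute)
  also have "\<dots> = c * n * cubic_char p a - c * (\<Sum>x\<in>reps p. cubic_char p x)"
    unfolding sum_subtractf sum_distrib_left
    using cubic_char_periodic[OF assms]
    by (subst sum_reps_delta[OF p0]) (auto simp: periodic_def)
  finally show ?thesis using sum_cubic_char[OF assms] by simp
qed

text \<open>The threefold convolution of \<chi>, \<chi>^2, \<chi>^2 is evaluated at 1 in two orders.
  Starting with \<chi> and \<chi>^2 gives N(p); starting with \<chi>^2 and \<chi>^2 gives J times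
  its conjugate.\<close>

lemma jacobi_sum_norm:
  assumes "pprime p"
  shows "eis_norm (jacobi_sum p) = eis_norm p"
proof -
  define ch where "ch = cubic_char p"
  define J where "J = jacobi_sum p"
  define N where "N = (of_nat (eis_norm p) :: eis)"
  have sq: "(\<lambda>x. eis_cnj (ch x)) = (\<lambda>x. ch x ^ 2)"
    using cubic_char_cnj_value[OF assms] by (simp add: ch_def)
  have a: "conv p ch (\<lambda>x. ch x ^ 2) = (\<lambda>a. 1 * (if p dvd a then N - 1 else - 1))"
    using conv_char_char_sq[OF assms] by (auto simp: ch_def N_def)
  have b: "conv p (\<lambda>x. ch x ^ 2) (\<lambda>x. ch x ^ 2) = (\<lambda>a. eis_cnj J * ch a)"
  proof
    fix a
    have "conv p (\<lambda>x. ch x ^ 2) (\<lambda>x. ch x ^ 2) a = eis_cnj (J * ch a ^ 2)"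
      using conv_cnj[of p ch ch a] conv_char_char[OF assms, of a] unfolding sq by (simp add: ch_def J_def)
    also have "\<dots> = eis_cnj J * ch a"
      using cubic_char_cnj_value[OF assms, of a] cubic_char_pow4[OF assms, of a]
      by (simp add: ch_def flip: power_mult)
    finally show "conv p (\<lambda>x. ch x ^ 2) (\<lambda>x. ch x ^ 2) a = eis_cnj J * ch a" .
  qed
  define g where "g = (\<lambda>a. 1 * (if p dvd a then N - 1 else - 1))"
  have gc: "(\<lambda>a. eis_cnj (g a)) = g" by (auto simp: g_def N_def)
  have "conv p (\<lambda>x. ch x ^ 2) (conv p ch (\<lambda>x. ch x ^ 2)) 1 = eis_cnj (conv p ch g 1)"
    unfolding a unfolding sq[symmetric] g_def[symmetric] using conv_cnj[of p ch g 1] unfolding gc .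
  also have "\<dots> = N"
    using conv_char_const[OF assms, of 1 N 1] assms by (simp add: ch_def N_def g_def)
  finally have "N = conv p ch (conv p (\<lambda>x. ch x ^ 2) (\<lambda>x. ch x ^ 2)) 1"
    by (simp add: conv_left_commute)
  also have "\<dots> = eis_cnj J * J" unfolding b conv_scale by (simp add: J_def jacobi_sum_def ch_def)
  also have "\<dots> = of_nat (eis_norm J)" using eis_mult_cnj[of J] by (simp add: mult.commute)
  finally show ?thesis by (simp add: N_def J_def)
qed

lemma jacobi_conv_1: "pprime p \<Longrightarrow> jacobi_conv p 1 = cubic_char p"
proof
  fix a assume p: "pprime p"
  have "jacobi_conv p 1 a = (\<Sum>x\<in>reps p. if p dvd x - a then cubic_char p x else 0)"
    by (simp add: conv_def) (intro sum.cong; auto simp: dvd_diff_commute)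
  then show "jacobi_conv p 1 a = cubic_char p a"
    using sum_reps_delta[OF pprime_nonzero[OF p] cubic_char_periodic[OF p]] by simp
qed

text \<open>Convolution with \<chi> runs through a cycle of length three: \<chi> becomes J \<chi>^2,
  this becomes J (N(p) [p | a] - 1), and that becomes N(p) J \<chi>.\<close>

lemma jacobi_conv_formula:
  assumes "pprime p"
  shows "jacobi_conv p (3 * k + 1) = (\<lambda>a. (of_nat (eis_norm p) * jacobi_sum p) ^ k * cubic_char p a)"
    and "jacobi_conv p (3 * k + 3) = (\<lambda>a. ((of_nat (eis_norm p) * jacobi_sum p) ^ k * jacobi_sum p) *
      (if p dvd a then of_nat (eis_norm p) - 1 else - 1))"
proof -
  define J N where "J = jacobi_sum p" and "N = (of_nat (eis_norm p) :: eis)"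
  have 3: "jacobi_conv p (3 * k + 3) = (\<lambda>a. ((N * J) ^ k * J) * (if p dvd a then N - 1 else - 1))"
    if 1: "jacobi_conv p (3 * k + 1) = (\<lambda>a. (N * J) ^ k * cubic_char p a)" for k
  proof -
    have 2: "jacobi_conv p (3 * k + 2) = (\<lambda>a. ((N * J) ^ k * J) * cubic_char p a ^ 2)"
    proof
      fix a
      have "jacobi_conv p (3 * k + 2) a = conv p (cubic_char p) (jacobi_conv p (3 * k + 1)) a" by simp
      then show "jacobi_conv p (3 * k + 2) a = ((N * J) ^ k * J) * cubic_char p a ^ 2"
        unfolding 1 conv_scale conv_char_char[OF assms] by (simp add: J_def)
    qed
    show ?thesis
    proof
      fix a
      have "jacobi_conv p (3 * k + 3) a = conv p (cubic_char p) (jacobi_conv p (3 * k + 2)) a"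
        by (simp add: numeral_3_eq_3)
      then show "jacobi_conv p (3 * k + 3) a = ((N * J) ^ k * J) * (if p dvd a then N - 1 else - 1)"
        unfolding 2 conv_scale conv_char_char_sq[OF assms] by (simp add: N_def)
    qed
  qed
  have 1: "jacobi_conv p (3 * k + 1) = (\<lambda>a. (N * J) ^ k * cubic_char p a)" for k
  proof (induction k)
    case 0
    then show ?case using jacobi_conv_1[OF assms] by simp
  next
    case (Suc k)
    show ?case
    proof
      fix a
      have "jacobi_conv p (3 * Suc k + 1) a = conv p (cubic_char p) (jacobi_conv p (3 * k + 3)) a"
        by (simp add: numeral_3_eq_3)
      then show "jacobi_conv p (3 * Suc k + 1) a = (N * J) ^ Suc k * cubic_char p a"
        unfolding 3[OF Suc] conv_char_const[OF assms] by (simp add: mult_ac)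
    qed
  qed
  show "jacobi_conv p (3 * k + 1) = (\<lambda>a. (of_nat (eis_norm p) * jacobi_sum p) ^ k * cubic_char p a)"
    using 1 unfolding N_def J_def .
  show "jacobi_conv p (3 * k + 3) = (\<lambda>a. ((of_nat (eis_norm p) * jacobi_sum p) ^ k * jacobi_sum p) *
      (if p dvd a then of_nat (eis_norm p) - 1 else - 1))"
    using 3[OF 1] unfolding N_def J_def .
qed

text \<open>Modulo \<open>p\<close> the Jacobi sum is the sum of the polynomial x^k (1 - x)^k with k
  = (N(p) - 1) / 3. Its degree 2 k is below N(p) - 1, so all power sums in it vanish.\<close>

lemma dvd_jacobi_sum:
  assumes "pprime p"
  shows "p dvd jacobi_sum p"
proof -
  define k where "k = (eis_norm p - 1) div 3"
  have N: "eis_norm p = 3 * k + 1" using pprime_norm_eq[OF assms] by (simp add: k_def)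
  then have k: "k > 0" using pprime_norm_ge_4[OF assms] by simp
  have "p dvd (\<Sum>x\<in>reps p. cubic_char p x * cubic_char p (1 - x) - x ^ k * (- x + 1) ^ k)"
  proof (rule dvd_sum)
    fix x
    show "p dvd cubic_char p x * cubic_char p (1 - x) - x ^ k * (- x + 1) ^ k"
      using dvd_mult_diff[OF cubic_char_cases(3)[OF assms, of x] cubic_char_cases(3)[OF assms, of "- x + 1"]]
      by (simp add: k_def)
  qed
  then have 1: "p dvd jacobi_sum p - (\<Sum>x\<in>reps p. x ^ k * (- x + 1) ^ k)"
    by (simp add: jacobi_sum_def conv_def sum_subtractf)
  have pw: "x ^ k * (- x + 1) ^ k = (\<Sum>i\<le>k. of_nat (k choose i) * (- 1) ^ i * x ^ (k + i))" for x :: eis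
    unfolding binomial_ring sum_distrib_left
    by (intro sum.cong refl) (simp add: power_minus[of x] power_add mult_ac)
  have "(\<Sum>x\<in>reps p. x ^ k * (- x + 1) ^ k)
      = (\<Sum>i\<le>k. of_nat (k choose i) * (- 1) ^ i * (\<Sum>x\<in>reps p. x ^ (k + i)))"
    unfolding pw sum_distrib_left by (rule sum.swap)
  also have "p dvd \<dots>"
    using N k by (intro dvd_sum dvd_mult dvd_power_sum[OF assms]) auto
  finally have 2: "p dvd (\<Sum>x\<in>reps p. x ^ k * (- x + 1) ^ k)" .
  show ?thesis using dvd_add[OF 1 2] by simp
qed

lemma jacobi_sum_eq:
  assumes "pprime p"
  shows "jacobi_sum p = - p"
proof -
  have p3: "\<not> p dvd 3" using pprime_not_dvd_3[OF assms] .
  \<comment> \<open>The Frobenius congruence with l = 3 and one step of it: the threefold sum at 3,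
    which \<open>p\<close> does not divide, is -J, so -J is primary. Norm and divisibility already
    make it an associate of \<open>p\<close>.\<close>
  have "of_nat 3 dvd jacobi_conv p (3 ^ 1) (of_nat (3 ^ 1)) - 1"
    using p3 by (intro jacobi_conv_prime_power[OF assms]) auto
  then have "3 dvd jacobi_conv p (3 * 0 + 3) 3 - 1" by simp
  then have "3 dvd - jacobi_sum p - 1"
    unfolding jacobi_conv_formula(2)[OF assms] using p3 by simp
  then have "primary (- jacobi_sum p)" by (simp add: primary_def)
  moreover have dvd: "p dvd - jacobi_sum p" using dvd_jacobi_sum[OF assms] by simp
  moreover have "- jacobi_sum p dvd p"
  proof -
    obtain u where u: "- jacobi_sum p = p * u" using dvd by blast
    then have "eis_norm p * eis_norm u = eis_norm p"
      using jacobi_sum_norm[OF assms] by (metis eis_norm_minus eis_norm_mult)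
    then have "is_unit u" using pprime_nonzero[OF assms] by (simp add: eis_is_unit_iff)
    then show ?thesis using u by (simp add: mult_unit_dvd_iff)
  qed
  ultimately have "p = - jacobi_sum p"
    using primary_associated_eq assms pprime_primary by blast
  then show ?thesis by (metis minus_minus)
qed

section \<open>The reciprocity law\<close>

lemma cubic_char_prime_power:
  assumes "pprime p" "prime l" "\<not> p dvd of_nat l" "l ^ e mod 3 = 1"
  shows "of_nat l dvd (- of_nat (eis_norm p) * p) ^ ((l ^ e - 1) div 3) * cubic_char p (of_nat (l ^ e)) - 1"
proof -
  define k where "k = (l ^ e - 1) div 3"
  have e: "l ^ e = 3 * k + 1" using assms(4) unfolding k_def by presburger
  have "of_nat l dvd jacobi_conv p (3 * k + 1) (of_nat (l ^ e)) - 1"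
    using jacobi_conv_prime_power[OF assms(1-3), of e] by (simp only: e)
  then show ?thesis
    unfolding jacobi_conv_formula(1)[OF assms(1)] jacobi_sum_eq[OF assms(1)] k_def[symmetric] by simp
qed

text \<open>For l^e = N(q) the exponent (l^e - 1) / 3 is the one that defines the character modulo
  \<open>q\<close>, and \<open>q\<close> divides l. The power in the preceding congruence thus
  becomes a symbol modulo \<open>q\<close>, while the other factor is a symbol modulo
  \<open>p\<close>.\<close>

lemma cubic_char_norm_relation:
  assumes "pprime p" "pprime q" "\<not> p dvd of_nat (eis_norm q)"
  shows "cubic_char q (of_nat (eis_norm p) * p) = cubic_char p (of_nat (eis_norm q)) ^ 2"
proof -
  obtain l e where l: "prime l" "q dvd of_nat l" "e > 0" "eis_norm q = l ^ e"
    using pprime_rational_prime[OF assms(2)] by metis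
  define z where "z = cubic_char p (of_nat (eis_norm q))"
  define y where "y = (- of_nat (eis_norm p) * p) ^ ((eis_norm q - 1) div 3)"
  have z: "z ^ 3 = 1" using cubic_char_cases(2)[OF assms(1,3)] by (simp add: z_def)
  have pl: "\<not> p dvd of_nat l"
    using assms(3) l(3) unfolding l(4) by (auto simp: pprime_dvd_power_iff[OF assms(1)])
  have "l ^ e mod 3 = 1" using primary_norm[of q] assms(2) l(4) by (simp add: pprime_def)
  from cubic_char_prime_power[OF assms(1) l(1) pl this]
  have "of_nat l dvd y * z - 1" by (simp only: l(4) y_def z_def)
  then have "q dvd (y * z - 1) * z ^ 2" using l(2) dvd_trans by (metis dvd_mult2)
  also have "(y * z - 1) * z ^ 2 = y * z ^ 3 - z ^ 2" by (simp add: algebra_simps eval_nat_numeral)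
  finally have "q dvd y - z ^ 2" using z by simp
  then have "q dvd z ^ 2 - (- of_nat (eis_norm p) * p) ^ ((eis_norm q - 1) div 3)"
    unfolding y_def by (rule dvd_diff_sym)
  moreover have "(z ^ 2) ^ 3 = 1 \<or> z ^ 2 = 0"
    using z by (metis mult.commute power_mult power_one)
  ultimately have "cubic_char q (- of_nat (eis_norm p) * p) = z ^ 2"
    using cubic_char_eqI[OF assms(2)] by blast
  then show ?thesis using cubic_char_minus[OF assms(2)] by (simp add: z_def)
qed

text \<open>The relation and its mirror image each determine one of the two symbols from A and B. As
  A and B are cube roots of unity, both symbols come out as A^2 B^2.\<close>

lemma cubic_reciprocity_coprime_norms:
  assumes "pprime p" "pprime q" "\<not> p dvd of_nat (eis_norm q)" "\<not> q dvd of_nat (eis_norm p)"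
  shows "cubic_char q p = cubic_char p q"
proof -
  define A B where "A = cubic_char q (of_nat (eis_norm p))" and "B = cubic_char p (of_nat (eis_norm q))"
  have A: "A ^ 3 = 1" and B: "B ^ 3 = 1"
    using cubic_char_cases(2) assms by (auto simp: A_def B_def)
  have 1: "A * cubic_char q p = B ^ 2"
    using cubic_char_norm_relation[OF assms(1-3)] by (simp add: A_def B_def cubic_char_mult[OF assms(2)])
  have 2: "B * cubic_char p q = A ^ 2"
    using cubic_char_norm_relation[OF assms(2,1,4)] by (simp add: A_def B_def cubic_char_mult[OF assms(1)])
  have "cubic_char q p = A ^ 3 * cubic_char q p" using A by simp
  also have "\<dots> = A ^ 2 * (A * cubic_char q p)" by (simp add: eval_nat_numeral)
  also have "\<dots> = B ^ 2 * (B * cubic_char p q)" using 1 2 by simp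
  also have "\<dots> = B ^ 3 * cubic_char p q" by (simp add: eval_nat_numeral)
  finally show ?thesis using B by simp
qed

text \<open>Modulo l, \<open>x\<close> may be taken as a + b \<omega> with natural a and b. The l-th
  power map fixes these by Fermat, and its square fixes \<omega> because l^2 is 1 modulo 3.\<close>

lemma eis_frobenius_sq:
  assumes "prime l" "l ^ 2 mod 3 = 1"
  shows "of_nat l dvd x ^ l ^ 2 - (x :: eis)"
proof -
  define a b where "a = nat (eis1 x mod int l)" and "b = nat (eis2 x mod int l)"
  have l: "l > 0" using assms prime_gt_0_nat by blast
  define y where "y = of_nat a + of_nat b * eis_omega"
  have xy: "x mod of_nat l = y"
    using l unfolding mod_eis_of_nat y_def a_def b_def eis_omega_def by (simp add: eis_eq_iff)
  have "of_nat l dvd (of_nat n :: eis) ^ l - of_nat n" for n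
  proof (induction n)
    case (Suc n)
    have "of_nat l dvd ((1 + of_nat n :: eis) ^ l - (1 ^ l + of_nat n ^ l)) + (of_nat n ^ l - of_nat n)"
      by (rule dvd_add[OF freshman_dvd[OF assms(1)] Suc.IH])
    then show ?case by (simp add: algebra_simps)
  qed (use l in \<open>simp add: power_0_left\<close>)
  then have fl: "of_nat l dvd (of_nat n :: eis) ^ l ^ 2 - of_nat n" for n
    using dvd_diff_trans[OF dvd_power_diff[of "of_nat l" "(of_nat n :: eis) ^ l" "of_nat n" l]]
    by (metis power2_eq_square power_mult)
  have "of_nat l dvd y ^ l ^ 2 - (of_nat a ^ l ^ 2 + (of_nat b * eis_omega) ^ l ^ 2)"
    using freshman_sum_dvd[OF assms(1), of "{False, True}" "\<lambda>i. if i then of_nat a else of_nat b * eis_omega" 2]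
    by (simp add: y_def add.commute)
  also have "eis_omega ^ l ^ 2 = eis_omega"
  proof -
    have "l ^ 2 = 3 * (l ^ 2 div 3) + 1" using assms(2) by presburger
    then have "eis_omega ^ l ^ 2 = (eis_omega ^ 3) ^ (l ^ 2 div 3) * eis_omega"
      by (metis power_add power_mult power_one_right)
    then show ?thesis by (simp add: eis_omega_cube)
  qed
  then have "(of_nat b * eis_omega) ^ l ^ 2 = of_nat b ^ l ^ 2 * eis_omega"
    by (simp add: power_mult_distrib)
  finally have "of_nat l dvd y ^ l ^ 2 - (of_nat a ^ l ^ 2 + of_nat b ^ l ^ 2 * eis_omega)" .
  moreover have "of_nat l dvd (of_nat a ^ l ^ 2 - of_nat a) + (of_nat b ^ l ^ 2 - of_nat b) * eis_omega"
    by (intro dvd_add fl dvd_mult2)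
  then have "of_nat l dvd (of_nat a ^ l ^ 2 + of_nat b ^ l ^ 2 * eis_omega) - y"
    by (simp add: y_def algebra_simps)
  ultimately have "of_nat l dvd y ^ l ^ 2 - y" by (rule dvd_diff_trans)
  moreover have "of_nat l dvd x - y" unfolding xy[symmetric] by (simp add: minus_mod_eq_mult_div)
  ultimately show ?thesis
    using dvd_diff_trans[OF dvd_power_diff dvd_diff_trans[OF _ dvd_diff_sym]] by blast
qed

text \<open>Here \<open>cubic_char_prime_power\<close> is applied with \<open>l\<^sup>2\<close>: modulo \<open>l\<close> the conjugate of \<open>p\<close> is \<open>-p\<close>,
  so the base there is \<open>p\<^sup>3\<close>.\<close>
lemma cubic_char_prime_dvd_trace:
  assumes "pprime p" "eis_cnj p \<noteq> p" "prime l" "of_nat l dvd p + eis_cnj p"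
  shows "cubic_char p (of_nat l) = 1"
proof -
  have pc: "pprime (eis_cnj p)" using pprime_cnj[OF assms(1)] .
  have pl: "\<not> p dvd of_nat l"
  proof
    assume "p dvd of_nat l"
    then have "p dvd (p + eis_cnj p) - p" by (intro dvd_diff dvd_trans[OF _ assms(4)] dvd_refl)
    then have "p = eis_cnj p" using pprime_dvd_pprime[OF assms(1) pc] by simp
    then show False using assms(2) by simp
  qed
  have "l \<noteq> 3"
  proof
    assume "l = 3"
    then have "3 dvd p + eis_cnj p" using assms(4) by simp
    then have "3 dvd 2 * eis1 p - eis2 p" by (simp add: eis_3_dvd_iff)
    moreover have "eis1 p mod 3 = 1" "eis2 p mod 3 = 0"
      using pprime_primary[OF assms(1)] by (simp_all add: primary_iff)
    ultimately show False by presburger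
  qed
  then have "\<not> 3 dvd l" using assms(3) primes_dvd_imp_eq[of 3 l] by auto
  then have "l mod 3 = 1 \<or> l mod 3 = 2" by presburger
  then have "(l mod 3) ^ 2 mod 3 = 1" by auto
  then have l2: "l ^ 2 mod 3 = 1" by (simp add: power_mod)
  define z where "z = cubic_char p (of_nat (l ^ 2))"
  define k where "k = (l ^ 2 - 1) div 3"
  have k: "l ^ 2 = 3 * k + 1" using l2 unfolding k_def by presburger
  have 1: "of_nat l dvd (- of_nat (eis_norm p) * p) ^ k * z - 1"
    using cubic_char_prime_power[OF assms(1,3) pl l2] by (simp only: k_def z_def)
  have "of_nat l dvd (p + eis_cnj p) * (- (p ^ 2))" using assms(4) by (rule dvd_mult2)
  also have "(p + eis_cnj p) * (- (p ^ 2)) = - of_nat (eis_norm p) * p - p ^ 3"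
    unfolding eis_mult_cnj[symmetric] by (simp add: algebra_simps eval_nat_numeral)
  finally have 2: "of_nat l dvd (- of_nat (eis_norm p) * p) ^ k - (p ^ 3) ^ k" by (rule dvd_power_diff)
  have "of_nat l dvd (p ^ 3) ^ k * z - 1"
    using dvd_diff[OF 1 dvd_mult2[OF 2, of z]] by (simp add: algebra_simps)
  then have 3: "of_nat l dvd ((p ^ 3) ^ k * z - 1) * p" by (rule dvd_mult2)
  have "((p ^ 3) ^ k * z - 1) * p = p ^ l ^ 2 * z - p"
    by (simp add: k algebra_simps flip: power_mult)
  with 3 have 4: "of_nat l dvd p ^ l ^ 2 * z - p" by simp
  have "of_nat l dvd p * (z - 1)"
    using dvd_diff[OF 4 dvd_mult2[OF eis_frobenius_sq[OF assms(3) l2, of p], of z]]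
    by (simp add: algebra_simps)
  \<comment> \<open>Multiplying by the conjugate replaces \<open>p\<close> by its norm, which is
    compared with l by ordinary divisibility below.\<close>
  then have "of_nat l dvd p * (z - 1) * eis_cnj p" by (rule dvd_mult2)
  also have "p * (z - 1) * eis_cnj p = (z - 1) * of_nat (eis_norm p)"
    unfolding eis_mult_cnj[symmetric] by (simp add: algebra_simps)
  finally have d: "of_nat l dvd (z - 1) * of_nat (eis_norm p)" .
  have z3: "z ^ 3 = 1"
    using cubic_char_cases(2)[OF assms(1)] pl pprime_dvd_power_iff[OF assms(1), of 2 "of_nat l"]
    by (simp add: z_def)
  have "z = 1"
  proof (rule ccontr)
    assume "z \<noteq> 1"
    moreover have "z \<noteq> 0" using z3 by auto
    ultimately have "z = Eis 0 1 \<or> z = Eis (-1) (-1)"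
      using eis_cube_root_cases[OF disjI1[OF z3]] by (auto simp: zero_eis_def one_eis_def)
    \<comment> \<open>Taking norms now gives l^2 | 3 N(p)^2, so l would be the rational prime below
      \<open>p\<close>; but \<open>p\<close> does not divide l.\<close>
    then have "eis_norm (z - 1) = 3" by (auto simp: eis_norm_def)
    then have "l ^ 2 dvd 3 * eis_norm p ^ 2" using eis_norm_dvd[OF d] by simp
    then have "l dvd 3 * eis_norm p ^ 2" by (metis dvd_trans dvd_triv_left power2_eq_square)
    then have "l dvd eis_norm p"
      using assms(3) \<open>l \<noteq> 3\<close> primes_dvd_imp_eq[of l 3] by (auto simp: prime_dvd_mult_iff prime_dvd_power_iff)
    moreover obtain l' e where l': "prime l'" "p dvd of_nat l'" "eis_norm p = l' ^ e"
      using pprime_rational_prime[OF assms(1)] by metis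
    ultimately have "l dvd l'" using assms(3) prime_dvd_power by metis
    then have "l = l'" using primes_dvd_imp_eq assms(3) l'(1) by blast
    then show False using l'(2) pl by simp
  qed
  then have "cubic_char p (of_nat l) ^ 2 = 1" by (simp add: z_def cubic_char_power[OF assms(1)])
  moreover have "cubic_char p (of_nat l) ^ 4 = (cubic_char p (of_nat l) ^ 2) ^ 2"
    by (simp flip: power_mult)
  ultimately show ?thesis using cubic_char_pow4[OF assms(1), of "of_nat l"] by simp
qed

text \<open>Modulo \<open>p\<close> the conjugate equals the trace, a rational integer that is 2
  modulo 3 and hence not 0. Every prime factor of the trace has character 1, and so has its
  sign.\<close>

lemma cubic_char_conjugate:
  assumes "pprime p" "eis_cnj p \<noteq> p"
  shows "cubic_char p (eis_cnj p) = 1"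
proof -
  define i where "i = 2 * eis1 p - eis2 p"
  have t: "p + eis_cnj p = of_int i" by (simp add: i_def eis_eq_iff)
  define m where "m = nat \<bar>i\<bar>"
  have im: "of_int i = (of_nat m :: eis) \<or> of_int i = - (of_nat m :: eis)"
    by (auto simp: m_def eis_eq_iff)
  have "i mod 3 = 2" using pprime_primary[OF assms(1)] unfolding primary_iff i_def by presburger
  then have m0: "m \<noteq> 0" by (auto simp: m_def)
  have "cubic_char p (of_nat n) = 1" if "n dvd m" for n
    using that
  proof (induction n rule: prime_divisors_induct)
    case zero
    then show ?case using m0 by simp
  next
    case (unit n)
    then show ?case using assms by simp
  next
    case (factor l n)
    have "of_nat l dvd (of_nat m :: eis)" using factor(3) by (metis dvd_mult_left of_nat_dvd_mono)
    then have "of_nat l dvd p + eis_cnj p" using im t by (metis dvd_minus_iff)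
    then have "cubic_char p (of_nat l) = 1" using cubic_char_prime_dvd_trace[OF assms factor(1)] by blast
    moreover have "cubic_char p (of_nat n) = 1" using factor(2,3) by (metis dvd_mult_right)
    ultimately show ?case by (simp add: cubic_char_mult[OF assms(1)])
  qed
  then have "cubic_char p (of_nat m) = 1" by simp
  then have "cubic_char p (p + eis_cnj p) = 1" using im t cubic_char_minus[OF assms(1)] by metis
  moreover have "cubic_char p (p + eis_cnj p) = cubic_char p (eis_cnj p)"
    by (rule periodicD[OF cubic_char_periodic[OF assms(1)]]) simp
  ultimately show ?thesis by simp
qed

text \<open>\<open>p\<close> divides N(q) only if it equals \<open>q\<close> or the conjugate of
  \<open>q\<close>, so the conjugate pair is the only case left over by the argument with
  norms.\<close>

theorem cubic_reciprocity:
  assumes "pprime p" "pprime q" "p \<noteq> q"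
  shows "cubic_char q p = cubic_char p q"
proof (cases "q = eis_cnj p")
  case True
  have "cubic_char p q = 1" using cubic_char_conjugate[OF assms(1)] assms(3) True by simp
  moreover have "cubic_char q p = eis_cnj (cubic_char p q)"
    using cubic_char_cnj[OF assms(1), of q] True by simp
  ultimately show ?thesis by simp
next
  case False
  have *: "\<not> p dvd of_nat (eis_norm q)" if "pprime p" "pprime q" "p \<noteq> q" "q \<noteq> eis_cnj p" for p q
  proof
    assume "p dvd of_nat (eis_norm q)"
    then have "p dvd q \<or> p dvd eis_cnj q"
      unfolding eis_mult_cnj[symmetric] pprime_dvd_mult_iff[OF that(1)] .
    then show False using pprime_dvd_pprime[OF that(1)] that pprime_cnj[OF that(2)] by (metis eis_cnj_hom(7))
  qed
  have "p \<noteq> eis_cnj q" using False by auto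
  then show ?thesis
    using cubic_reciprocity_coprime_norms[OF assms(1,2)] *[OF assms False] *[OF assms(2,1)] assms(3) by blast
qed

section \<open>Lattice sums\<close>

text \<open>Boundaries of coordinate squares take the place of discs in the norm: shell k has O(k)
  points by direct counting, and their norms lie between 3 k^2 / 4 and 3 k^2.\<close>

definition shell :: "nat \<Rightarrow> eis set" where
  "shell k = {x. max \<bar>eis1 x\<bar> \<bar>eis2 x\<bar> = int k}"

lemma shell_subset:
  "shell k \<subseteq> (\<lambda>(a, b). Eis a b) ` ({- int k, int k} \<times> {- int k..int k})
    \<union> (\<lambda>(a, b). Eis a b) ` ({- int k..int k} \<times> {- int k, int k})"
proof
  fix x assume "x \<in> shell k"
  then have x: "max \<bar>eis1 x\<bar> \<bar>eis2 x\<bar> = int k" by (simp add: shell_def)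
  then consider "\<bar>eis1 x\<bar> = int k" "\<bar>eis2 x\<bar> \<le> int k" | "\<bar>eis2 x\<bar> = int k" "\<bar>eis1 x\<bar> \<le> int k"
    by (auto simp: max_def split: if_splits)
  then show "x \<in> (\<lambda>(a, b). Eis a b) ` ({- int k, int k} \<times> {- int k..int k})
    \<union> (\<lambda>(a, b). Eis a b) ` ({- int k..int k} \<times> {- int k, int k})"
  proof cases
    case 1
    then show ?thesis by (intro UnI1 image_eqI[of _ _ "(eis1 x, eis2 x)"]) auto
  next
    case 2
    then show ?thesis by (intro UnI2 image_eqI[of _ _ "(eis1 x, eis2 x)"]) auto
  qed
qed

lemma finite_shell: "finite (shell k)"
  using shell_subset by (rule finite_subset) auto

lemma card_shell_le: "card (shell k) \<le> 8 * k + 4"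
proof -
  have "card (shell k) \<le> card ((\<lambda>(a, b). Eis a b) ` ({- int k, int k} \<times> {- int k..int k})
    \<union> (\<lambda>(a, b). Eis a b) ` ({- int k..int k} \<times> {- int k, int k}))"
    by (rule card_mono[OF _ shell_subset]) auto
  also have "\<dots> \<le> card ({- int k, int k} \<times> {- int k..int k}) + card ({- int k..int k} \<times> {- int k, int k})"
    by (intro order_trans[OF card_Un_le] add_mono card_image_le) auto
  also have "\<dots> = 2 * (card {- int k, int k} * (2 * k + 1))"
    by (simp add: card_cartesian_product nat_add_distrib nat_mult_distrib algebra_simps)
  also have "\<dots> \<le> 2 * (2 * (2 * k + 1))"
    by (intro mult_left_mono mult_right_mono) (simp_all add: card_insert_if)
  finally show ?thesis by simp
qed

lemma UN_shell: "(\<Union>k. shell k) = UNIV"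
proof -
  have "x \<in> shell (nat (max \<bar>eis1 x\<bar> \<bar>eis2 x\<bar>))" for x by (simp add: shell_def)
  then show ?thesis by blast
qed

lemma shell_norm_ge: "x \<in> shell k \<Longrightarrow> 3 * (real k)\<^sup>2 \<le> 4 * real (eis_norm x)"
proof -
  assume x: "x \<in> shell k"
  define a b where "a = eis1 x" and "b = eis2 x"
  have n: "int (eis_norm x) = a * a - a * b + b * b" by (simp add: int_eis_norm a_def b_def)
  have "4 * int (eis_norm x) = (2 * a - b) * (2 * a - b) + 3 * (b * b)"
    unfolding n by (simp add: algebra_simps)
  moreover have "(2 * a - b) * (2 * a - b) \<ge> 0" by simp
  ultimately have "3 * (b * b) \<le> 4 * int (eis_norm x)" by linarith
  moreover have "4 * int (eis_norm x) = (2 * b - a) * (2 * b - a) + 3 * (a * a)"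
    unfolding n by (simp add: algebra_simps)
  moreover have "(2 * b - a) * (2 * b - a) \<ge> 0" by simp
  ultimately have "3 * (a * a) \<le> 4 * int (eis_norm x)" "3 * (b * b) \<le> 4 * int (eis_norm x)"
    by linarith+
  moreover have "\<bar>a\<bar> = int k \<or> \<bar>b\<bar> = int k"
    using x by (auto simp: shell_def a_def b_def max_def split: if_splits)
  then have "int k * int k = a * a \<or> int k * int k = b * b" by (metis abs_mult_self_eq)
  ultimately have "3 * (int k * int k) \<le> 4 * int (eis_norm x)" by auto
  then have "real_of_int (3 * (int k * int k)) \<le> real_of_int (4 * int (eis_norm x))" by (simp only: of_int_le_iff)
  then show ?thesis by (simp add: power2_eq_square)
qed

lemma shell_norm_le: "x \<in> shell k \<Longrightarrow> eis_norm x \<le> 3 * k\<^sup>2"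
proof -
  assume x: "x \<in> shell k"
  define a b where "a = eis1 x" and "b = eis2 x"
  have ab: "\<bar>a\<bar> \<le> int k" "\<bar>b\<bar> \<le> int k" using x by (auto simp: shell_def a_def b_def)
  have "int (eis_norm x) \<le> \<bar>a\<bar> * \<bar>a\<bar> + \<bar>a\<bar> * \<bar>b\<bar> + \<bar>b\<bar> * \<bar>b\<bar>"
    unfolding int_eis_norm a_def[symmetric] b_def[symmetric] abs_mult[symmetric] by linarith
  also have "\<dots> \<le> int k * int k + int k * int k + int k * int k"
    using ab by (intro add_mono mult_mono) auto
  finally have "int (eis_norm x) \<le> int (3 * k\<^sup>2)" by (simp add: power2_eq_square)
  then show ?thesis by (simp only: of_nat_le_iff)
qed

lemma shells_summable:
  fixes g :: "eis \<Rightarrow> real"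
  assumes "\<And>x. g x \<ge> 0" "summable (\<lambda>k. sum g (shell k))"
  shows "g summable_on UNIV"
proof (rule nonneg_bdd_above_summable_on)
  show "bdd_above (sum g ` {F. F \<subseteq> UNIV \<and> finite F})"
  proof (rule bdd_aboveI2)
    fix F :: "eis set" assume "F \<in> {F. F \<subseteq> UNIV \<and> finite F}"
    then have F: "finite F" by simp
    define m where "m x = nat (max \<bar>eis1 x\<bar> \<bar>eis2 x\<bar>)" for x
    have xm: "x \<in> shell (m x)" for x by (simp add: shell_def m_def)
    define K where "K = Suc (Max (insert 0 (m ` F)))"
    have "m x < K" if "x \<in> F" for x
      using F that by (simp add: K_def less_Suc_eq_le)
    then have sub: "F \<subseteq> (\<Union>k<K. shell k)" using xm by blast
    have "sum g F \<le> sum g (\<Union>k<K. shell k)"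
      using assms(1) finite_shell by (intro sum_mono2 sub) auto
    also have "\<dots> = (\<Sum>k<K. sum g (shell k))"
      using finite_shell by (intro sum.UNION_disjoint) (auto simp: shell_def)
    also have "\<dots> \<le> suminf (\<lambda>k. sum g (shell k))"
      using assms by (intro sum_le_suminf sum_nonneg) auto
    finally show "sum g F \<le> suminf (\<lambda>k. sum g (shell k))" .
  qed
qed (use assms in auto)

text \<open>Turns an unordered sum into an ordinary series of finite sums, the form to which the
  theorems on series of holomorphic functions apply.\<close>

lemma shells_sums:
  fixes g :: "eis \<Rightarrow> complex"
  assumes "(g has_sum L) UNIV"
  shows "(\<lambda>k. sum g (shell k)) sums L"
proof -
  have inj: "inj_on snd (Sigma UNIV shell)"
    by (auto simp: inj_on_def shell_def)
  have "snd ` Sigma UNIV shell = UNIV"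
    using UN_shell by (force simp: image_iff)
  then have "(g has_sum L) (snd ` Sigma UNIV shell)" using assms by simp
  then have "(g \<circ> snd has_sum L) (Sigma UNIV shell)" using has_sum_reindex[OF inj] by blast
  then have "((\<lambda>k. sum g (shell k)) has_sum L) UNIV"
    by (rule has_sum_Sigma[OF isUCont_plus]) (simp add: o_def finite_shell)
  then show ?thesis by (rule has_sum_imp_sums)
qed

lemma eis_cells_bij:
  assumes "M \<noteq> 0"
  shows "bij_betw (\<lambda>(c, r). M * c + r) (UNIV \<times> reps M) UNIV"
proof (rule bij_betwI[where g = "\<lambda>x. (x div M, x mod M)"])
  fix z :: "eis \<times> eis" assume "z \<in> UNIV \<times> reps M"
  then obtain c r where z: "z = (c, r)" "r mod M = r" by (auto simp: reps_mod)
  have "r div M = 0"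
    using z(2) assms by (metis add_cancel_right_left div_mult_mod_eq mult_eq_0_iff)
  then show "(\<lambda>x. (x div M, x mod M)) ((\<lambda>(c, r). M * c + r) z) = z"
    using z assms by simp
qed auto

lemma cells_has_sum:
  fixes g :: "eis \<Rightarrow> complex"
  assumes "(g has_sum L) UNIV" "M \<noteq> 0"
  shows "((\<lambda>c. \<Sum>r\<in>reps M. g (M * c + r)) has_sum L) UNIV"
proof -
  have "((\<lambda>z. g ((\<lambda>(c, r). M * c + r) z)) has_sum L) (UNIV \<times> reps M)"
    using assms has_sum_reindex_bij_betw[OF eis_cells_bij[OF assms(2)], of g L] by simp
  then show ?thesis
    by (rule has_sum_Sigma[OF isUCont_plus]) (simp add: finite_reps[OF assms(2)])
qed

text \<open>Since \<open>0 powr s = 0\<close>, the zero element does not contribute to the sums below.\<close>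
lemma norm_powr_summable:
  assumes "\<sigma> > 1"
  shows "(\<lambda>x. real (eis_norm x) powr (- \<sigma>)) summable_on UNIV"
proof (rule shells_summable)
  have bound: "(\<Sum>x\<in>shell k. real (eis_norm x) powr (- \<sigma>)) \<le> 12 * 2 powr \<sigma> * (real k powr (1 - 2 * \<sigma>))"
    if "k \<ge> 1" for k
  proof -
    have "(\<Sum>x\<in>shell k. real (eis_norm x) powr (- \<sigma>)) \<le> (\<Sum>x\<in>shell k. ((real k)\<^sup>2 / 2) powr (- \<sigma>))"
    proof (intro sum_mono powr_mono2')
      fix x assume "x \<in> shell k"
      from shell_norm_ge[OF this] show "(real k)\<^sup>2 / 2 \<le> real (eis_norm x)" by simp
    qed (use assms that in auto)
    also have "\<dots> = real (card (shell k)) * ((real k)\<^sup>2 / 2) powr (- \<sigma>)" by simp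
    also have "\<dots> \<le> (12 * real k) * ((real k)\<^sup>2 / 2) powr (- \<sigma>)"
      using card_shell_le[of k] that by (intro mult_right_mono) auto
    also have "((real k)\<^sup>2 / 2) powr (- \<sigma>) = 2 powr \<sigma> * real k powr (- 2 * \<sigma>)"
      using that by (simp add: powr_divide powr_powr powr_minus field_simps flip: powr_numeral)
    also have "(12 * real k) * (2 powr \<sigma> * real k powr (- 2 * \<sigma>)) = 12 * 2 powr \<sigma> * (real k powr 1 * real k powr (- 2 * \<sigma>))"
      using that by simp
    also have "real k powr 1 * real k powr (- 2 * \<sigma>) = real k powr (1 - 2 * \<sigma>)"
      by (simp only: powr_add[symmetric]) simp
    finally show ?thesis .
  qed
  have "summable (\<lambda>k. 12 * 2 powr \<sigma> * (real k powr (1 - 2 * \<sigma>)))"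
    using assms by (intro summable_mult) (simp add: summable_real_powr_iff)
  then show "summable (\<lambda>k. \<Sum>x\<in>shell k. real (eis_norm x) powr (- \<sigma>))"
    by (rule summable_comparison_test'[where N = 1]) (use bound in \<open>simp add: sum_nonneg\<close>)
qed simp

section \<open>Dirichlet series over the lattice and their continuation\<close>

definition dseries :: "(eis \<Rightarrow> complex) \<Rightarrow> complex \<Rightarrow> complex" where
  "dseries f s = (\<Sum>\<^sub>\<infinity>x. f x * of_nat (eis_norm x) powr (- s))"

lemma norm_of_nat_powr: "norm (of_nat n powr s :: complex) = real n powr (Re s)"
  by (cases "n = 0") (simp_all add: norm_powr_real_powr)

lemma dseries_abs_summable:
  assumes "\<And>x. norm (f x) \<le> 1" "Re s > 1"
  shows "(\<lambda>x. norm (f x * of_nat (eis_norm x) powr (- s))) summable_on UNIV"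
proof (rule Infinite_Sum.abs_summable_on_comparison_test)
  show "(\<lambda>x. norm (real (eis_norm x) powr (- Re s))) summable_on UNIV"
    using norm_powr_summable[OF assms(2)] by simp
  show "norm (f x * of_nat (eis_norm x) powr (- s)) \<le> norm (real (eis_norm x) powr (- Re s))" for x
    using assms(1)[of x] by (simp add: norm_mult norm_of_nat_powr mult_left_le_one_le)
qed

lemma dseries_has_sum:
  assumes "\<And>x. norm (f x) \<le> 1" "Re s > 1"
  shows "((\<lambda>x. f x * of_nat (eis_norm x) powr (- s)) has_sum dseries f s) UNIV"
  unfolding dseries_def by (rule has_sum_infsum[OF abs_summable_summable[OF dseries_abs_summable[OF assms]]])

lemma powr_diff_bound:
  fixes x y m :: real and s :: complex
  assumes "m > 0" "m \<le> x" "m \<le> y" "Re s \<ge> 0"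
  shows "norm (of_real x powr (- s) - of_real y powr (- s)) \<le> norm s * m powr (- Re s - 1) * \<bar>x - y\<bar>"
proof -
  have seg: "z \<in> of_real ` {m..}" if "z \<in> closed_segment (of_real x :: complex) (of_real y)" for z
    using that assms unfolding closed_segment_of_real closed_segment_eq_real_ivl by (auto split: if_splits)
  have "norm (of_real x powr (- s) - of_real y powr (- s)) \<le> norm s * m powr (- Re s - 1) * norm (of_real x - of_real y :: complex)"
  proof (rule field_differentiable_bound[where S = "closed_segment (of_real x) (of_real y)"
        and f' = "\<lambda>z. - s * z powr (- s - 1)"])
    fix z assume "z \<in> closed_segment (of_real x :: complex) (of_real y)"
    then obtain t where t: "z = of_real t" "t \<ge> m" using seg by blast
    then have "z \<notin> \<real>\<^sub>\<le>\<^sub>0" using assms(1) by auto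
    then show "((\<lambda>z. z powr (- s)) has_field_derivative - s * z powr (- s - 1))
        (at z within closed_segment (of_real x) (of_real y))"
      by (auto intro!: derivative_eq_intros)
    have "norm (z powr (- s - 1)) = t powr (- Re s - 1)"
      using t assms(1) by (simp add: norm_powr_real_powr)
    also have "\<dots> \<le> m powr (- Re s - 1)" using t assms by (intro powr_mono2') auto
    finally show "norm (- s * z powr (- s - 1)) \<le> norm s * m powr (- Re s - 1)"
      by (simp add: norm_mult mult_left_mono)
  qed (auto simp: convex_closed_segment)
  then show ?thesis by (simp flip: of_real_diff)
qed

text \<open>The norm is a quadratic form, so moving by a bounded vector inside a cell changes it by
  a term linear in the position, that is by O(k) on shell k.\<close>

lemma norm_shift_bounds:
  assumes "M \<noteq> 0"
  obtains C where "C \<ge> 0" "\<And>k c r. k \<ge> 1 \<Longrightarrow> c \<in> shell k \<Longrightarrow> r \<in> reps M \<Longrightarrow>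
     \<bar>real (eis_norm (M * c + r)) - real (eis_norm (M * c))\<bar> \<le> C * real k"
proof -
  define B where "B r = \<bar>eis1 r\<bar> + \<bar>eis2 r\<bar>" for r
  define R where "R = Max (B ` insert 0 (reps M))"
  have R: "B r \<le> R" if "r \<in> reps M" for r
    using that finite_reps[OF assms] by (simp add: R_def)
  have R0: "R \<ge> 0" using finite_reps[OF assms] by (simp add: R_def B_def Max_ge_iff)
  \<comment> \<open>The bilinear part has coefficients of total size 2 + 1 + 1 + 2 = 6 and the
    coordinates of M c are at most 3 B(M) k, which makes 18. The part quadratic in r has three terms
    of size R^2.\<close>
  define C where "C = 18 * B M * R + 3 * R * R"
  have "\<bar>int (eis_norm (M * c + r)) - int (eis_norm (M * c))\<bar> \<le> C * int k"
    if k: "k \<ge> 1" and c: "c \<in> shell k" and r: "r \<in> reps M" for k c r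
  proof -
    define a b where "a = eis1 (M * c)" and "b = eis2 (M * c)"
    define u v where "u = eis1 r" and "v = eis2 r"
    have uv: "\<bar>u\<bar> \<le> R" "\<bar>v\<bar> \<le> R" using R[OF r] by (auto simp: B_def u_def v_def)
    have ck: "\<bar>eis1 c\<bar> \<le> int k" "\<bar>eis2 c\<bar> \<le> int k" using c by (auto simp: shell_def)
    have m: "\<bar>x * y\<bar> \<le> X * Y" if "\<bar>x\<bar> \<le> X" "\<bar>y\<bar> \<le> Y" for x y X Y :: int
      using that by (simp add: abs_mult mult_mono)
    have B: "\<bar>eis1 M\<bar> \<le> B M" "\<bar>eis2 M\<bar> \<le> B M" by (auto simp: B_def)
    have ab: "\<bar>a\<bar> \<le> 3 * (B M * int k)" "\<bar>b\<bar> \<le> 3 * (B M * int k)"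
      using m[OF B(1) ck(1)] m[OF B(1) ck(2)] m[OF B(2) ck(1)] m[OF B(2) ck(2)]
      by (auto simp: a_def b_def)
    define A where "A = 3 * (B M * int k)"
    have "int (eis_norm (M * c + r)) - int (eis_norm (M * c))
        = 2 * (a * u) - a * v - b * u + 2 * (b * v) + (u * u - u * v + v * v)"
      unfolding int_eis_norm eis_simps(5,6) a_def[symmetric] b_def[symmetric] u_def[symmetric] v_def[symmetric]
      by (simp add: algebra_simps)
    moreover have m2: "x * y \<le> X * Y \<and> - (X * Y) \<le> x * y" if "\<bar>x\<bar> \<le> X" "\<bar>y\<bar> \<le> Y" for x y X Y :: int
      using m[OF that] by (simp add: abs_le_iff)
    have "a * u \<le> A * R \<and> - (A * R) \<le> a * u" "a * v \<le> A * R \<and> - (A * R) \<le> a * v"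
      "b * u \<le> A * R \<and> - (A * R) \<le> b * u" "b * v \<le> A * R \<and> - (A * R) \<le> b * v"
      "u * u \<le> R * R \<and> - (R * R) \<le> u * u" "u * v \<le> R * R \<and> - (R * R) \<le> u * v"
      "v * v \<le> R * R \<and> - (R * R) \<le> v * v"
      using m2 uv ab unfolding A_def by blast+
    ultimately have "int (eis_norm (M * c + r)) - int (eis_norm (M * c)) \<le> 6 * (A * R) + 3 * (R * R)"
      "- (int (eis_norm (M * c + r)) - int (eis_norm (M * c))) \<le> 6 * (A * R) + 3 * (R * R)"
      by linarith+
    then have "\<bar>int (eis_norm (M * c + r)) - int (eis_norm (M * c))\<bar> \<le> 6 * (A * R) + 3 * (R * R)"
      by (rule abs_leI)
    also have "\<dots> \<le> C * int k"
    proof -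
      have "R * R * 1 \<le> R * R * int k" using k R0 by (intro mult_left_mono) auto
      moreover have "A * R \<ge> 0" using R0 by (simp add: A_def B_def)
      moreover have "C * int k = 6 * (A * R) + 3 * (R * R * int k)"
        by (simp add: C_def A_def algebra_simps)
      ultimately show ?thesis by linarith
    qed
    finally show ?thesis .
  qed
  moreover have "C \<ge> 0" using R0 by (simp add: C_def B_def)
  ultimately show ?thesis
  proof (intro that[of "real_of_int C"])
    fix k c r assume "k \<ge> 1" "c \<in> shell k" "r \<in> reps M"
      and "\<And>k c r. k \<ge> 1 \<Longrightarrow> c \<in> shell k \<Longrightarrow> r \<in> reps M \<Longrightarrow>
        \<bar>int (eis_norm (M * c + r)) - int (eis_norm (M * c))\<bar> \<le> C * int k"
    then have "real_of_int \<bar>int (eis_norm (M * c + r)) - int (eis_norm (M * c))\<bar> \<le> real_of_int (C * int k)"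
      by (simp only: of_int_le_iff)
    then show "\<bar>real (eis_norm (M * c + r)) - real (eis_norm (M * c))\<bar> \<le> real_of_int C * real k" by simp
  qed simp
qed

lemma norm_powr_has_derivative:
  "((\<lambda>s. c * of_nat n powr (- s)) has_field_derivative
    - (c * of_real (ln (real n)) * of_nat n powr (- s))) (at (s :: complex))"
proof (cases "n = 0")
  case False
  then show ?thesis
    by (auto intro!: derivative_eq_intros simp: powr_def Ln_of_nat exp_diff algebra_simps)
qed simp

lemma field_differentiable_norm_powr:
  "(\<lambda>s. c * of_nat n powr (- s)) field_differentiable at (s :: complex)"
  using norm_powr_has_derivative field_differentiable_def by blast

lemma ln_nat_nonneg: "0 \<le> ln (real n)"
  by (cases "n = 0") auto

lemma ln_nat_powr_nonneg: "0 \<le> ln (real n) * real n powr a"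
  by (simp add: ln_nat_nonneg)

text \<open>Since \<open>f\<close> has mean 0 over a cell, the power taken at the corner M c may be
  subtracted from every term of the cell. With \<sigma> = Re s, a cell in shell k then contributes
  O(k^(-2 \<sigma> - 1)) and the whole shell O(k^(-2 \<sigma>)), which is summable for \<sigma> >
  1/2.\<close>

theorem dseries_continuation:
  fixes f :: "eis \<Rightarrow> complex"
  assumes M: "M \<noteq> 0" and per: "periodic M f" and sum0: "(\<Sum>r\<in>reps M. f r) = 0"
    and f1: "\<And>x. norm (f x) \<le> 1"
  obtains H where "H holomorphic_on {s. Re s > 1 / 2}" "\<And>s. Re s > 1 \<Longrightarrow> H s = dseries f s"
proof -
  define S where "S = {s. Re s > 1 / 2}"
  define D where "D k s = (\<Sum>c\<in>shell k. \<Sum>r\<in>reps M. f r * of_nat (eis_norm (M * c + r)) powr (- s))" for k s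
  obtain C where C: "C \<ge> 0" "\<And>k c r. k \<ge> 1 \<Longrightarrow> c \<in> shell k \<Longrightarrow> r \<in> reps M \<Longrightarrow>
     \<bar>real (eis_norm (M * c + r)) - real (eis_norm (M * c))\<bar> \<le> C * real k"
    using norm_shift_bounds[OF M] by metis
  have bound: "norm (D k s) \<le> 12 * real (eis_norm M) * (norm s * 4 powr (Re s + 1) * C) * real k powr (- 2 * Re s)"
    if k: "real k \<ge> 2 * C + 2" and s: "Re s \<ge> 0" for k s
  proof -
    have k0: "real k > 0" "k \<ge> 1" using k C(1) by linarith+
    \<comment> \<open>For k \<ge> 2 C + 2 the shift C k is at most k^2 / 2, so every norm occurring
      in the cell is at least 3 k^2 / 4 - k^2 / 2 = m.\<close>
    define m where "m = (real k)\<^sup>2 / 4"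
    have m: "m > 0" using k0 by (simp add: m_def)
    have mk: "m powr (- Re s - 1) = 4 powr (Re s + 1) * real k powr (- 2 * Re s - 2)"
    proof -
      have "m powr (- Re s - 1) = (real k powr 2) powr (- Re s - 1) / 4 powr (- Re s - 1)"
        using k0 unfolding m_def by (simp add: powr_divide)
      also have "\<dots> = real k powr (- 2 * Re s - 2) * 4 powr (Re s + 1)"
        unfolding powr_powr by (simp add: powr_minus[of 4 "Re s + 1", simplified] field_simps)
      finally show ?thesis by (simp add: mult.commute)
    qed
    have cell: "norm (\<Sum>r\<in>reps M. f r * of_nat (eis_norm (M * c + r)) powr (- s))
        \<le> real (eis_norm M) * (norm s * m powr (- Re s - 1) * (C * real k))" if c: "c \<in> shell k" for c
    proof -
      have Nc: "real (eis_norm (M * c)) \<ge> 3 / 4 * (real k)\<^sup>2"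
      proof -
        have "real (eis_norm c) \<ge> 3 / 4 * (real k)\<^sup>2" using shell_norm_ge[OF c] by simp
        moreover have "real (eis_norm c) * 1 \<le> real (eis_norm c) * real (eis_norm M)"
          using eis_norm_pos[OF M] by (intro mult_left_mono) auto
        ultimately show ?thesis by (simp add: mult.commute)
      qed
      have Ck: "C * real k \<le> (real k)\<^sup>2 / 2"
      proof -
        have "C * real k \<le> (real k / 2) * real k" using k C(1) by (intro mult_right_mono) auto
        then show ?thesis by (simp add: power2_eq_square)
      qed
      have "(\<Sum>r\<in>reps M. f r * of_nat (eis_norm (M * c + r)) powr (- s))
          = (\<Sum>r\<in>reps M. f r * (of_nat (eis_norm (M * c + r)) powr (- s) - of_nat (eis_norm (M * c)) powr (- s)))"
        unfolding right_diff_distrib sum_subtractf sum_distrib_right[symmetric] sum0 by simp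
      also have "norm \<dots> \<le> (\<Sum>r\<in>reps M. norm s * m powr (- Re s - 1) * (C * real k))"
      proof (rule sum_norm_le)
        fix r assume r: "r \<in> reps M"
        note d = C(2)[OF k0(2) c r]
        have "norm (of_real (real (eis_norm (M * c + r))) powr (- s) - of_real (real (eis_norm (M * c))) powr (- s))
            \<le> norm s * m powr (- Re s - 1) * \<bar>real (eis_norm (M * c + r)) - real (eis_norm (M * c))\<bar>"
        proof (rule powr_diff_bound)
          show "m \<le> real (eis_norm (M * c))" using Nc zero_le_power2[of "real k"] unfolding m_def by linarith
          show "m \<le> real (eis_norm (M * c + r))" using Nc d Ck unfolding m_def abs_le_iff by linarith
        qed (use m s in auto)
        also have "\<dots> \<le> norm s * m powr (- Re s - 1) * (C * real k)"
          using d by (intro mult_left_mono) auto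
        finally have "norm (of_nat (eis_norm (M * c + r)) powr (- s) - of_nat (eis_norm (M * c)) powr (- s))
            \<le> norm s * m powr (- Re s - 1) * (C * real k)" by (simp only: of_real_of_nat_eq)
        then have "norm (f r) * norm (of_nat (eis_norm (M * c + r)) powr (- s) - of_nat (eis_norm (M * c)) powr (- s))
            \<le> 1 * (norm s * m powr (- Re s - 1) * (C * real k))"
          using f1 by (intro mult_mono) auto
        then show "norm (f r * (of_nat (eis_norm (M * c + r)) powr (- s) - of_nat (eis_norm (M * c)) powr (- s)))
            \<le> norm s * m powr (- Re s - 1) * (C * real k)" by (simp add: norm_mult)
      qed
      finally show ?thesis by (simp add: card_reps[OF M])
    qed
    define B where "B = real (eis_norm M) * (norm s * m powr (- Re s - 1) * (C * real k))"
    have B0: "B \<ge> 0" using C(1) by (simp add: B_def)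
    have "norm (D k s) \<le> (\<Sum>c\<in>shell k. B)"
      unfolding D_def B_def by (intro sum_norm_le cell)
    also have "\<dots> \<le> 12 * real k * B"
      using card_shell_le[of k] k0 B0 by (simp add: mult_right_mono)
    also have "\<dots> = 12 * real (eis_norm M) * (norm s * 4 powr (Re s + 1) * C) * (real k powr 2 * real k powr (- 2 * Re s - 2))"
      unfolding B_def mk using k0 by (simp add: power2_eq_square)
    also have "real k powr 2 * real k powr (- 2 * Re s - 2) = real k powr (- 2 * Re s)"
      by (simp only: powr_add[symmetric]) simp
    finally show ?thesis .
  qed
  have "open S" unfolding S_def by (rule open_halfspace_Re_gt)
  then obtain H where H: "\<forall>s\<in>S. ((\<lambda>k. D k s) sums H s) \<and> H field_differentiable (at s)"
  proof (rule series_differentiable_comparison_complex)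
    fix k s assume "s \<in> S"
    show "D k field_differentiable at s"
      unfolding D_def by (intro field_differentiable_sum field_differentiable_norm_powr)
  next
    fix s assume s: "s \<in> S"
    \<comment> \<open>Half the distance to the line Re s = 1/2; the real part is then at least
      \<open>\<sigma>\<close> > 1/2 on the ball of radius d, and the bound is uniform there.\<close>
    define d where "d = (Re s - 1 / 2) / 2"
    define \<sigma> where "\<sigma> = 1 / 2 + d"
    have d: "d > 0" using s by (simp add: d_def S_def)
    define K where "K = 12 * real (eis_norm M) * ((norm s + d) * 4 powr (Re s + d + 1) * C)"
    have K0: "K \<ge> 0" using C(1) d by (simp add: K_def)
    define h where "h k = complex_of_real (K * real k powr (- 2 * \<sigma>))" for k
    have "summable (\<lambda>k. K * real k powr (- 2 * \<sigma>))"
      using d by (intro summable_mult) (simp add: summable_real_powr_iff \<sigma>_def)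
    then have "summable h" unfolding h_def by (rule summable_of_real)
    moreover have "range h \<subseteq> \<real>\<^sub>\<ge>\<^sub>0" using K0 by (auto simp: h_def)
    moreover have "\<forall>\<^sub>F k in sequentially. \<forall>y\<in>ball s d \<inter> S. cmod (D k y) \<le> cmod (h k)"
      using eventually_ge_at_top[of "nat \<lceil>2 * C + 2\<rceil>"]
    proof eventually_elim
      case (elim k)
      then have k: "real k \<ge> 2 * C + 2" by linarith
      then have k1: "real k \<ge> 1" using C(1) by linarith
      show ?case
      proof
        fix y assume y: "y \<in> ball s d \<inter> S"
        then have ds: "norm (s - y) < d" by (simp add: dist_norm)
        have "\<bar>Re s - Re y\<bar> < d" using abs_Re_le_cmod[of "s - y"] ds by simp
        moreover have "\<sigma> = Re s - d" by (simp add: \<sigma>_def d_def field_simps)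
        ultimately have re: "Re y \<le> Re s + d" "Re y \<ge> \<sigma>" by linarith+
        have ny: "norm y \<le> norm s + d" using ds norm_triangle_ineq2[of y s] by (simp add: norm_minus_commute)
        have y0: "Re y \<ge> 0" using y by (simp add: S_def)
        have "norm y * 4 powr (Re y + 1) \<le> (norm s + d) * 4 powr (Re s + d + 1)"
          using ny re(1) d by (intro mult_mono powr_mono) (auto simp: add_nonneg_nonneg)
        then have b1: "12 * real (eis_norm M) * (norm y * 4 powr (Re y + 1) * C) \<le> K"
          unfolding K_def using C(1) by (intro mult_left_mono mult_right_mono) auto
        have b2: "real k powr (- 2 * Re y) \<le> real k powr (- 2 * \<sigma>)"
          using re(2) k1 by (intro powr_mono) auto
        have "norm (D k y) \<le> 12 * real (eis_norm M) * (norm y * 4 powr (Re y + 1) * C) * real k powr (- 2 * Re y)"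
          by (rule bound[OF k y0])
        also have "\<dots> \<le> K * real k powr (- 2 * \<sigma>)"
          by (rule mult_mono[OF b1 b2 K0]) simp
        also have "\<dots> = norm (h k)" using K0 by (simp add: h_def norm_mult)
        finally show "norm (D k y) \<le> norm (h k)" .
      qed
    qed
    ultimately show "\<exists>d h. 0 < d \<and> summable h \<and> range h \<subseteq> \<real>\<^sub>\<ge>\<^sub>0 \<and>
        (\<forall>\<^sub>F n in sequentially. \<forall>y\<in>ball s d \<inter> S. cmod (D n y) \<le> cmod (h n))"
      using d by blast
  qed blast
  have "H holomorphic_on S"
    using H by (simp add: holomorphic_on_def field_differentiable_at_within)
  moreover have "H s = dseries f s" if s: "Re s > 1" for s
  proof -
    have "((\<lambda>c. \<Sum>r\<in>reps M. f (M * c + r) * of_nat (eis_norm (M * c + r)) powr (- s)) has_sum dseries f s) UNIV"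
      by (rule cells_has_sum[OF dseries_has_sum[OF f1 s] M])
    moreover have "f (M * c + r) = f r" for c r by (rule periodicD[OF per]) simp
    ultimately have "((\<lambda>c. \<Sum>r\<in>reps M. f r * of_nat (eis_norm (M * c + r)) powr (- s)) has_sum dseries f s) UNIV"
      by simp
    from shells_sums[OF this] have "(\<lambda>k. D k s) sums dseries f s" by (simp add: D_def)
    moreover have "(\<lambda>k. D k s) sums H s" using H s by (auto simp: S_def)
    ultimately show ?thesis by (rule sums_unique2[symmetric])
  qed
  ultimately show ?thesis using that by (simp add: S_def)
qed

lemma ln_norm_powr_le:
  assumes "\<epsilon> > 0"
  shows "ln (real n) * real n powr (- \<sigma>) \<le> 1 / \<epsilon> * real n powr (- (\<sigma> - \<epsilon>))"
proof (cases "n = 0")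
  case False
  then have "ln (real n) \<le> real n powr \<epsilon> / \<epsilon>" using assms by (intro ln_powr_bound) auto
  then have "ln (real n) * real n powr (- \<sigma>) \<le> (real n powr \<epsilon> / \<epsilon>) * real n powr (- \<sigma>)"
    by (intro mult_right_mono) auto
  also have "\<dots> = 1 / \<epsilon> * (real n powr \<epsilon> * real n powr (- \<sigma>))" by simp
  also have "real n powr \<epsilon> * real n powr (- \<sigma>) = real n powr (- (\<sigma> - \<epsilon>))"
    by (simp only: powr_add[symmetric]) simp
  finally show ?thesis .
qed simp

lemma ln_norm_powr_summable:
  assumes "\<sigma> > 1"
  shows "(\<lambda>x. ln (real (eis_norm x)) * real (eis_norm x) powr (- \<sigma>)) summable_on UNIV"
proof -
  define \<epsilon> where "\<epsilon> = (\<sigma> - 1) / 2"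
  have e: "\<epsilon> > 0" "\<sigma> - \<epsilon> > 1" using assms by (auto simp: \<epsilon>_def field_simps)
  have "(\<lambda>x. 1 / \<epsilon> * real (eis_norm x) powr (- (\<sigma> - \<epsilon>))) summable_on UNIV"
    by (intro summable_on_cmult_right norm_powr_summable e)
  then show ?thesis
    by (rule summable_on_comparison_test) (use ln_norm_powr_le[OF e(1)] ln_nat_powr_nonneg in auto)
qed

section \<open>Termwise differentiation\<close>

definition dseries_log :: "(eis \<Rightarrow> complex) \<Rightarrow> complex \<Rightarrow> complex" where
  "dseries_log f s = (\<Sum>\<^sub>\<infinity>x. f x * of_real (ln (real (eis_norm x))) * of_nat (eis_norm x) powr (- s))"

lemma dseries_log_summable:
  assumes "\<And>x. norm (f x) \<le> 1" "Re s > 1"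
  shows "(\<lambda>x. norm (f x * of_real (ln (real (eis_norm x))) * of_nat (eis_norm x) powr (- s))) summable_on UNIV"
proof (rule summable_on_comparison_test)
  show "(\<lambda>x. ln (real (eis_norm x)) * real (eis_norm x) powr (- Re s)) summable_on UNIV"
    by (rule ln_norm_powr_summable[OF assms(2)])
  fix x
  have l: "ln (real (eis_norm x)) * real (eis_norm x) powr (- Re s) \<ge> 0"
    by (rule ln_nat_powr_nonneg)
  have "norm (f x * of_real (ln (real (eis_norm x))) * of_nat (eis_norm x) powr (- s))
      = norm (f x) * (ln (real (eis_norm x)) * real (eis_norm x) powr (- Re s))"
    using ln_nat_nonneg[of "eis_norm x"] by (simp add: norm_mult norm_of_nat_powr)
  also have "\<dots> \<le> 1 * (ln (real (eis_norm x)) * real (eis_norm x) powr (- Re s))"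
    using assms(1) l by (intro mult_right_mono) auto
  finally show "norm (f x * of_real (ln (real (eis_norm x))) * of_nat (eis_norm x) powr (- s))
      \<le> ln (real (eis_norm x)) * real (eis_norm x) powr (- Re s)" by simp
qed auto

theorem dseries_has_derivative:
  assumes f1: "\<And>x. norm (f x) \<le> 1" and s: "Re s > 1"
  shows "(dseries f has_field_derivative - dseries_log f s) (at s)"
proof -
  define S where "S = {s. Re s > 1}"
  define E where "E k s = (\<Sum>x\<in>shell k. f x * of_nat (eis_norm x) powr (- s))" for k s
  define E' where "E' k s = (\<Sum>x\<in>shell k. - (f x * of_real (ln (real (eis_norm x))) * of_nat (eis_norm x) powr (- s)))" for k s
  have S: "open S" unfolding S_def by (rule open_halfspace_Re_gt)
  \<comment> \<open>Only the undifferentiated shell sums have to be dominated: a locally uniform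
    limit of holomorphic functions can be differentiated term by term.\<close>
  have "\<exists>g g'. \<forall>s\<in>S. ((\<lambda>k. E k s) sums g s) \<and> ((\<lambda>k. E' k s) sums g' s) \<and> (g has_field_derivative g' s) (at s)"
  proof (rule series_and_derivative_comparison_complex[OF S])
    show "(E k has_field_derivative E' k s) (at s)" for k s
      unfolding E_def E'_def by (intro DERIV_sum norm_powr_has_derivative)
    fix s assume s: "s \<in> S"
    define d where "d = (Re s - 1) / 2"
    define \<sigma> where "\<sigma> = 1 + d"
    have d: "d > 0" using s by (simp add: d_def S_def)
    define h where "h k = complex_of_real (\<Sum>x\<in>shell k. real (eis_norm x) powr (- \<sigma>))" for k
    have "((\<lambda>x. complex_of_real (real (eis_norm x) powr (- \<sigma>))) has_sum
        of_real (\<Sum>\<^sub>\<infinity>x. real (eis_norm x) powr (- \<sigma>))) UNIV"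
      using d by (intro has_sum_of_real has_sum_infsum norm_powr_summable) (simp add: \<sigma>_def)
    from shells_sums[OF this] have "summable h"
      unfolding h_def by (simp add: sums_iff)
    moreover have "range h \<subseteq> \<real>\<^sub>\<ge>\<^sub>0" by (auto simp: h_def sum_nonneg simp del: of_real_sum)
    moreover have "cmod (E k y) \<le> cmod (h k)" if y: "y \<in> ball s d" for k y
    proof -
      have "\<bar>Re s - Re y\<bar> < d" using abs_Re_le_cmod[of "s - y"] y by (simp add: dist_norm)
      moreover have "\<sigma> = Re s - d" by (simp add: \<sigma>_def d_def field_simps)
      ultimately have re: "Re y \<ge> \<sigma>" by linarith
      have "norm (E k y) \<le> (\<Sum>x\<in>shell k. real (eis_norm x) powr (- \<sigma>))"
        unfolding E_def
      proof (rule sum_norm_le)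
        fix x
        have "real (eis_norm x) powr (- Re y) \<le> real (eis_norm x) powr (- \<sigma>)"
        proof (cases "eis_norm x = 0")
          case False
          then have "real (eis_norm x) \<ge> 1" by linarith
          then show ?thesis using re by (intro powr_mono) auto
        qed simp
        then have "norm (f x) * real (eis_norm x) powr (- Re y) \<le> 1 * real (eis_norm x) powr (- \<sigma>)"
          by (intro mult_mono f1) auto
        then show "norm (f x * of_nat (eis_norm x) powr (- y)) \<le> real (eis_norm x) powr (- \<sigma>)"
          by (simp add: norm_mult norm_of_nat_powr)
      qed
      also have "\<dots> = norm (h k)" unfolding h_def norm_of_real by (simp add: sum_nonneg)
      finally show ?thesis .
    qed
    ultimately show "\<exists>d h. 0 < d \<and> summable h \<and> range h \<subseteq> \<real>\<^sub>\<ge>\<^sub>0 \<and>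
        (\<forall>\<^sub>F n in sequentially. \<forall>y\<in>ball s d \<inter> S. cmod (E n y) \<le> cmod (h n))"
      using d by (intro exI[of _ d] exI[of _ h]) auto
  qed
  then obtain g g' where g: "\<And>s. s \<in> S \<Longrightarrow> (\<lambda>k. E k s) sums g s" "\<And>s. s \<in> S \<Longrightarrow> (\<lambda>k. E' k s) sums g' s"
    "\<And>s. s \<in> S \<Longrightarrow> (g has_field_derivative g' s) (at s)" by blast
  have gd: "g t = dseries f t" if t: "t \<in> S" for t
  proof -
    have "Re t > 1" using t by (simp add: S_def)
    then have "(\<lambda>k. E k t) sums dseries f t"
      unfolding E_def by (rule shells_sums[OF dseries_has_sum[OF f1]])
    then show ?thesis by (rule sums_unique2[OF g(1)[OF t]])
  qed
  have "((\<lambda>x. f x * of_real (ln (real (eis_norm x))) * of_nat (eis_norm x) powr (- s)) has_sum dseries_log f s) UNIV"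
    unfolding dseries_log_def by (rule has_sum_infsum[OF abs_summable_summable[OF dseries_log_summable[OF f1 s]]])
  then have "(\<lambda>k. E' k s) sums (- dseries_log f s)"
    unfolding E'_def sum_negf by (intro sums_minus shells_sums)
  moreover have sS: "s \<in> S" using s by (simp add: S_def)
  ultimately have "g' s = - dseries_log f s" using g(2) sums_unique2 by blast
  then have "(g has_field_derivative - dseries_log f s) (at s)" using g(3)[OF sS] by simp
  then show ?thesis
    by (rule has_field_derivative_transform_within_open[OF _ S sS]) (rule gd)
qed

section \<open>Logarithmic derivatives\<close>

text \<open>A character of ideals, read on primary generators and set to 0 elsewhere, so that
  \<open>dseries f\<close> counts each ideal prime to 3 once. Multiplicativity can hold for primary
  arguments only: f(-1) is 0 although f((-1) * (-1)) is 1.\<close>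

definition hecke_char :: "eis \<Rightarrow> (eis \<Rightarrow> complex) \<Rightarrow> bool" where
  "hecke_char M f \<longleftrightarrow> M \<noteq> 0 \<and> periodic M f \<and> f 1 = 1 \<and>
     (\<forall>x. f x \<noteq> 0 \<longrightarrow> primary x \<and> norm (f x) = 1) \<and>
     (\<forall>x y. primary x \<longrightarrow> primary y \<longrightarrow> f (x * y) = f x * f y)"

lemma hecke_charD:
  assumes "hecke_char M f"
  shows "M \<noteq> 0" "periodic M f" "f 1 = 1" "norm (f x) \<le> 1"
    and "\<not> primary x \<Longrightarrow> f x = 0"
    and "primary x \<Longrightarrow> primary y \<Longrightarrow> f (x * y) = f x * f y"
  using assms unfolding hecke_char_def by (auto, metis norm_zero zero_le_one order_refl)

definition prime_powers :: "(eis \<times> nat) set" where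
  "prime_powers = {(p, j). pprime p \<and> j \<ge> 1}"

text \<open>This is -L'/L written with the von Mangoldt function, indexed by a prime and an
  exponent.\<close>

definition lambda_series :: "(eis \<Rightarrow> complex) \<Rightarrow> complex \<Rightarrow> complex" where
  "lambda_series f s = (\<Sum>\<^sub>\<infinity>(p, j)\<in>prime_powers.
     f (p ^ j) * of_real (ln (real (eis_norm p))) * of_nat (eis_norm (p ^ j)) powr (- s))"

definition pp_divisors :: "eis \<Rightarrow> (eis \<times> nat) set" where
  "pp_divisors x = {(p, j) \<in> prime_powers. p ^ j dvd x}"

lemma pprime_power_dvd_mult:
  assumes "pprime p" "pprime q" "p \<noteq> q"
  shows "p ^ j dvd q * y \<longleftrightarrow> p ^ j dvd y"
proof
  show "p ^ j dvd y" if "p ^ j dvd q * y"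
    using that
  proof (induction j arbitrary: y)
    case (Suc j)
    have "\<not> p dvd q" using pprime_dvd_pprime assms by blast
    moreover have "p dvd q * y" using Suc.prems by (metis dvd_mult_left power_Suc)
    ultimately have "p dvd y" using pprime_dvd_mult_iff[OF assms(1)] by blast
    then obtain z where z: "y = p * z" by blast
    have "p * p ^ j dvd p * (q * z)" using Suc.prems unfolding z by (simp add: mult_ac)
    then have "p ^ j dvd q * z" using pprime_nonzero[OF assms(1)] by simp
    then have "p ^ j dvd z" by (rule Suc.IH)
    then show ?case unfolding z by (simp add: mult_dvd_mono)
  qed simp
qed simp

text \<open>The identity log = \<Lambda> * 1. A further prime factor q adds one power of q to the
  list of divisors and leaves the powers of other primes unchanged.\<close>

lemma sum_pp_divisors:
  assumes "primary x"
  shows "finite (pp_divisors x) \<and> (\<Sum>(p, j)\<in>pp_divisors x. ln (real (eis_norm p))) = ln (real (eis_norm x))"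
  using assms
proof (induction x rule: primary_induct)
  case one
  have "pp_divisors 1 = {}"
  proof -
    have "\<not> p ^ j dvd 1" if "pprime p" "j \<ge> 1" for p j
    proof -
      have "p dvd p ^ j" using that(2) by (intro dvd_power) auto
      then show ?thesis using pprime_not_dvd_1[OF that(1)] dvd_trans by blast
    qed
    then show ?thesis by (auto simp: pp_divisors_def prime_powers_def)
  qed
  then show ?case by simp
next
  case (mult q y)
  \<comment> \<open>The exponent 0 belongs to J: the powers of q dividing y are counted by J without
    0, those dividing q y by J shifted by one, and this yields the extra term.\<close>
  define J where "J = {j. q ^ j dvd y}"
  define R where "R = {(p, j) \<in> pp_divisors y. p \<noteq> q}"
  have y0: "y \<noteq> 0" using primary_nonzero mult by blast
  have q0: "q \<noteq> 0" using pprime_nonzero mult by blast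
  have "j < eis_norm y" if "j \<in> J" for j
  proof -
    have "eis_norm q ^ j \<le> eis_norm y"
      using that eis_norm_dvd[of "q ^ j" y] eis_norm_pos[OF y0] by (auto simp: J_def intro: dvd_imp_le)
    moreover have "2 ^ j \<le> eis_norm q ^ j"
      using pprime_norm_ge_4[OF mult(1)] by (intro power_mono) auto
    ultimately show ?thesis using less_exp[of j] by linarith
  qed
  then have finJ: "finite J" by (meson bounded_nat_set_is_finite)
  have 1: "pp_divisors y = R \<union> Pair q ` (J - {0})"
    using mult(1) by (auto simp: pp_divisors_def prime_powers_def R_def J_def)
  have "pp_divisors (q * y) = R \<union> Pair q ` Suc ` J"
  proof (intro Set.set_eqI iffI)
    fix z assume z: "z \<in> pp_divisors (q * y)"
    obtain p j where pj: "z = (p, j)" "pprime p" "j \<ge> 1" "p ^ j dvd q * y"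
      using z by (auto simp: pp_divisors_def prime_powers_def)
    show "z \<in> R \<union> Pair q ` Suc ` J"
    proof (cases "p = q")
      case True
      obtain i where i: "j = Suc i" using pj(3) by (cases j) auto
      then have "q * q ^ i dvd q * y" using pj(4) True by simp
      then have "i \<in> J" using q0 by (simp add: J_def)
      then show ?thesis using pj(1) True i by simp
    next
      case False
      then show ?thesis using pj pprime_power_dvd_mult[OF pj(2) mult(1) False]
        by (simp add: R_def pp_divisors_def prime_powers_def)
    qed
  next
    fix z assume "z \<in> R \<union> Pair q ` Suc ` J"
    then show "z \<in> pp_divisors (q * y)"
      using mult(1) by (auto simp: R_def J_def pp_divisors_def prime_powers_def mult_dvd_mono)
  qed
  note 2 = this
  have finR: "finite R" using mult.IH unfolding 1 by simp
  have "(\<Sum>(p, j)\<in>pp_divisors y. ln (real (eis_norm p)))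
      = (\<Sum>(p, j)\<in>R. ln (real (eis_norm p))) + real (card (J - {0})) * ln (real (eis_norm q))"
    unfolding 1 using finR finJ
    by (subst sum.union_disjoint) (auto simp: R_def sum.reindex inj_on_def)
  moreover have "(\<Sum>(p, j)\<in>pp_divisors (q * y). ln (real (eis_norm p)))
      = (\<Sum>(p, j)\<in>R. ln (real (eis_norm p))) + real (card J) * ln (real (eis_norm q))"
    unfolding 2 using finR finJ
    by (subst sum.union_disjoint) (auto simp: R_def sum.reindex inj_on_def card_image)
  moreover have "real (card J) = real (card (J - {0})) + 1"
  proof -
    have "0 \<in> J" by (simp add: J_def)
    then have "card J = Suc (card (J - {0}))" using finJ by (metis card_Suc_Diff1)
    then show ?thesis by simp
  qed
  moreover have "ln (real (eis_norm (q * y))) = ln (real (eis_norm q)) + ln (real (eis_norm y))"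
    using q0 y0 by (simp add: ln_mult)
  ultimately show ?case using mult.IH finR finJ unfolding 2 by (simp add: algebra_simps)
qed

lemma prime_powers_cofactor_bij:
  "bij_betw (\<lambda>((p, j), y). (p ^ j * y, (p, j))) (prime_powers \<times> {y. primary y})
     (Sigma {x. primary x} pp_divisors)"
proof (rule bij_betwI[where g = "\<lambda>(x, (p, j)). ((p, j), x div p ^ j)"])
  show "(\<lambda>((p, j), y). (p ^ j * y, (p, j))) \<in> prime_powers \<times> {y. primary y} \<rightarrow> Sigma {x. primary x} pp_divisors"
    by (auto simp: prime_powers_def pp_divisors_def intro: primary_mult primary_power pprime_primary)
  have "primary (x div p ^ j)" if "primary x" "pprime p" "p ^ j dvd x" for x p j
    using primary_mult_cancel[OF primary_power[OF pprime_primary[OF that(2)]], of j "x div p ^ j"] that by simp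
  then show "(\<lambda>(x, (p, j)). ((p, j), x div p ^ j)) \<in> Sigma {x. primary x} pp_divisors \<rightarrow> prime_powers \<times> {y. primary y}"
    by (auto simp: prime_powers_def pp_divisors_def)
qed (auto simp: prime_powers_def pp_divisors_def dest: pprime_nonzero)

lemma of_nat_powr_mult:
  "(of_nat (m * n) :: complex) powr s = of_nat m powr s * of_nat n powr s"
  using powr_times_real[of "of_nat m" "of_nat n" s] by simp

text \<open>Stands in for the Euler product. Inserting log = \<Lambda> * 1 into the differentiated
  series and regrouping x = p^j y splits it into a product; absolute convergence of that series
  justifies the regrouping.\<close>

lemma
  assumes f: "hecke_char M f" and s: "Re s > 1"
  defines "a \<equiv> \<lambda>(p, j). f (p ^ j) * of_real (ln (real (eis_norm p))) * of_nat (eis_norm (p ^ j)) powr (- s)"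
  shows lambda_series_summable: "a summable_on prime_powers"
    and dseries_log_eq: "dseries_log f s = lambda_series f s * dseries f s"
proof -
  define b where "b y = f y * of_nat (eis_norm y) powr (- s)" for y
  define G where "G = (\<lambda>(x, (p, j :: nat)). f x * of_real (ln (real (eis_norm p))) * of_nat (eis_norm x) powr (- s))"
  define P where "P = {x. primary x}"
  have inner: "(\<Sum>z\<in>pp_divisors x. G (x, z)) = f x * of_real (ln (real (eis_norm x))) * of_nat (eis_norm x) powr (- s)"
    if "x \<in> P" for x
  proof -
    have "(\<Sum>z\<in>pp_divisors x. G (x, z))
        = (\<Sum>(p, j)\<in>pp_divisors x. of_real (ln (real (eis_norm p)))) * (f x * of_nat (eis_norm x) powr (- s))"
      unfolding sum_distrib_right by (intro sum.cong) (auto simp: G_def)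
    also have "(\<Sum>(p, j)\<in>pp_divisors x. complex_of_real (ln (real (eis_norm p)))) = of_real (ln (real (eis_norm x)))"
      using sum_pp_divisors[of x] that by (simp add: P_def case_prod_unfold flip: of_real_sum)
    finally show ?thesis by simp
  qed
  have inner': "(\<Sum>z\<in>pp_divisors x. norm (G (x, z)))
      = norm (f x * of_real (ln (real (eis_norm x))) * of_nat (eis_norm x) powr (- s))"
    if "x \<in> P" for x
  proof -
    have "(\<Sum>z\<in>pp_divisors x. norm (G (x, z)))
        = (\<Sum>(p, j)\<in>pp_divisors x. ln (real (eis_norm p))) * (norm (f x) * norm (of_nat (eis_norm x) powr (- s) :: complex))"
      unfolding sum_distrib_right by (intro sum.cong) (auto simp: G_def norm_mult ln_nat_nonneg)
    also have "(\<Sum>(p, j)\<in>pp_divisors x. ln (real (eis_norm p))) = ln (real (eis_norm x))"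
      using sum_pp_divisors[of x] that by (simp add: P_def)
    finally show ?thesis by (simp add: norm_mult ln_nat_nonneg)
  qed
  have fin: "finite (pp_divisors x)" if "x \<in> P" for x using sum_pp_divisors[of x] that by (simp add: P_def)
  have sumL: "(\<lambda>x. norm (f x * of_real (ln (real (eis_norm x))) * of_nat (eis_norm x) powr (- s))) summable_on P"
    using dseries_log_summable[OF hecke_charD(4)[OF f] s] by (rule summable_on_subset_banach) simp
  have "(\<lambda>z. norm (G z)) summable_on Sigma P pp_divisors"
    unfolding Infinite_Sum.abs_summable_on_Sigma_iff
  proof (intro conjI ballI)
    show "(\<lambda>y. norm (G (x, y))) summable_on pp_divisors x" if "x \<in> P" for x
      using fin[OF that] by simp
    have "(\<lambda>x. norm (\<Sum>\<^sub>\<infinity>y\<in>pp_divisors x. norm (G (x, y)))) summable_on P \<longleftrightarrow>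
      (\<lambda>x. norm (f x * of_real (ln (real (eis_norm x))) * of_nat (eis_norm x) powr (- s))) summable_on P"
      by (intro summable_on_cong) (simp add: fin inner' sum_nonneg)
    then show "(\<lambda>x. norm (\<Sum>\<^sub>\<infinity>y\<in>pp_divisors x. norm (G (x, y)))) summable_on P" using sumL by simp
  qed
  then have G: "G summable_on Sigma P pp_divisors" by (rule abs_summable_summable)
  have GF: "G ((\<lambda>((p, j), y). (p ^ j * y, (p, j))) z) = a (fst z) * b (snd z)" if "z \<in> prime_powers \<times> P" for z
  proof -
    obtain p j y where z: "z = ((p, j), y)" "pprime p" "primary y"
      using \<open>z \<in> prime_powers \<times> P\<close> by (auto simp: prime_powers_def P_def)
    then have "f (p ^ j * y) = f (p ^ j) * f y"
      by (intro hecke_charD(6)[OF f primary_power[OF pprime_primary]])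
    moreover have "(of_nat (eis_norm (p ^ j * y)) :: complex) powr (- s)
        = of_nat (eis_norm (p ^ j)) powr (- s) * of_nat (eis_norm y) powr (- s)"
      unfolding eis_norm_mult by (rule of_nat_powr_mult)
    ultimately show ?thesis unfolding z(1)
      by (simp add: G_def a_def b_def mult_ac del: eis_norm_mult eis_norm_power)
  qed
  have "(\<lambda>z. G ((\<lambda>((p, j), y). (p ^ j * y, (p, j))) z)) summable_on prime_powers \<times> P"
    using G summable_on_reindex_bij_betw[OF prime_powers_cofactor_bij, of G] by (simp add: P_def)
  then have F: "(\<lambda>z. a (fst z) * b (snd z)) summable_on prime_powers \<times> P"
    by (rule summable_on_cong[THEN iffD1, rotated]) (rule GF)
  \<comment> \<open>The slice y = 1 of the double sum is the series over prime powers itself,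
    because b 1 = 1.\<close>
  have "(\<lambda>z. a (fst z) * b (snd z)) summable_on prime_powers \<times> {1}"
    using F by (rule summable_on_subset_banach) (auto simp: P_def)
  moreover have "bij_betw (\<lambda>z. (z, 1 :: eis)) prime_powers (prime_powers \<times> {1})"
    by (auto simp: bij_betw_def inj_on_def)
  ultimately have "(\<lambda>z. a z * b 1) summable_on prime_powers"
    using summable_on_reindex_bij_betw[of "\<lambda>z. (z, 1)" prime_powers "prime_powers \<times> {1}" "\<lambda>z. a (fst z) * b (snd z)"]
    by simp
  then show "a summable_on prime_powers" by (simp add: b_def hecke_charD(3)[OF f])
  have "dseries_log f s = (\<Sum>\<^sub>\<infinity>x\<in>P. f x * of_real (ln (real (eis_norm x))) * of_nat (eis_norm x) powr (- s))"
    unfolding dseries_log_def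
    by (intro infsum_cong_neutral) (use hecke_charD(5)[OF f] in \<open>auto simp: P_def\<close>)
  also have "\<dots> = (\<Sum>\<^sub>\<infinity>x\<in>P. \<Sum>\<^sub>\<infinity>z\<in>pp_divisors x. G (x, z))"
    by (intro infsum_cong) (simp add: fin inner)
  also have "\<dots> = infsum G (Sigma P pp_divisors)" by (rule infsum_Sigma_banach[OF G])
  also have "\<dots> = (\<Sum>\<^sub>\<infinity>z\<in>prime_powers \<times> P. G ((\<lambda>((p, j), y). (p ^ j * y, (p, j))) z))"
    using infsum_reindex_bij_betw[OF prime_powers_cofactor_bij, of G] by (simp add: P_def)
  also have "\<dots> = (\<Sum>\<^sub>\<infinity>z\<in>prime_powers \<times> P. a (fst z) * b (snd z))"
    by (intro infsum_cong GF)
  also have "\<dots> = (\<Sum>\<^sub>\<infinity>u\<in>prime_powers. \<Sum>\<^sub>\<infinity>y\<in>P. a u * b y)"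
    using infsum_Sigma_banach[OF F] by simp
  also have "\<dots> = infsum a prime_powers * infsum b P"
    by (simp add: infsum_cmult_right' infsum_cmult_left')
  also have "infsum b P = dseries f s"
    unfolding dseries_def b_def
    by (intro infsum_cong_neutral) (use hecke_charD(5)[OF f] in \<open>auto simp: P_def\<close>)
  also have "infsum a prime_powers = lambda_series f s"
    by (simp add: lambda_series_def a_def)
  finally show "dseries_log f s = lambda_series f s * dseries f s" .
qed

text \<open>Far to the right the term 1 at x = 1 dominates, as every other term that occurs has norm
  at least 4. This keeps the continuation from vanishing identically, so its order at 1 is
  finite.\<close>

lemma dseries_nonzero:
  assumes f: "hecke_char M f"
  obtains s where "Re s > 1" "dseries f s \<noteq> 0"
proof -
  define Z where "Z = (\<Sum>\<^sub>\<infinity>x. real (eis_norm x) powr (- 2))"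
  have Z: "((\<lambda>x. real (eis_norm x) powr (- 2)) has_sum Z) UNIV"
    unfolding Z_def by (intro has_sum_infsum norm_powr_summable) simp
  obtain n :: nat where n: "Z < 4 ^ n"
    using real_arch_pow[of 4 Z] by auto
  define s where "s = complex_of_real (2 + real n)"
  have s: "Re s > 1" by (simp add: s_def)
  define b where "b x = f x * of_nat (eis_norm x) powr (- s)" for x
  have "(b has_sum dseries f s) UNIV"
    unfolding b_def by (rule dseries_has_sum[OF hecke_charD(4)[OF f] s])
  moreover have "((\<lambda>x :: eis. if x = 1 then - 1 else 0 :: complex) has_sum (- 1)) UNIV"
    using has_sum_finite_neutralI[of "{1 :: eis}" UNIV "\<lambda>x. if x = 1 then - 1 else 0 :: complex" "- 1"] by simp
  ultimately have d: "((\<lambda>x. b x + (if x = 1 then - 1 else 0)) has_sum (dseries f s + - 1)) UNIV"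
    by (rule has_sum_add)
  have le: "norm (b x + (if x = 1 then - 1 else 0)) \<le> (1 / 4 ^ n) * real (eis_norm x) powr (- 2)" for x
  proof (cases "x = 1 \<or> f x = 0")
    case True
    then show ?thesis using hecke_charD(3)[OF f] by (auto simp: b_def)
  next
    case False
    then have px: "primary x" using hecke_charD(5)[OF f] by blast
    have N4: "real (eis_norm x) \<ge> 4"
    proof -
      obtain p where p: "pprime p" "p dvd x" using pprime_divisor_exists[OF px] False by blast
      then have "eis_norm p \<le> eis_norm x"
        using eis_norm_dvd eis_norm_pos[OF primary_nonzero[OF px]] dvd_imp_le by blast
      then show ?thesis using pprime_norm_ge_4[OF p(1)] by linarith
    qed
    have "norm (b x + (if x = 1 then - 1 else 0)) \<le> 1 * real (eis_norm x) powr (- 2 - real n)"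
      using False hecke_charD(4)[OF f, of x]
      by (auto simp: b_def norm_mult norm_of_nat_powr s_def intro!: mult_left_le_one_le)
    also have "\<dots> = real (eis_norm x) powr (- 2) / real (eis_norm x) ^ n"
      using N4 by (simp add: powr_diff powr_realpow)
    also have "\<dots> \<le> real (eis_norm x) powr (- 2) / 4 ^ n"
      using N4 by (intro divide_left_mono power_mono) auto
    finally show ?thesis by simp
  qed
  have "((\<lambda>x. (1 / 4 ^ n) * real (eis_norm x) powr (- 2)) has_sum (1 / 4 ^ n) * Z) UNIV"
    by (intro has_sum_cmult_right Z)
  from norm_infsum_le[OF d this] le have "norm (dseries f s + - 1) \<le> (1 / 4 ^ n) * Z" by blast
  also have "\<dots> < 1" using n by (simp add: field_simps)
  finally have "dseries f s \<noteq> 0" by auto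
  then show ?thesis using that s by blast
qed

text \<open>\<open>m\<close> is the order of vanishing at 1, finite since H is not 0 on the
  connected half-plane. Expressing it as a limit lets orders of several series be added and
  compared.\<close>

lemma log_deriv_order:
  assumes H: "H holomorphic_on {s. Re s > 1 / 2}" and nz: "Re s0 > 1 / 2" "H s0 \<noteq> 0"
  obtains m :: nat where "((\<lambda>s. (s - 1) * deriv H s / H s) \<longlongrightarrow> of_nat m) (at 1)"
    "m = 0 \<longleftrightarrow> H 1 \<noteq> 0" "\<forall>\<^sub>F s in at 1. H s \<noteq> 0"
proof -
  define S where "S = {s. Re s > 1 / 2}"
  have S: "open S" "connected S" "1 \<in> S"
    unfolding S_def by (rule open_halfspace_Re_gt, rule convex_connected, rule convex_halfspace_Re_gt) simp
  have "\<exists>n g r. 0 < r \<and> ball 1 r \<subseteq> S \<and> g holomorphic_on ball 1 r \<and>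
      (\<forall>w\<in>ball 1 r. H w = (w - 1) ^ n * g w \<and> g w \<noteq> 0) \<and> (n = 0 \<longleftrightarrow> H 1 \<noteq> 0)"
  proof (cases "H 1 = 0")
    case True
    have "\<not> H constant_on S"
      using True nz S(3) unfolding constant_on_def S_def by (metis mem_Collect_eq)
    then obtain g r n where "0 < n" "0 < r" "ball 1 r \<subseteq> S" "g holomorphic_on ball 1 r"
      "\<And>w. w \<in> ball 1 r \<Longrightarrow> H w = (w - 1) ^ n * g w" "\<And>w. w \<in> ball 1 r \<Longrightarrow> g w \<noteq> 0"
      using holomorphic_factor_zero_nonconstant[of H S 1] H S True unfolding S_def by metis
    then show ?thesis using True by blast
  next
    case False
    have "isCont H 1"
      using holomorphic_on_imp_continuous_on[OF H] S continuous_on_eq_continuous_at unfolding S_def by blast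
    then have "\<forall>\<^sub>F w in nhds 1. H w \<noteq> 0"
      using False tendsto_imp_eventually_ne[of H "H 1" "nhds 1" 0]
      by (simp add: isCont_def tendsto_at_iff_tendsto_nhds)
    moreover have "\<forall>\<^sub>F w in nhds 1. w \<in> S" using S by (simp add: eventually_nhds_in_open)
    ultimately have "\<forall>\<^sub>F w in nhds 1. H w \<noteq> 0 \<and> w \<in> S" by (rule eventually_conj)
    then obtain r where r: "r > 0" "\<And>w. dist w 1 < r \<Longrightarrow> H w \<noteq> 0 \<and> w \<in> S"
      unfolding eventually_nhds_metric by blast
    then have "ball 1 r \<subseteq> S" by (auto simp: dist_commute)
    moreover have "H holomorphic_on ball 1 r"
      using H \<open>ball 1 r \<subseteq> S\<close> holomorphic_on_subset unfolding S_def by blast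
    ultimately show ?thesis using False r
      by (intro exI[of _ 0] exI[of _ H] exI[of _ r]) (auto simp: dist_commute)
  qed
  then obtain n g r where r: "0 < r" "ball 1 r \<subseteq> S" and g: "g holomorphic_on ball 1 r"
    and Hg: "\<And>w. w \<in> ball 1 r \<Longrightarrow> H w = (w - 1) ^ n * g w" "\<And>w. w \<in> ball 1 r \<Longrightarrow> g w \<noteq> 0"
    and n: "n = 0 \<longleftrightarrow> H 1 \<noteq> 0" by blast
  have ev: "\<forall>\<^sub>F s in at 1. s \<in> ball 1 r \<and> s \<noteq> (1 :: complex)"
    using r(1) by (auto simp: eventually_at dist_commute intro!: exI[of _ r])
  have eq: "(s - 1) * deriv H s / H s = of_nat n + (s - 1) * (deriv g s / g s)" if s: "s \<in> ball 1 r \<and> s \<noteq> 1" for s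
  proof -
    have gd: "(g has_field_derivative deriv g s) (at s)"
      using g s by (intro holomorphic_derivI[of g "ball 1 r"]) auto
    have "((\<lambda>w. (w - 1) ^ n * g w) has_field_derivative
        (of_nat n * (s - 1) ^ (n - 1)) * g s + (s - 1) ^ n * deriv g s) (at s)"
      by (auto intro!: derivative_eq_intros gd)
    then have "(H has_field_derivative (of_nat n * (s - 1) ^ (n - 1)) * g s + (s - 1) ^ n * deriv g s) (at s)"
      by (rule has_field_derivative_transform_within_open[where S = "ball 1 r"]) (use s Hg(1) in auto)
    then have dH: "deriv H s = (of_nat n * (s - 1) ^ (n - 1)) * g s + (s - 1) ^ n * deriv g s"
      by (rule DERIV_imp_deriv)
    \<comment> \<open>For n = 0 the exponent n - 1 is cut off at 0, but then the factor
      \<open>of_nat n\<close> vanishes.\<close>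
    have E: "(s - 1) * (of_nat n * (s - 1) ^ (n - 1)) = of_nat n * (s - 1) ^ n"
      by (cases n) auto
    have "(s - 1) * deriv H s = ((s - 1) * (of_nat n * (s - 1) ^ (n - 1))) * g s + (s - 1) * ((s - 1) ^ n * deriv g s)"
      unfolding dH by (simp only: distrib_left mult.assoc)
    then have "(s - 1) * deriv H s = of_nat n * ((s - 1) ^ n * g s) + (s - 1) * ((s - 1) ^ n * deriv g s)"
      unfolding E by (simp only: mult.assoc)
    moreover have "H s = (s - 1) ^ n * g s" "(s - 1) ^ n \<noteq> 0" "g s \<noteq> 0" using Hg s by auto
    ultimately show ?thesis by (simp add: add_divide_distrib)
  qed
  have "isCont (deriv g) 1" "isCont g 1"
    using holomorphic_deriv[OF g] g r(1) holomorphic_on_imp_continuous_on continuous_on_eq_continuous_at[OF open_ball]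
    by (metis centre_in_ball open_ball)+
  then have "((\<lambda>s. of_nat n + (s - 1) * (deriv g s / g s)) \<longlongrightarrow> of_nat n + (1 - 1) * (deriv g 1 / g 1)) (at 1)"
    using Hg(2)[of 1] r(1) unfolding isCont_def by (intro tendsto_intros) auto
  then have "((\<lambda>s. of_nat n + (s - 1) * (deriv g s / g s)) \<longlongrightarrow> of_nat n) (at 1)"
    by (simp only: diff_self mult_zero_left add_0_right)
  then have "((\<lambda>s. (s - 1) * deriv H s / H s) \<longlongrightarrow> of_nat n) (at 1)"
    by (subst tendsto_cong[OF eventually_mono[OF ev eq]]) simp
  moreover have "\<forall>\<^sub>F s in at 1. H s \<noteq> 0"
    using ev by eventually_elim (use Hg in auto)
  ultimately show ?thesis using that n by blast
qed

lemma filterlim_of_real_at_right_1: "filterlim complex_of_real (at 1) (at_right 1)"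
proof -
  have "((\<lambda>x. complex_of_real x) \<longlongrightarrow> of_real 1) (at_right 1)" by (intro tendsto_intros)
  then show ?thesis by (auto simp: filterlim_at eventually_at_right_less intro: eventually_mono[OF eventually_at_right_less])
qed

lemma hecke_order_nontrivial:
  assumes f: "hecke_char M f" and sum0: "(\<Sum>r\<in>reps M. f r) = 0"
  obtains m :: nat where
    "((\<lambda>s. of_real (s - 1) * lambda_series f (of_real s)) \<longlongrightarrow> - of_nat m) (at_right 1)"
proof -
  note f1 = hecke_charD(4)[OF f]
  obtain H where H: "H holomorphic_on {s. Re s > 1 / 2}" "\<And>s. Re s > 1 \<Longrightarrow> H s = dseries f s"
    using dseries_continuation[OF hecke_charD(1,2)[OF f] sum0 f1] by metis
  obtain s0 where s0: "Re s0 > 1" "dseries f s0 \<noteq> 0" using dseries_nonzero[OF f] .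
  then have "Re s0 > 1 / 2" "H s0 \<noteq> 0" using H(2) by auto
  then obtain m where m: "((\<lambda>s. (s - 1) * deriv H s / H s) \<longlongrightarrow> of_nat m) (at 1)" "\<forall>\<^sub>F s in at 1. H s \<noteq> 0"
    using log_deriv_order[OF H(1)] by metis
  have d: "deriv H s = - lambda_series f s * H s" if "Re s > 1" for s
  proof -
    have "(dseries f has_field_derivative - dseries_log f s) (at s)"
      by (rule dseries_has_derivative[OF f1 that])
    then have "(H has_field_derivative - dseries_log f s) (at s)"
      by (rule has_field_derivative_transform_within_open[where S = "{s. Re s > 1}"])
         (use H(2) that open_halfspace_Re_gt in auto)
    then show ?thesis using dseries_log_eq[OF f that] H(2)[OF that] by (simp add: DERIV_imp_deriv)
  qed
  have "((\<lambda>s. - ((of_real s - 1) * deriv H (of_real s) / H (of_real s))) \<longlongrightarrow> - of_nat m) (at_right 1)"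
    by (intro tendsto_minus filterlim_compose[OF m(1) filterlim_of_real_at_right_1])
  moreover have "\<forall>\<^sub>F s in at_right 1. - ((of_real s - 1) * deriv H (of_real s) / H (of_real s))
      = of_real (s - 1) * lambda_series f (of_real s)"
    using eventually_at_right_less[of "1 :: real"] eventually_compose_filterlim[OF m(2) filterlim_of_real_at_right_1]
    by eventually_elim (simp add: d)
  ultimately have "((\<lambda>s. of_real (s - 1) * lambda_series f (of_real s)) \<longlongrightarrow> - of_nat m) (at_right 1)"
    by (rule Lim_transform_eventually)
  then show ?thesis by (rule that)
qed

section \<open>The principal character\<close>

lemma eis_norm_add_le: "eis_norm (x + y) \<le> 2 * eis_norm x + 2 * eis_norm y"
proof -
  have "2 * int (eis_norm x) + 2 * int (eis_norm y) = int (eis_norm (x + y)) + int (eis_norm (x - y))"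
    by (simp add: int_eis_norm algebra_simps)
  then show ?thesis by linarith
qed

text \<open>The points M (k + b \<omega>) + 1 with b < k suffice: row k has k of them, of norm at
  most C k^2, so it contributes at least 1 / (C k) and the harmonic series appears. C comes from N(x
  + y) \<le> 2 N(x) + 2 N(y) and the bound 3 k^2 on shell k.\<close>

lemma reciprocal_norm_sum_unbounded:
  assumes M: "M \<noteq> 0" and nz: "\<And>x. M dvd x - 1 \<Longrightarrow> x \<noteq> 0"
  obtains F where "finite F" "\<And>x. x \<in> F \<Longrightarrow> M dvd x - 1" "B < (\<Sum>x\<in>F. 1 / real (eis_norm x))"
proof -
  define C where "C = 6 * real (eis_norm M) + 2"
  have C: "C > 0" by (simp add: C_def add_nonneg_pos)
  define z where "z = (\<lambda>(k, b). M * Eis (int k) (int b) + 1)"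
  have "\<forall>\<^sub>F n in sequentially. B * C < harm n"
    using harm_at_top unfolding filterlim_at_top_dense by blast
  then obtain n where n: "B * C < harm n" by (auto simp: eventually_sequentially)
  define I where "I = Sigma {1..n} (\<lambda>k. {..<k})"
  have inj: "inj_on z I" using M by (auto simp: inj_on_def z_def)
  have le: "1 / (C * real k ^ 2) \<le> 1 / real (eis_norm (z (k, b)))" if "(k, b) \<in> I" for k b
  proof -
    have kb: "k \<ge> 1" "b < k" using that by (auto simp: I_def)
    then have "Eis (int k) (int b) \<in> shell k" by (simp add: shell_def)
    then have "eis_norm (Eis (int k) (int b)) \<le> 3 * k\<^sup>2" by (rule shell_norm_le)
    then have "eis_norm M * eis_norm (Eis (int k) (int b)) \<le> eis_norm M * (3 * k\<^sup>2)" by (rule mult_le_mono2)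
    moreover have "eis_norm (z (k, b)) \<le> 2 * (eis_norm M * eis_norm (Eis (int k) (int b))) + 2"
      using eis_norm_add_le[of "M * Eis (int k) (int b)" 1] by (simp add: z_def)
    ultimately have "eis_norm (z (k, b)) \<le> 2 * (eis_norm M * (3 * k\<^sup>2)) + 2" by linarith
    also have "\<dots> \<le> 6 * eis_norm M * k\<^sup>2 + 2 * k\<^sup>2" using kb by simp
    finally have "real (eis_norm (z (k, b))) \<le> real (6 * eis_norm M * k\<^sup>2 + 2 * k\<^sup>2)"
      by (rule of_nat_mono)
    also have "\<dots> = C * real k ^ 2" by (simp add: C_def algebra_simps)
    finally have "real (eis_norm (z (k, b))) \<le> C * real k ^ 2" .
    moreover have "real (eis_norm (z (k, b))) > 0"
      using eis_norm_pos[OF nz[of "z (k, b)"]] by (simp add: z_def)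
    ultimately show ?thesis by (intro divide_left_mono) auto
  qed
  have "harm n / C = (\<Sum>k=1..n. \<Sum>b<k. 1 / (C * real k ^ 2))"
    unfolding harm_def sum_divide_distrib
    by (intro sum.cong refl) (simp add: field_simps power2_eq_square)
  also have "\<dots> = (\<Sum>(k, b)\<in>I. 1 / (C * real k ^ 2))"
    unfolding I_def by (rule sum.Sigma) auto
  also have "\<dots> \<le> (\<Sum>(k, b)\<in>I. 1 / real (eis_norm (z (k, b))))"
    using le by (intro sum_mono) auto
  also have "\<dots> = (\<Sum>x\<in>z ` I. 1 / real (eis_norm x))"
    using sum.reindex[OF inj, of "\<lambda>x. 1 / real (eis_norm x)"] by (simp add: o_def case_prod_unfold)
  finally have "harm n / C \<le> (\<Sum>x\<in>z ` I. 1 / real (eis_norm x))" .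
  moreover have "B < harm n / C" using n C by (simp add: field_simps)
  ultimately have "B < (\<Sum>x\<in>z ` I. 1 / real (eis_norm x))" by linarith
  moreover have "finite (z ` I)" by (simp add: I_def)
  moreover have "M dvd x - 1" if "x \<in> z ` I" for x using that by (auto simp: z_def)
  ultimately show ?thesis using that by blast
qed

text \<open>Subtracting four times the sum over even elements gives mean value \<open>0\<close>; this multiplies
  the series by \<open>1 - 4\<^sup>1\<^sup>-\<^sup>s\<close>, and the factor \<open>1/5\<close> only restores the bound \<open>1\<close>.\<close>
lemma principal_dseries_continuation:
  assumes f: "hecke_char M f"
  obtains H where "H holomorphic_on {s. Re s > 1 / 2}"
    "\<And>s. Re s > 1 \<Longrightarrow> H s = (1 - 4 * 4 powr (- s)) / 5 * dseries f s"
proof -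
  note M = hecke_charD(1)[OF f] and per = hecke_charD(2)[OF f] and f1 = hecke_charD(4)[OF f]
  define g where "g x = (if 2 dvd x then f (x div 2) else 0)" for x
  define h where "h x = (f x - 4 * g x) / 5" for x
  have M2: "2 * M \<noteq> 0" using M by simp
  have g1: "norm (g x) \<le> 1" for x using f1 by (simp add: g_def)
  have h1: "norm (h x) \<le> 1" for x
  proof -
    have "norm (f x - 4 * g x) \<le> norm (f x) + norm (4 * g x)" by (rule norm_triangle_ineq4)
    also have "\<dots> \<le> 1 + 4 * 1" using f1[of x] g1[of x] by (intro add_mono) (auto simp: norm_mult)
    finally show ?thesis by (simp add: h_def norm_divide)
  qed
  have perf: "periodic (2 * M) f" by (rule periodic_dvd[OF per]) simp
  have perg: "periodic (2 * M) g"
    unfolding periodic_def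
  proof (intro allI impI)
    fix x y assume d: "2 * M dvd x - y"
    then have "2 dvd x - y" using dvd_mult_left by blast
    then have e: "2 dvd x \<longleftrightarrow> 2 dvd y" by (metis dvd_diffD1 dvd_diff_sym dvd_add_left_iff diff_add_cancel)
    show "g x = g y"
    proof (cases "2 dvd x")
      case True
      then obtain a b where ab: "x = 2 * a" "y = 2 * b" using e by (auto elim!: dvdE)
      then have "2 * M dvd 2 * (a - b)" using d by (simp add: algebra_simps)
      then have "(2 :: eis) = 0 \<or> M dvd a - b" by (simp only: dvd_mult_cancel_left)
      then have "M dvd a - b" by simp
      then show ?thesis using periodicD[OF per] by (simp add: g_def ab)
    qed (use e in \<open>simp add: g_def\<close>)
  qed
  have "(\<Sum>x\<in>reps (2 * M). f x) = 4 * (\<Sum>x\<in>reps M. f x)"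
  proof -
    have "(\<Sum>x\<in>reps (M * 2). f x) = (\<Sum>q\<in>reps 2. \<Sum>r\<in>reps M. f (r + M * q))"
      using perf by (intro sum_reps_product[OF M]) (simp_all add: mult.commute)
    also have "\<dots> = (\<Sum>q\<in>reps 2. \<Sum>r\<in>reps M. f r)"
      by (intro sum.cong refl periodicD[OF per]) simp
    also have "\<dots> = 4 * (\<Sum>x\<in>reps M. f x)"
      using card_reps[of 2] eis_norm_of_nat[of 2] by simp
    finally show ?thesis by (simp add: mult.commute)
  qed
  moreover have "(\<Sum>x\<in>reps (2 * M). g x) = (\<Sum>x\<in>reps M. f x)"
  proof -
    have "(\<Sum>x\<in>reps (2 * M). g x) = (\<Sum>q\<in>reps M. \<Sum>r\<in>reps 2. g (r + 2 * q))"
      using perg by (intro sum_reps_product M) simp_all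
    also have "\<dots> = (\<Sum>q\<in>reps M. \<Sum>r\<in>reps 2. if r = 0 then f q else 0)"
    proof (intro sum.cong refl)
      fix q r :: eis assume r: "r \<in> reps 2"
      have "2 dvd r \<longleftrightarrow> r = 0" using reps_mod[OF r] by (metis dvd_0_right dvd_eq_mod_eq_0)
      moreover have "2 dvd r + 2 * q \<longleftrightarrow> 2 dvd r" by (rule dvd_add_left_iff) simp
      ultimately show "g (r + 2 * q) = (if r = 0 then f q else 0)" by (cases "r = 0") (simp_all add: g_def)
    qed
    also have "\<dots> = (\<Sum>q\<in>reps M. f q)"
    proof -
      have "0 \<in> reps 2" using mod_in_reps[of 0 2] by simp
      then show ?thesis using finite_reps[of 2] by (intro sum.cong refl) simp
    qed
    finally show ?thesis .
  qed
  ultimately have sum0: "(\<Sum>x\<in>reps (2 * M). h x) = 0"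
    by (simp add: h_def sum_subtractf flip: sum_divide_distrib sum_distrib_left)
  have perh: "periodic (2 * M) h"
    using perf perg unfolding periodic_def h_def by metis
  obtain H where H: "H holomorphic_on {s. Re s > 1 / 2}" "\<And>s. Re s > 1 \<Longrightarrow> H s = dseries h s"
    using dseries_continuation[OF M2 perh sum0 h1] by metis
  have "dseries h s = (1 - 4 * 4 powr (- s)) / 5 * dseries f s" if s: "Re s > 1" for s
  proof -
    define L where "L = dseries f s"
    have L: "((\<lambda>x. f x * of_nat (eis_norm x) powr (- s)) has_sum L) UNIV"
      unfolding L_def by (rule dseries_has_sum[OF f1 s])
    have t: "g (2 * x) * of_nat (eis_norm (2 * x)) powr (- s) = 4 powr (- s) * (f x * of_nat (eis_norm x) powr (- s))" for x
    proof -
      have "eis_norm 2 = 4" using eis_norm_of_nat[of 2] by simp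
      then show ?thesis using of_nat_powr_mult[of 4 "eis_norm x" "- s"] by (simp add: g_def)
    qed
    have "((\<lambda>x. g (2 * x) * of_nat (eis_norm (2 * x)) powr (- s)) has_sum 4 powr (- s) * L) UNIV"
      unfolding t by (rule has_sum_cmult_right[OF L])
    moreover have "inj ((*) (2 :: eis))" by (auto simp: inj_def)
    ultimately have "((\<lambda>x. g x * of_nat (eis_norm x) powr (- s)) has_sum 4 powr (- s) * L) (range ((*) 2))"
      by (subst has_sum_reindex) (simp_all add: o_def)
    then have g: "((\<lambda>x. g x * of_nat (eis_norm x) powr (- s)) has_sum 4 powr (- s) * L) UNIV"
      by (subst (asm) has_sum_cong_neutral[where T = UNIV and g = "\<lambda>x. g x * of_nat (eis_norm x) powr (- s)"])
         (auto simp: g_def elim: dvdE)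
    have "((\<lambda>x. 1 / 5 * (f x * of_nat (eis_norm x) powr (- s)) + (- 4 / 5) * (g x * of_nat (eis_norm x) powr (- s)))
        has_sum 1 / 5 * L + (- 4 / 5) * (4 powr (- s) * L)) UNIV"
      by (intro has_sum_add has_sum_cmult_right L g)
    also have "(\<lambda>x. 1 / 5 * (f x * of_nat (eis_norm x) powr (- s)) + (- 4 / 5) * (g x * of_nat (eis_norm x) powr (- s)))
        = (\<lambda>x. h x * of_nat (eis_norm x) powr (- s))"
      by (auto simp: h_def field_simps)
    finally have "dseries h s = 1 / 5 * L + (- 4 / 5) * (4 powr (- s) * L)"
      unfolding dseries_def by (rule infsumI)
    then show ?thesis by (simp add: L_def field_simps)
  qed
  then show ?thesis using that H by simp
qed

text \<open>Here H = e L, where e has a simple zero at 1. Once H(1) is known to be nonzero, the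
  limit 1 comes from e'/e alone, since -L'/L = e'/e - H'/H.\<close>

lemma hecke_order_principal:
  assumes f: "hecke_char M f" and f01: "\<And>x. f x = 0 \<or> f x = 1"
  shows "((\<lambda>s. of_real (s - 1) * lambda_series f (of_real s)) \<longlongrightarrow> 1) (at_right 1)"
proof -
  note M = hecke_charD(1)[OF f] and per = hecke_charD(2)[OF f] and f1 = hecke_charD(4)[OF f]
  define e where "e s = (1 - 4 * 4 powr (- s)) / (5 :: complex)" for s
  define e' where "e' s = 4 * of_real (ln 4) * 4 powr (- s) / (5 :: complex)" for s
  obtain H where H: "H holomorphic_on {s. Re s > 1 / 2}" "\<And>s. Re s > 1 \<Longrightarrow> H s = e s * dseries f s"
    using principal_dseries_continuation[OF f] unfolding e_def by metis
  have Ln4: "Ln 4 = complex_of_real (ln 4)" using Ln_of_nat[of 4] by simp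
  have de: "(e has_field_derivative e' s) (at s)" for s
    unfolding e_def[abs_def] e'_def
    by (auto intro!: derivative_eq_intros simp: powr_def exp_diff Ln4 field_simps)
  have e1: "e 1 = 0" "e' 1 = of_real (ln 4) / 5"
    by (simp_all add: e_def e'_def powr_minus powr_one)
  have e'1: "e' 1 \<noteq> 0" by (simp add: e1)
  have "((\<lambda>s. (e s - e 1) / (s - 1)) \<longlongrightarrow> e' 1) (at 1)"
    using de[of 1] unfolding has_field_derivative_iff .
  then have lim: "((\<lambda>s. inverse ((e s - e 1) / (s - 1))) \<longlongrightarrow> inverse (e' 1)) (at 1)"
    by (rule tendsto_inverse[OF _ e'1])
  then have lim: "((\<lambda>s. (s - 1) / e s) \<longlongrightarrow> inverse (e' 1)) (at 1)" by (simp add: e1 inverse_eq_divide)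
  have "isCont e' 1" unfolding e'_def[abs_def] by (intro continuous_intros) auto
  then have "(e' \<longlongrightarrow> e' 1) (at 1)" by (simp add: isCont_def)
  from tendsto_mult[OF lim this] have lim1: "((\<lambda>s. (s - 1) / e s * e' s) \<longlongrightarrow> 1) (at 1)"
    using e'1 by simp
  obtain s0 where s0: "Re s0 > 1" "dseries f s0 \<noteq> 0" using dseries_nonzero[OF f] .
  have ene: "e s \<noteq> 0" if "Re s > 1" for s
  proof
    assume "e s = 0"
    then have "4 powr s = 4" by (simp add: e_def powr_minus field_simps)
    then have "norm (4 powr s :: complex) = 4" by simp
    then have "4 powr (Re s) = (4 :: real) powr 1" using norm_of_nat_powr[of 4 s] by simp
    then have "Re s = 1" by (subst (asm) powr_inj) auto
    then show False using that by simp
  qed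
  have "Re s0 > 1 / 2" "H s0 \<noteq> 0" using H(2)[OF s0(1)] s0 ene by auto
  then obtain m where m: "((\<lambda>s. (s - 1) * deriv H s / H s) \<longlongrightarrow> of_nat m) (at 1)" "m = 0 \<longleftrightarrow> H 1 \<noteq> 0" "\<forall>\<^sub>F s in at 1. H s \<noteq> 0"
    using log_deriv_order[OF H(1)] by metis
  have d: "deriv H s = e' s * dseries f s - e s * (lambda_series f s * dseries f s)" if s: "Re s > 1" for s
  proof -
    have "(dseries f has_field_derivative - dseries_log f s) (at s)"
      by (rule dseries_has_derivative[OF f1 s])
    from DERIV_mult[OF de this]
    have "((\<lambda>s. e s * dseries f s) has_field_derivative e' s * dseries f s + - dseries_log f s * e s) (at s)" .
    then have "(H has_field_derivative e' s * dseries f s + - dseries_log f s * e s) (at s)"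
      by (rule has_field_derivative_transform_within_open[where S = "{s. Re s > 1}"])
         (use H(2) s open_halfspace_Re_gt in auto)
    then show ?thesis using dseries_log_eq[OF f s] by (simp add: DERIV_imp_deriv mult.commute)
  qed
  \<comment> \<open>Otherwise L = H / e would stay bounded as s decreases to 1. Its terms are
    nonnegative and include all elements congruent to 1 modulo M, whose reciprocal norms have
    unbounded finite sums.\<close>
  have "H 1 \<noteq> 0"
  proof
    assume H10: "H 1 = 0"
    have "(1 :: complex) \<in> {s. Re s > 1 / 2}" by simp
    then have "(H has_field_derivative deriv H 1) (at 1)"
      using holomorphic_derivI[OF H(1) open_halfspace_Re_gt] by blast
    then have "((\<lambda>s. (H s - H 1) / (s - 1)) \<longlongrightarrow> deriv H 1) (at 1)"
      unfolding has_field_derivative_iff .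
    from tendsto_mult[OF this lim]
    have "((\<lambda>s. H s / (s - 1) * ((s - 1) / e s)) \<longlongrightarrow> deriv H 1 * inverse (e' 1)) (at 1)" by (simp add: H10)
    from filterlim_compose[OF this filterlim_of_real_at_right_1]
    have lim2: "((\<lambda>s. H (of_real s) / (of_real s - 1) * ((of_real s - 1) / e (of_real s))) \<longlongrightarrow> deriv H 1 * inverse (e' 1)) (at_right 1)" .
    have "\<forall>\<^sub>F s in at_right 1. H (of_real s) / (of_real s - 1) * ((of_real s - 1) / e (of_real s)) = dseries f (of_real s)"
      using eventually_at_right_less[of "1 :: real"]
    proof eventually_elim
      case (elim s)
      then have es: "e (of_real s) \<noteq> 0" and Hs: "H (of_real s) = e (of_real s) * dseries f (of_real s)"
        using ene[of "of_real s"] H(2)[of "of_real s"] by simp_all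
      have cancel: "x * y / a * (a / x) = y" if "x \<noteq> 0" "a \<noteq> 0" for a x y :: complex
        using that by simp
      have "complex_of_real s - 1 \<noteq> 0" using elim by simp
      then show ?case unfolding Hs by (rule cancel[OF es])
    qed
    from Lim_transform_eventually[OF lim2 this]
    have lim3: "((\<lambda>s. Re (dseries f (of_real s))) \<longlongrightarrow> Re (deriv H 1 * inverse (e' 1))) (at_right 1)"
      by (rule tendsto_Re)
    define b where "b = Re (deriv H 1 * inverse (e' 1))"
    have fM: "f x = 1" if "M dvd x - 1" for x using periodicD[OF per that] hecke_charD(3)[OF f] by simp
    have "x \<noteq> 0" if "M dvd x - 1" for x
      using fM[OF that] hecke_charD(5)[OF f, of x] primary_nonzero by force
    then obtain F where F: "finite F" "\<And>x. x \<in> F \<Longrightarrow> M dvd x - 1" "b < (\<Sum>x\<in>F. 1 / real (eis_norm x))"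
      using reciprocal_norm_sum_unbounded[OF M] by metis
    have "(\<Sum>x\<in>F. real (eis_norm x) powr (- s)) \<le> Re (dseries f (of_real s))" if s: "s > 1" for s
    proof -
      have "((\<lambda>x. Re (f x * of_nat (eis_norm x) powr (- of_real s))) has_sum Re (dseries f (of_real s))) UNIV"
        using s by (intro has_sum_Re dseries_has_sum[OF f1]) simp
      moreover have r: "Re (f x * of_nat (eis_norm x) powr (- of_real s)) = (if f x = 1 then real (eis_norm x) powr (- s) else 0)" for x
        using f01[of x] powr_of_real[of "real (eis_norm x)" "- s"] by auto
      ultimately have "((\<lambda>x. if f x = 1 then real (eis_norm x) powr (- s) else 0) has_sum Re (dseries f (of_real s))) UNIV"
        by simp
      from finite_sum_le_has_sum[OF this F(1)]
      have "(\<Sum>x\<in>F. if f x = 1 then real (eis_norm x) powr (- s) else 0) \<le> Re (dseries f (of_real s))" by simp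
      moreover have "(\<Sum>x\<in>F. if f x = 1 then real (eis_norm x) powr (- s) else 0) = (\<Sum>x\<in>F. real (eis_norm x) powr (- s))"
        using F(2) fM by (intro sum.cong) auto
      ultimately show ?thesis by simp
    qed
    then have ev: "\<forall>\<^sub>F s in at_right 1. (\<Sum>x\<in>F. real (eis_norm x) powr (- s)) \<le> Re (dseries f (of_real s))"
      using eventually_at_right_less[of "1 :: real"] by (auto elim: eventually_mono)
    have xn: "real (eis_norm x) > 0" if "x \<in> F" for x
      using \<open>\<And>x. M dvd x - 1 \<Longrightarrow> x \<noteq> 0\<close>[OF F(2)[OF that]] eis_norm_pos by simp
    have "((\<lambda>s. \<Sum>x\<in>F. real (eis_norm x) powr (- s)) \<longlongrightarrow> (\<Sum>x\<in>F. real (eis_norm x) powr (- 1))) (at_right 1)"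
      by (intro tendsto_intros) (metis xn less_irrefl)
    from tendsto_le[OF trivial_limit_at_right_real lim3 this ev]
    have "(\<Sum>x\<in>F. real (eis_norm x) powr (- 1)) \<le> b" by (simp add: b_def)
    moreover have "(\<Sum>x\<in>F. real (eis_norm x) powr (- 1)) = (\<Sum>x\<in>F. 1 / real (eis_norm x))"
      using xn by (intro sum.cong) (auto simp: powr_minus_divide)
    ultimately show False using F(3) by simp
  qed
  then have m0: "m = 0" using m(2) by simp
  from tendsto_diff[OF lim1 m(1)]
  have "((\<lambda>s. (s - 1) / e s * e' s - (s - 1) * deriv H s / H s) \<longlongrightarrow> 1) (at 1)" by (simp add: m0)
  from filterlim_compose[OF this filterlim_of_real_at_right_1]
  have lim4: "((\<lambda>s. (of_real s - 1) / e (of_real s) * e' (of_real s) - (of_real s - 1) * deriv H (of_real s) / H (of_real s)) \<longlongrightarrow> 1) (at_right 1)" .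
  have "\<forall>\<^sub>F s in at_right 1. (of_real s - 1) / e (of_real s) * e' (of_real s) - (of_real s - 1) * deriv H (of_real s) / H (of_real s)
      = of_real (s - 1) * lambda_series f (of_real s)"
    using eventually_at_right_less[of "1 :: real"] eventually_compose_filterlim[OF m(3) filterlim_of_real_at_right_1]
  proof eventually_elim
    case (elim s)
    then have s: "Re (of_real s) > 1" by simp
    have "e (of_real s) \<noteq> 0" "dseries f (of_real s) \<noteq> 0" using ene[OF s] H(2)[OF s] elim(2) by auto
    moreover have "a / x * x' - a * (x' * y - x * (l * y)) / (x * y) = a * l"
      if "x \<noteq> 0" "y \<noteq> 0" for a x x' y l :: complex
      using that by (simp add: field_simps)
    ultimately show ?case unfolding d[OF s] H(2)[OF s] of_real_diff of_real_1 by blast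
  qed
  from Lim_transform_eventually[OF lim4 this] show ?thesis .
qed

section \<open>Primes with prescribed cubic characters\<close>

definition of_eis :: "eis \<Rightarrow> complex" where
  "of_eis x = of_int (eis1 x) + of_int (eis2 x) * omega_K"

lemma of_eis_hom [simp]:
  "of_eis 0 = 0" "of_eis 1 = 1"
  "of_eis (x + y) = of_eis x + of_eis y"
  "of_eis (x - y) = of_eis x - of_eis y"
  "of_eis (- x) = - of_eis x"
  by (simp_all add: of_eis_def algebra_simps)

lemma of_eis_mult [simp]: "of_eis (x * y) = of_eis x * of_eis y"
proof -
  have "of_eis x * of_eis y = of_int (eis1 x) * of_int (eis1 y)
      + (of_int (eis1 x) * of_int (eis2 y) + of_int (eis2 x) * of_int (eis1 y)) * omega_K
      + of_int (eis2 x) * of_int (eis2 y) * (omega_K * omega_K)"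
    by (simp add: of_eis_def algebra_simps)
  then show ?thesis unfolding omega_K_square by (simp add: of_eis_def algebra_simps)
qed

lemma of_eis_power [simp]: "of_eis (x ^ n) = of_eis x ^ n"
  by (induction n) auto

lemma cnj_omega_K: "cnj omega_K = - 1 - omega_K"
  by (simp add: omega_K_def cnj_csqrt_minus_3 field_simps)

lemma of_eis_cnj: "of_eis (eis_cnj x) = cnj (of_eis x)"
  by (simp add: of_eis_def cnj_omega_K algebra_simps)

text \<open>Injectivity is read off the norm: an element of the kernel has norm 0.\<close>

lemma of_eis_eq_iff [simp]: "of_eis x = of_eis y \<longleftrightarrow> x = y"
proof
  assume "of_eis x = of_eis y"
  then have z: "of_eis (x - y) = 0" by simp
  have "of_eis ((x - y) * eis_cnj (x - y)) = 0" unfolding of_eis_mult z by simp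
  then have "of_int (int (eis_norm (x - y))) = (0 :: complex)"
    unfolding eis_mult_cnj by (simp add: of_eis_def)
  then show "x = y" by simp
qed simp

lemma of_eis_eq_0_iff [simp]: "of_eis x = 0 \<longleftrightarrow> x = 0"
  using of_eis_eq_iff[of x 0] by simp

lemma norm_cube_root: "(z :: complex) ^ 3 = 1 \<Longrightarrow> norm z = 1"
  by (metis norm_ge_zero norm_one norm_power power_eq_1_iff zero_neq_numeral)

text \<open>Coprimality to all of \<open>B\<close> is demanded separately because
  \<open>0 ^ 0 = 1\<close>: with exponent 0 the multiples of q would otherwise survive, and the
  vectors \<open>v\<close> would not give characters with a common support.\<close>

definition cubic_product :: "eis set \<Rightarrow> (eis \<Rightarrow> nat) \<Rightarrow> eis \<Rightarrow> complex" where
  "cubic_product B v x = (if primary x \<and> (\<forall>q\<in>B. \<not> q dvd x)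
     then (\<Prod>q\<in>B. of_eis (cubic_char q x) ^ v q) else 0)"

lemma hecke_char_cubic_product:
  assumes "finite B" "\<And>q. q \<in> B \<Longrightarrow> pprime q"
  shows "hecke_char (3 * (\<Prod>q\<in>B. q)) (cubic_product B v)"
  unfolding hecke_char_def
proof (intro conjI allI impI)
  show "3 * (\<Prod>q\<in>B. q) \<noteq> 0" using assms pprime_nonzero by auto
  show "periodic (3 * (\<Prod>q\<in>B. q)) (cubic_product B v)"
    unfolding periodic_def
  proof (intro allI impI)
    fix x y assume d: "3 * (\<Prod>q\<in>B. q) dvd x - y"
    then have "3 dvd x - y" using dvd_mult_left by blast
    then have "primary x \<longleftrightarrow> primary y"
      unfolding primary_def by (metis dvd_diff_sym dvd_diff_trans)
    moreover have qd: "q dvd x - y" if "q \<in> B" for q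
      using dvd_trans[OF dvd_prodI[OF assms(1) that, of "\<lambda>x. x"] dvd_trans[OF dvd_triv_right d]] .
    then have "q dvd x \<longleftrightarrow> q dvd y" "cubic_char q x = cubic_char q y" if "q \<in> B" for q
      using that periodicD[OF cubic_char_periodic[OF assms(2)]] cubic_char_eq_0_iff[OF assms(2)] by metis+
    ultimately show "cubic_product B v x = cubic_product B v y"
      unfolding cubic_product_def by (intro if_cong) (auto intro!: prod.cong)
  qed
  show "cubic_product B v 1 = 1"
    using assms pprime_not_dvd_1 by (auto simp: cubic_product_def intro!: prod.neutral)
  fix x
  assume nz: "cubic_product B v x \<noteq> 0"
  show "primary x" using nz by (auto simp: cubic_product_def split: if_splits)
  have "\<not> q dvd x" if "q \<in> B" for q using nz that by (auto simp: cubic_product_def split: if_splits)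
  then have "norm (of_eis (cubic_char q x)) = 1" if "q \<in> B" for q
    using cubic_char_cases(2)[OF assms(2)[OF that]] that
    by (intro norm_cube_root) (simp flip: of_eis_power)
  then have "norm (\<Prod>q\<in>B. of_eis (cubic_char q x) ^ v q) = 1"
    by (simp add: norm_power flip: prod_norm)
  then show "norm (cubic_product B v x) = 1" using nz by (auto simp: cubic_product_def split: if_splits)
next
  fix x y assume xy: "primary x" "primary y"
  then have "primary (x * y)" by (rule primary_mult)
  moreover have "q dvd x * y \<longleftrightarrow> q dvd x \<or> q dvd y" if "q \<in> B" for q
    using pprime_dvd_mult_iff[OF assms(2)[OF that]] .
  moreover have "(\<Prod>q\<in>B. of_eis (cubic_char q (x * y)) ^ v q)
     = (\<Prod>q\<in>B. of_eis (cubic_char q x) ^ v q) * (\<Prod>q\<in>B. of_eis (cubic_char q y) ^ v q)"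
    unfolding prod.distrib[symmetric]
    by (intro prod.cong refl) (simp add: cubic_char_mult assms(2) power_mult_distrib)
  ultimately show "cubic_product B v (x * y) = cubic_product B v x * cubic_product B v y"
    using xy unfolding cubic_product_def by auto
qed

text \<open>The usual substitution x to c x with f(c) \<noteq> 1. As f is multiplicative only on
  primary elements, c is chosen primary: then c x is primary exactly when x is, and both sides
  vanish otherwise.\<close>

lemma cubic_product_sum_zero:
  assumes B: "finite B" "\<And>q. q \<in> B \<Longrightarrow> pprime q" and q0: "q0 \<in> B" "v q0 = 1 \<or> v q0 = 2"
  shows "(\<Sum>x\<in>reps (3 * (\<Prod>q\<in>B. q)). cubic_product B v x) = 0"
proof -
  define M where "M = 3 * (\<Prod>q\<in>B. q)"
  define M' where "M' = 3 * (\<Prod>q\<in>B - {q0}. q)"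
  note hc = hecke_char_cubic_product[OF B, of v, folded M_def]
  have p0: "pprime q0" using B q0 by blast
  have "\<not> q0 dvd M'"
  proof
    assume "q0 dvd M'"
    then have "q0 dvd (\<Prod>q\<in>B - {q0}. q)"
      using pprime_dvd_mult_iff[OF p0] pprime_not_dvd_3[OF p0] unfolding M'_def by blast
    then obtain q where "q \<in> B - {q0}" "q0 dvd q" using prime_elem_dvd_prod[OF _ pprime_prime_elem[OF p0], of "B - {q0}" "\<lambda>x. x"] B(1) by auto
    then show False using pprime_dvd_pprime[OF p0] B(2) by auto
  qed
  then obtain w where w: "q0 dvd M' * w - 1" using eis_inverse_mod_prime p0 pprime_def by blast
  obtain c0 where c0: "\<not> q0 dvd c0" "cubic_char q0 c0 \<noteq> 1" using cubic_char_nontrivial[OF p0] .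
  \<comment> \<open>Chinese remainders: c is 1 modulo M', hence primary and invisible to the other
    characters, and c0 modulo \<open>q0\<close>.\<close>
  define c where "c = 1 + (c0 - 1) * (M' * w)"
  have c1: "M' dvd c - 1" by (simp add: c_def)
  have cc: "q0 dvd c - c0"
  proof -
    have "q0 dvd (c0 - 1) * (M' * w - 1)" using w by (rule dvd_mult)
    also have "(c0 - 1) * (M' * w - 1) = c - c0" by (simp add: c_def algebra_simps)
    finally show ?thesis .
  qed
  have prim: "primary c" using c1 unfolding primary_def M'_def using dvd_mult_left by blast
  have chi: "cubic_char q c = (if q = q0 then cubic_char q0 c0 else 1)" if "q \<in> B" for q
  proof (cases "q = q0")
    case True
    then show ?thesis using periodicD[OF cubic_char_periodic[OF p0] cc] by simp
  next
    case False
    then have "q dvd M'" unfolding M'_def using that B(1) by (intro dvd_mult dvd_prodI[of _ _ "\<lambda>x. x"]) auto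
    then have "q dvd c - 1" using c1 dvd_trans by blast
    then show ?thesis using periodicD[OF cubic_char_periodic[OF B(2)[OF that]]] False B(2)[OF that] by simp
  qed
  have nd: "\<not> q dvd c" if "q \<in> B" for q
    using chi[OF that] cubic_char_eq_0_iff[OF B(2)[OF that], of c] cubic_char_eq_0_iff[OF p0, of c0] c0(1)
    by (auto split: if_splits)
  have fc: "cubic_product B v c = of_eis (cubic_char q0 c0) ^ v q0"
  proof -
    have "cubic_product B v c = (\<Prod>q\<in>B. of_eis (cubic_char q c) ^ v q)"
      using prim nd by (simp add: cubic_product_def)
    also have "\<dots> = (\<Prod>q\<in>B. if q = q0 then of_eis (cubic_char q0 c0) ^ v q0 else 1)"
      by (intro prod.cong) (auto simp: chi)
    finally show ?thesis using B(1) q0(1) by simp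
  qed
  have "cubic_char q0 c0 ^ v q0 \<noteq> 1"
    using q0(2) c0(2) cubic_char_cases(2)[OF p0 c0(1)]
    by (auto simp: eval_nat_numeral)
  then have fc1: "cubic_product B v c \<noteq> 1"
    unfolding fc by (metis of_eis_eq_iff of_eis_hom(2) of_eis_power)
  \<comment> \<open>c is invertible modulo M: a common prime factor would divide 3, impossible for
    primary c, or some q in \<open>B\<close>, where the character of c is not 0.\<close>
  obtain d a b where d: "d dvd c" "d dvd M" "d = a * c + b * M" using eis_bezout by blast
  have "is_unit d"
  proof (rule ccontr)
    assume nu: "\<not> is_unit d"
    have "d \<noteq> 0" using d(1) primary_nonzero[OF prim] by auto
    then obtain p where p: "prime_elem p" "p dvd d" using eis_prime_divisor_exists nu by blast
    have pc: "p dvd c" and "p dvd M" using p(2) d(1,2) dvd_trans by blast+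
    then have "p dvd 3 \<or> p dvd (\<Prod>q\<in>B. q)" using p(1) by (simp add: M_def prime_elem_dvd_mult_iff)
    then show False
    proof
      assume "p dvd 3"
      then have "p dvd c - 1" using prim dvd_trans unfolding primary_def by blast
      then have "p dvd c - (c - 1)" using pc by (rule dvd_diff[rotated])
      then show False using p(1) prime_elem_not_unit by simp
    next
      assume "p dvd (\<Prod>q\<in>B. q)"
      then obtain q where q: "q \<in> B" "p dvd q"
        using prime_elem_dvd_prod[OF B(1) p(1)] by blast
      then have "q dvd p" using prime_elem_dvd_prime_elem p(1) B(2) pprime_prime_elem by blast
      then show False using nd[OF q(1)] pc dvd_trans by blast
    qed
  qed
  then obtain u where u: "d * u = 1" by (metis dvdE)
  have inv: "M dvd c * (a * u) - 1"
  proof -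
    have "c * (a * u) - 1 = M * (- b * u)" unfolding u[symmetric] d(3) by (simp add: algebra_simps)
    then show ?thesis by simp
  qed
  have mult: "cubic_product B v (c * x) = cubic_product B v c * cubic_product B v x" for x
  proof (cases "primary x")
    case True
    then show ?thesis using hecke_charD(6)[OF hc prim] by blast
  next
    case False
    then have "\<not> primary (c * x)" using primary_mult_cancel[OF prim] by blast
    then show ?thesis using hecke_charD(5)[OF hc] False by simp
  qed
  have "(\<Sum>x\<in>reps M. cubic_product B v (c * x)) = (\<Sum>x\<in>reps M. cubic_product B v x)"
    by (rule sum_reps_mult[OF hecke_charD(1,2)[OF hc] inv])
  then have "cubic_product B v c * (\<Sum>x\<in>reps M. cubic_product B v x) = (\<Sum>x\<in>reps M. cubic_product B v x)"
    by (simp add: mult sum_distrib_left)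
  then show ?thesis using fc1 by (simp add: M_def)
qed

text \<open>Proper prime powers contribute a bounded amount near s = 1. The bound is uniform in s
  and in the coefficients, so that it survives the limit s to 1 after multiplication by s -
  1.\<close>

lemma prime_powers_tail_bound:
  "\<exists>K. \<forall>s>1. \<forall>w. (\<forall>z. norm (w z) \<le> C) \<longrightarrow> (\<forall>p. pprime p \<longrightarrow> w (p, 1) = (0 :: complex)) \<longrightarrow>
    norm (\<Sum>\<^sub>\<infinity>(p, j)\<in>prime_powers. w (p, j) * of_real (ln (real (eis_norm p))) *
      of_nat (eis_norm (p ^ j)) powr (- of_real s)) \<le> C * K"
proof -
  \<comment> \<open>For N = N(p) \<ge> 4 and j \<ge> 2, N^(-j) is at most N^(-2) 4^(2 - j), which
    gives the factor 16, and ln N N^(-2) is at most 2 N^(-3/2). The result is a convergent norm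
    series times a geometric series.\<close>
  define t where "t = (\<lambda>(p, j :: nat). 2 * real (eis_norm p) powr (- (3 / 2)) * (16 * (1 / 4 :: real) ^ j))"
  have tn: "t z \<ge> 0" for z by (simp add: t_def case_prod_unfold)
  have geo: "(\<lambda>j. (1 / 4 :: real) ^ j) summable_on UNIV"
    by (rule norm_summable_imp_summable_on) (simp add: summable_geometric norm_power)
  have "(\<lambda>z. norm (t z)) summable_on (UNIV \<times> UNIV)"
    unfolding Infinite_Sum.abs_summable_on_Sigma_iff
  proof (intro conjI ballI)
    show "(\<lambda>j. norm (t (p, j))) summable_on UNIV" for p
      using geo by (simp add: t_def abs_mult summable_on_cmult_right)
    have "(\<Sum>\<^sub>\<infinity>j. norm (t (p, j))) = real (eis_norm p) powr (- (3 / 2)) * (32 * (\<Sum>\<^sub>\<infinity>j. (1 / 4 :: real) ^ j))" for p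
    proof -
      have "(\<Sum>\<^sub>\<infinity>j. norm (t (p, j)))
          = (\<Sum>\<^sub>\<infinity>j. (real (eis_norm p) powr (- (3 / 2)) * 32) * (1 / 4 :: real) ^ j)"
        by (intro infsum_cong) (simp add: t_def abs_mult)
      then show ?thesis unfolding infsum_cmult_right' by simp
    qed
    then show "(\<lambda>p. norm (\<Sum>\<^sub>\<infinity>j. norm (t (p, j)))) summable_on UNIV"
      by (simp add: abs_mult summable_on_cmult_left norm_powr_summable)
  qed
  then have "t summable_on (UNIV \<times> UNIV)" by (rule abs_summable_summable)
  then have "t summable_on prime_powers" by (rule summable_on_subset_banach) simp
  then have T: "(t has_sum infsum t prime_powers) prime_powers" by (rule has_sum_infsum)
  show ?thesis
  proof (intro exI[of _ "infsum t prime_powers"] allI impI)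
    fix s :: real and w :: "eis \<times> nat \<Rightarrow> complex"
    assume s: "s > 1" and w': "\<forall>z. norm (w z) \<le> C" "\<forall>p. pprime p \<longrightarrow> w (p, 1) = 0"
    have w: "\<And>z. norm (w z) \<le> C" "\<And>p. pprime p \<Longrightarrow> w (p, 1) = 0" using w' by blast+
    have C0: "C \<ge> 0" using w(1)[of undefined] norm_ge_zero order_trans by blast
    define F where "F = (\<lambda>(p, j). w (p, j) * of_real (ln (real (eis_norm p))) * of_nat (eis_norm (p ^ j)) powr (- of_real s))"
    have le: "norm (F z) \<le> C * t z" if zp: "z \<in> prime_powers" for z
    proof -
      obtain p j where z: "z = (p, j)" "pprime p" "j \<ge> 1" using zp by (auto simp: prime_powers_def)
      show ?thesis
      proof (cases "j = 1")
        case True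
        then show ?thesis using w(2)[OF z(2)] tn[of z] C0 z by (simp add: F_def)
      next
        case False
        define N where "N = real (eis_norm p)"
        have N4: "N \<ge> 4" using pprime_norm_ge_4[OF z(2)] by (simp add: N_def)
        obtain i where i: "j = i + 2" using z(3) False by (metis add.commute le_Suc_ex less_iff_succ_less_eq nat_less_le one_add_one plus_1_eq_Suc)
        have "real (eis_norm (p ^ j)) powr (- s) \<le> real (eis_norm (p ^ j)) powr (- 1)"
        proof (rule powr_mono)
          have "1 \<le> N ^ j" using N4 by (intro one_le_power) auto
          then show "1 \<le> real (eis_norm (p ^ j))" by (simp add: N_def)
        qed (use s in simp)
        also have "\<dots> = 1 / (N ^ 2 * N ^ i)"
        proof -
          have "real (eis_norm (p ^ j)) = N ^ 2 * N ^ i" by (simp add: N_def i power2_eq_square mult_ac)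
          moreover have "N ^ 2 * N ^ i \<ge> 0" using N4 by simp
          ultimately show ?thesis by (simp add: powr_minus_divide)
        qed
        also have "\<dots> \<le> 1 / (N ^ 2 * 4 ^ i)"
          using N4 by (intro divide_left_mono mult_left_mono power_mono) auto
        also have "\<dots> = N powr (- 2) * (16 * (1 / 4) ^ j)"
        proof -
          have "16 * (1 / 4) ^ j = 1 / (4 :: real) ^ i" by (simp add: i power_divide)
          moreover have "N powr (- 2) = 1 / N ^ 2" using N4 by (simp add: powr_minus_divide)
          ultimately show ?thesis by simp
        qed
        finally have a: "real (eis_norm (p ^ j)) powr (- s) \<le> N powr (- 2) * (16 * (1 / 4) ^ j)" .
        have b: "ln N * N powr (- 2) \<le> 2 * N powr (- (3 / 2))"
          using ln_norm_powr_le[of "1 / 2" "eis_norm p" 2] by (simp add: N_def)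
        have "norm (F z) = norm (w z) * (ln N * real (eis_norm (p ^ j)) powr (- s))"
          using norm_of_nat_powr[of "eis_norm (p ^ j)" "- of_real s"]
          by (simp add: F_def z(1) norm_mult N_def ln_nat_nonneg)
        also have "\<dots> \<le> C * (ln N * (N powr (- 2) * (16 * (1 / 4) ^ j)))"
          using w(1)[of z] a C0 N4 by (intro mult_mono mult_left_mono) auto
        also have "\<dots> = C * ((ln N * N powr (- 2)) * (16 * (1 / 4) ^ j))" by simp
        also have "\<dots> \<le> C * ((2 * N powr (- (3 / 2))) * (16 * (1 / 4) ^ j))"
          using b C0 by (intro mult_left_mono mult_right_mono) auto
        finally show ?thesis by (simp add: t_def z(1) N_def)
      qed
    qed
    have CT: "((\<lambda>z. C * t z) has_sum C * infsum t prime_powers) prime_powers" by (rule has_sum_cmult_right[OF T])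
    have "F summable_on prime_powers"
      by (rule abs_summable_summable, rule Infinite_Sum.abs_summable_on_comparison_test[where g = "\<lambda>z. C * t z"])
         (use has_sum_imp_summable[OF CT] le C0 tn in auto)
    then have "(F has_sum infsum F prime_powers) prime_powers" by (rule has_sum_infsum)
    from norm_infsum_le[OF this CT le]
    show "norm (\<Sum>\<^sub>\<infinity>(p, j)\<in>prime_powers. w (p, j) * of_real (ln (real (eis_norm p))) *
      of_nat (eis_norm (p ^ j)) powr (- of_real s)) \<le> C * infsum t prime_powers" by (simp add: F_def)
  qed
qed

lemma has_sum_finite_sum:
  fixes f :: "'i \<Rightarrow> 'a \<Rightarrow> complex"
  assumes "finite V" "\<And>v. v \<in> V \<Longrightarrow> (f v has_sum b v) A"
  shows "((\<lambda>x. \<Sum>v\<in>V. f v x) has_sum (\<Sum>v\<in>V. b v)) A"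
  using assms by (induction V rule: finite_induct) (auto intro!: has_sum_add has_sum_0)

lemma cube_root_of_unity_sum:
  assumes "(y :: complex) ^ 3 = 1"
  shows "(\<Sum>j<3. y ^ j) = (if y = 1 then 3 else 0)"
proof -
  have "(y - 1) * (1 + y + y ^ 2) = y ^ 3 - 1" by (simp add: eval_nat_numeral algebra_simps)
  then have "y = 1 \<or> 1 + y + y ^ 2 = 0" using assms by simp
  then show ?thesis by (auto simp: eval_nat_numeral)
qed

section \<open>Orthogonality of the cubic characters\<close>

locale cubic_targets =
  fixes B :: "eis set" and g :: "eis \<Rightarrow> eis"
  assumes finite_B: "finite B" and pprime_B: "\<And>q. q \<in> B \<Longrightarrow> pprime q"
    and g_cube: "\<And>q. q \<in> B \<Longrightarrow> g q ^ 3 = 1"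
begin

definition exponents :: "(eis \<Rightarrow> nat) set" where
  "exponents = PiE B (\<lambda>_. {..<3})"

definition zero_exponent :: "eis \<Rightarrow> nat" where
  "zero_exponent = (\<lambda>q\<in>B. 0)"

definition modulus :: eis where
  "modulus = 3 * (\<Prod>q\<in>B. q)"

text \<open>Conjugation inverts the targets, which are cube roots of unity; with these coefficients
  the sum over characters detects \<chi>_q(x) = g q.\<close>

definition coefficient :: "(eis \<Rightarrow> nat) \<Rightarrow> complex" where
  "coefficient v = (\<Prod>q\<in>B. cnj (of_eis (g q)) ^ v q)"

lemma finite_exponents: "finite exponents"
  unfolding exponents_def by (intro finite_PiE finite_B) auto

lemma zero_exponent_in: "zero_exponent \<in> exponents"
  by (auto simp: exponents_def zero_exponent_def)

lemma hecke: "hecke_char modulus (cubic_product B v)"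
  unfolding modulus_def by (rule hecke_char_cubic_product[OF finite_B pprime_B])

text \<open>The factor is the number of exponent vectors, which the orthogonality relation leaves
  behind when it is not normalised.\<close>

definition weight :: "eis \<Rightarrow> complex" where
  "weight x = (if primary x \<and> (\<forall>q\<in>B. \<not> q dvd x \<and> cubic_char q x = g q) then 3 ^ card B else 0)"

text \<open>Orthogonality one prime at a time: the sum over vectors factors into the geometric sums
  over exponents 0, 1, 2 of \<chi>_q(x) / g q, each of which is 3 or 0.\<close>

lemma sum_coefficient_cubic_product:
  "(\<Sum>v\<in>exponents. coefficient v * cubic_product B v x) = weight x"
proof (cases "primary x \<and> (\<forall>q\<in>B. \<not> q dvd x)")
  case True
  define y where "y q = cnj (of_eis (g q)) * of_eis (cubic_char q x)" for q
  have gn: "cnj (of_eis (g q)) * of_eis (g q) = 1" if "q \<in> B" for q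
  proof -
    have "of_eis (g q) ^ 3 = 1" using g_cube[OF that] by (simp flip: of_eis_power)
    then have "norm (of_eis (g q)) = 1" by (rule norm_cube_root)
    then show ?thesis using complex_norm_square[of "of_eis (g q)"] by (simp add: mult.commute)
  qed
  have y3: "y q ^ 3 = 1" if "q \<in> B" for q
  proof -
    have "cubic_char q x ^ 3 = 1" using cubic_char_cases(2)[OF pprime_B[OF that]] True that by blast
    moreover have "of_eis (eis_cnj (g q)) ^ 3 = of_eis (eis_cnj (g q ^ 3))" by simp
    ultimately show ?thesis using g_cube[OF that]
      by (simp add: y_def power_mult_distrib flip: of_eis_cnj of_eis_power)
  qed
  have y1: "y q = 1 \<longleftrightarrow> cubic_char q x = g q" if "q \<in> B" for q
  proof
    assume "y q = 1"
    then have "cnj (of_eis (g q)) * of_eis (cubic_char q x)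
        = cnj (of_eis (g q)) * of_eis (g q)" using gn[OF that] by (simp add: y_def)
    moreover have "cnj (of_eis (g q)) \<noteq> 0" using gn[OF that] by auto
    ultimately show "cubic_char q x = g q" by simp
  qed (use gn[OF that] in \<open>simp add: y_def\<close>)
  have "(\<Sum>v\<in>exponents. coefficient v * cubic_product B v x) = (\<Sum>v\<in>exponents. \<Prod>q\<in>B. y q ^ v q)"
    using True by (simp add: coefficient_def cubic_product_def y_def power_mult_distrib prod.distrib)
  also have "\<dots> = (\<Prod>q\<in>B. \<Sum>j<3. y q ^ j)"
    unfolding exponents_def by (rule prod_sum_PiE[symmetric]) (auto simp: finite_B)
  also have "\<dots> = (\<Prod>q\<in>B. if cubic_char q x = g q then 3 else 0)"
    by (intro prod.cong refl) (simp add: cube_root_of_unity_sum y3 y1)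
  also have "\<dots> = weight x"
  proof (cases "\<forall>q\<in>B. cubic_char q x = g q")
    case all: True
    then have "(\<Prod>q\<in>B. if cubic_char q x = g q then 3 else 0) = (\<Prod>q\<in>B. (3 :: complex))"
      by (intro prod.cong) auto
    then show ?thesis using True all by (simp add: weight_def)
  next
    case False
    then show ?thesis using finite_B by (auto simp: weight_def)
  qed
  finally show ?thesis .
next
  case False
  then have "\<not> (primary x \<and> (\<forall>q\<in>B. \<not> q dvd x \<and> cubic_char q x = g q))" by blast
  moreover have "cubic_product B v x = 0" for v
    unfolding cubic_product_def by (rule if_not_P[OF False])
  ultimately show ?thesis by (simp only: weight_def if_False mult_zero_right sum.neutral_const)
qed

lemma weighted_lambda_has_sum:
  assumes s: "s > 1"
  shows "((\<lambda>(p, j). weight (p ^ j) * of_real (ln (real (eis_norm p))) * of_nat (eis_norm (p ^ j)) powr (- of_real s))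
    has_sum (\<Sum>v\<in>exponents. coefficient v * lambda_series (cubic_product B v) (of_real s))) prime_powers"
proof -
  define a where "a v = (\<lambda>(p, j). cubic_product B v (p ^ j) * of_real (ln (real (eis_norm p)))
    * of_nat (eis_norm (p ^ j)) powr (- complex_of_real s))" for v
  have "(a v has_sum lambda_series (cubic_product B v) (of_real s)) prime_powers" for v
    unfolding lambda_series_def a_def using s
    by (intro has_sum_infsum lambda_series_summable[OF hecke]) simp
  then have "((\<lambda>z. \<Sum>v\<in>exponents. coefficient v * a v z)
      has_sum (\<Sum>v\<in>exponents. coefficient v * lambda_series (cubic_product B v) (of_real s))) prime_powers"
    by (intro has_sum_finite_sum finite_exponents has_sum_cmult_right)
  moreover have "(\<lambda>z. \<Sum>v\<in>exponents. coefficient v * a v z)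
      = (\<lambda>(p, j). weight (p ^ j) * of_real (ln (real (eis_norm p))) * of_nat (eis_norm (p ^ j)) powr (- of_real s))"
    unfolding sum_coefficient_cubic_product[symmetric] a_def
    by (auto simp: fun_eq_iff sum_distrib_right mult.assoc)
  ultimately show ?thesis by simp
qed

lemma nonzero_exponent:
  assumes "v \<in> exponents" "v \<noteq> zero_exponent"
  obtains q where "q \<in> B" "v q = 1 \<or> v q = 2"
proof -
  have "\<exists>q\<in>B. v q \<noteq> 0"
  proof (rule ccontr)
    assume "\<not> (\<exists>q\<in>B. v q \<noteq> 0)"
    then have "v = zero_exponent"
      using assms(1) by (auto simp: exponents_def zero_exponent_def fun_eq_iff PiE_def extensional_def)
    then show False using assms(2) by simp
  qed
  then obtain q where q: "q \<in> B" "v q \<noteq> 0" by blast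
  then have "v q = 1 \<or> v q = 2" using assms(1) by (fastforce simp: exponents_def PiE_def Pi_def)
  then show ?thesis using that q(1) by blast
qed

lemma order_exists:
  assumes "v \<in> exponents" "v \<noteq> zero_exponent"
  shows "\<exists>m :: nat. ((\<lambda>s. of_real (s - 1) * lambda_series (cubic_product B v) (of_real s)) \<longlongrightarrow> - of_nat m) (at_right 1)"
proof -
  obtain q where q: "q \<in> B" "v q = 1 \<or> v q = 2" using nonzero_exponent[OF assms] .
  have "(\<Sum>x\<in>reps modulus. cubic_product B v x) = 0"
    unfolding modulus_def using q by (intro cubic_product_sum_zero[OF finite_B pprime_B])
  then show ?thesis using hecke_order_nontrivial[OF hecke] by metis
qed

lemma order_zero_exponent:
  "((\<lambda>s. of_real (s - 1) * lambda_series (cubic_product B zero_exponent) (of_real s)) \<longlongrightarrow> 1) (at_right 1)"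
  by (rule hecke_order_principal[OF hecke]) (auto simp: cubic_product_def zero_exponent_def)

definition opposite :: "(eis \<Rightarrow> nat) \<Rightarrow> eis \<Rightarrow> nat" where
  "opposite v = (\<lambda>q\<in>B. (3 - v q) mod 3)"

text \<open>Negation modulo 3 fixes only 0, so any nonzero entry of \<open>v\<close> distinguishes
  it from its opposite.\<close>

lemma opposite_exponents:
  assumes "v \<in> exponents" "v \<noteq> zero_exponent"
  shows "opposite v \<in> exponents" "opposite v \<noteq> v" "opposite v \<noteq> zero_exponent"
proof -
  show "opposite v \<in> exponents" by (auto simp: opposite_def exponents_def)
  obtain q where q: "q \<in> B" "v q = 1 \<or> v q = 2" using nonzero_exponent[OF assms] .
  then have "opposite v q \<noteq> v q" "opposite v q \<noteq> zero_exponent q"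
    by (auto simp: opposite_def zero_exponent_def)
  then show "opposite v \<noteq> v" "opposite v \<noteq> zero_exponent" by metis+
qed

lemma cubic_product_opposite:
  assumes "v \<in> exponents"
  shows "cubic_product B (opposite v) x = cnj (cubic_product B v x)"
proof (cases "primary x \<and> (\<forall>q\<in>B. \<not> q dvd x)")
  case True
  have "of_eis (cubic_char q x) ^ opposite v q = cnj (of_eis (cubic_char q x) ^ v q)" if q: "q \<in> B" for q
  proof -
    define y where "y = cubic_char q x"
    have y3: "y ^ 3 = 1" using cubic_char_cases(2)[OF pprime_B[OF q]] True q by (simp add: y_def)
    have yc: "eis_cnj y = y ^ 2" using cube_root_cnj y3 by blast
    have "v q \<in> {..<3}" using assms q by (auto simp: exponents_def)
    then have "v q = 0 \<or> v q = 1 \<or> v q = 2" by auto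
    moreover have "(y ^ 2) ^ 2 = y"
    proof -
      have "(y ^ 2) ^ 2 = y ^ 3 * y" by (simp add: eval_nat_numeral)
      then show ?thesis using y3 by simp
    qed
    moreover have "opposite v q = (3 - v q) mod 3" using q by (simp add: opposite_def)
    ultimately have "y ^ opposite v q = eis_cnj (y ^ v q)"
    proof (elim disjE)
      assume "v q = 1" "opposite v q = (3 - v q) mod 3"
      then show ?thesis using yc by simp
    next
      assume y4: "(y\<^sup>2)\<^sup>2 = y" and "v q = 2" "opposite v q = (3 - v q) mod 3"
      then show ?thesis using yc by simp
    qed simp
    then show ?thesis
      unfolding y_def[symmetric] of_eis_power[symmetric] of_eis_cnj[symmetric] by simp
  qed
  then show ?thesis using True by (simp add: cubic_product_def)
next
  case False
  then show ?thesis unfolding cubic_product_def if_not_P[OF False] by simp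
qed

lemma lambda_series_opposite:
  assumes "v \<in> exponents"
  shows "lambda_series (cubic_product B (opposite v)) (of_real s) = cnj (lambda_series (cubic_product B v) (of_real s))"
proof -
  have c: "cnj (of_nat n powr (- complex_of_real s)) = of_nat n powr (- complex_of_real s)" for n
    using powr_of_real[of "real n" "- s"] by (metis complex_cnj_complex_of_real of_nat_0_le_iff of_real_minus of_real_of_nat_eq)
  show ?thesis
    unfolding lambda_series_def infsum_cnj[symmetric]
    by (intro infsum_cong) (auto simp: cubic_product_opposite[OF assms] c simp del: eis_norm_power)
qed

end

text \<open>With all targets equal to \<open>1\<close> the weights are nonnegative, so the orders of vanishing at \<open>1\<close>
  of the nonprincipal series add up to at most \<open>1\<close>. Complex conjugation pairs these series, hence
  none of them vanishes at \<open>1\<close>.\<close>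
lemma lambda_series_nonprincipal_limit:
  assumes B: "finite B" "\<And>q. q \<in> B \<Longrightarrow> pprime q"
    and v: "v \<in> PiE B (\<lambda>_. {..<3})" "v \<noteq> (\<lambda>q\<in>B. 0)"
  shows "((\<lambda>s. of_real (s - 1) * lambda_series (cubic_product B v) (of_real s)) \<longlongrightarrow> 0) (at_right 1)"
proof -
  interpret cubic_targets B "\<lambda>_. 1" by unfold_locales (use B in auto)
  have v: "v \<in> exponents" "v \<noteq> zero_exponent" using v by (auto simp: exponents_def zero_exponent_def)
  define E where "E = exponents - {zero_exponent}"
  have finE: "finite E" using finite_exponents by (simp add: E_def)
  define \<Lambda> where "\<Lambda> v s = complex_of_real (s - 1) * lambda_series (cubic_product B v) (of_real s)" for v s
  have "\<forall>v\<in>E. \<exists>m :: nat. (\<Lambda> v \<longlongrightarrow> - of_nat m) (at_right 1)"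
    unfolding \<Lambda>_def E_def using order_exists by blast
  then obtain m :: "(eis \<Rightarrow> nat) \<Rightarrow> nat" where m: "\<And>v. v \<in> E \<Longrightarrow> (\<Lambda> v \<longlongrightarrow> - of_nat (m v)) (at_right 1)"
    by metis
  have "((\<lambda>s. \<Lambda> zero_exponent s + (\<Sum>v\<in>E. \<Lambda> v s)) \<longlongrightarrow> 1 + (\<Sum>v\<in>E. - of_nat (m v))) (at_right 1)"
    using order_zero_exponent m unfolding \<Lambda>_def by (intro tendsto_add tendsto_sum) auto
  moreover have "\<Lambda> zero_exponent s + (\<Sum>v\<in>E. \<Lambda> v s) = (\<Sum>v\<in>exponents. \<Lambda> v s)" for s
    unfolding E_def using sum.remove[OF finite_exponents zero_exponent_in, of "\<lambda>v. \<Lambda> v s"] by simp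
  ultimately have "((\<lambda>s. \<Sum>v\<in>exponents. \<Lambda> v s) \<longlongrightarrow> 1 + (\<Sum>v\<in>E. - of_nat (m v))) (at_right 1)" by simp
  then have lim: "((\<lambda>s. Re (\<Sum>v\<in>exponents. \<Lambda> v s)) \<longlongrightarrow> Re (1 + (\<Sum>v\<in>E. - of_nat (m v)))) (at_right 1)"
    by (rule tendsto_Re)
  have "0 \<le> Re (\<Sum>v\<in>exponents. \<Lambda> v s)" if s: "s > 1" for s
  proof -
    have "0 \<le> Re (\<Sum>v\<in>exponents. coefficient v * lambda_series (cubic_product B v) (of_real s))"
    proof (rule has_sum_nonneg[OF has_sum_Re[OF weighted_lambda_has_sum[OF s]]])
      fix z :: "eis \<times> nat"
      obtain p j where z: "z = (p, j)" by fastforce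
      have w: "weight (p ^ j) = of_real (if weight (p ^ j) = 0 then 0 else 3 ^ card B)"
        by (auto simp: weight_def)
      have n: "of_nat (eis_norm (p ^ j)) powr (- complex_of_real s) = of_real (real (eis_norm (p ^ j)) powr (- s))"
        using powr_of_real[of "real (eis_norm (p ^ j))" "- s"] by simp
      show "0 \<le> Re (case z of (p, j) \<Rightarrow> weight (p ^ j) * of_real (ln (real (eis_norm p)))
          * of_nat (eis_norm (p ^ j)) powr (- of_real s))"
        unfolding z prod.case n by (subst w) (simp add: ln_nat_nonneg)
    qed
    moreover have "coefficient v = 1" for v by (simp add: coefficient_def)
    ultimately have "0 \<le> Re (\<Sum>v\<in>exponents. lambda_series (cubic_product B v) (of_real s))" by simp
    then have "0 \<le> (s - 1) * Re (\<Sum>v\<in>exponents. lambda_series (cubic_product B v) (of_real s))" using s by simp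
    also have "\<dots> = Re (\<Sum>v\<in>exponents. \<Lambda> v s)"
      unfolding \<Lambda>_def sum_distrib_left[symmetric] by simp
    finally show ?thesis .
  qed
  then have "\<forall>\<^sub>F s in at_right 1. 0 \<le> Re (\<Sum>v\<in>exponents. \<Lambda> v s)"
    using eventually_at_right_less[of "1 :: real"] by (auto elim: eventually_mono)
  from tendsto_lowerbound[OF lim this] have "0 \<le> Re (1 + (\<Sum>v\<in>E. - of_nat (m v)))" by simp
  then have "real (\<Sum>v\<in>E. m v) \<le> 1" by (simp add: sum_negf)
  then have le: "(\<Sum>v\<in>E. m v) \<le> 1" by linarith
  have "m v = 0"
  proof (rule ccontr)
    assume "m v \<noteq> 0"
    have vE: "v \<in> E" and oE: "opposite v \<in> E" and ne: "opposite v \<noteq> v"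
      using v opposite_exponents by (auto simp: E_def)
    have "\<Lambda> (opposite v) = (\<lambda>s. cnj (\<Lambda> v s))"
      by (auto simp: \<Lambda>_def lambda_series_opposite[OF v(1)])
    then have "(\<Lambda> (opposite v) \<longlongrightarrow> cnj (- of_nat (m v))) (at_right 1)"
      using tendsto_cnj[OF m[OF vE]] by simp
    then have "- of_nat (m (opposite v)) = cnj (- of_nat (m v))"
      by (rule tendsto_unique[OF trivial_limit_at_right_real m[OF oE]])
    then have "m (opposite v) = m v" by simp
    moreover have "(\<Sum>u\<in>{v, opposite v}. m u) \<le> (\<Sum>v\<in>E. m v)"
      using finE vE oE by (intro sum_mono2) auto
    ultimately show False using le ne \<open>m v \<noteq> 0\<close> by simp
  qed
  then show ?thesis using m[of v] v unfolding \<Lambda>_def E_def by simp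
qed

text \<open>If no such prime existed, the weight would vanish on all primes and only proper prime
  powers would remain, so T would be s - 1 times a bounded quantity. But T tends to 1, the
  contribution of the principal character, whose coefficient is 1.\<close>

theorem exists_pprime_cubic_char:
  assumes "finite B" "\<And>q. q \<in> B \<Longrightarrow> pprime q" "\<And>q. q \<in> B \<Longrightarrow> g q ^ 3 = 1"
  obtains p where "pprime p" "p \<notin> B" "\<And>q. q \<in> B \<Longrightarrow> cubic_char q p = g q"
proof (rule ccontr)
  assume no: "\<not> thesis"
  interpret cubic_targets B g by unfold_locales (use assms in auto)
  have w0: "weight p = 0" if "pprime p" for p
  proof (rule ccontr)
    assume "weight p \<noteq> 0"
    then have *: "\<forall>q\<in>B. \<not> q dvd p \<and> cubic_char q p = g q" by (auto simp: weight_def split: if_splits)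
    then have "p \<notin> B" by auto
    then show False using no that * \<open>\<And>p. pprime p \<Longrightarrow> p \<notin> B \<Longrightarrow> (\<And>q. q \<in> B \<Longrightarrow> cubic_char q p = g q) \<Longrightarrow> thesis\<close>
      by blast
  qed
  obtain K where K: "norm (\<Sum>\<^sub>\<infinity>(p, j)\<in>prime_powers. w (p, j) * of_real (ln (real (eis_norm p))) *
      of_nat (eis_norm (p ^ j)) powr (- of_real s)) \<le> 3 ^ card B * K"
    if "s > 1" "\<forall>z. norm (w z) \<le> 3 ^ card B" "\<forall>p. pprime p \<longrightarrow> w (p, 1) = (0 :: complex)" for s w
    using prime_powers_tail_bound[of "3 ^ card B"] by blast
  define T where "T s = (\<Sum>v\<in>exponents. coefficient v * (complex_of_real (s - 1) * lambda_series (cubic_product B v) (of_real s)))" for s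
  have "((\<lambda>s. coefficient v * (of_real (s - 1) * lambda_series (cubic_product B v) (of_real s)))
      \<longlongrightarrow> (if v = zero_exponent then 1 else 0)) (at_right 1)" if "v \<in> exponents" for v
  proof (cases "v = zero_exponent")
    case True
    have "coefficient zero_exponent = 1" by (simp add: coefficient_def zero_exponent_def)
    then show ?thesis using order_zero_exponent True by simp
  next
    case False
    then have "((\<lambda>s. of_real (s - 1) * lambda_series (cubic_product B v) (of_real s)) \<longlongrightarrow> 0) (at_right 1)"
      using that lambda_series_nonprincipal_limit[OF assms(1,2)] unfolding exponents_def zero_exponent_def by blast
    from tendsto_mult_left[OF this, of "coefficient v"] show ?thesis using False by simp
  qed
  then have "(T \<longlongrightarrow> (\<Sum>v\<in>exponents. if v = zero_exponent then 1 else 0)) (at_right 1)"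
    unfolding T_def[abs_def] by (intro tendsto_sum)
  then have T1: "(T \<longlongrightarrow> 1) (at_right 1)" using finite_exponents zero_exponent_in by simp
  have "norm (T s) \<le> (s - 1) * (3 ^ card B * K)" if s: "s > 1" for s
  proof -
    define w where "w = (\<lambda>(p :: eis, j :: nat). weight (p ^ j))"
    have "(\<Sum>\<^sub>\<infinity>(p, j)\<in>prime_powers. w (p, j) * of_real (ln (real (eis_norm p))) *
        of_nat (eis_norm (p ^ j)) powr (- of_real s))
        = (\<Sum>v\<in>exponents. coefficient v * lambda_series (cubic_product B v) (of_real s))"
      using weighted_lambda_has_sum[OF s] unfolding w_def prod.case by (rule infsumI)
    moreover have "norm (w z) \<le> 3 ^ card B" for z
      by (cases z) (simp add: w_def weight_def norm_power)
    moreover have "w (p, 1) = 0" if "pprime p" for p using w0[OF that] by (simp add: w_def)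
    ultimately have le: "norm (\<Sum>v\<in>exponents. coefficient v * lambda_series (cubic_product B v) (of_real s)) \<le> 3 ^ card B * K"
      using K[OF s, of w] by simp
    have "T s = of_real (s - 1) * (\<Sum>v\<in>exponents. coefficient v * lambda_series (cubic_product B v) (of_real s))"
      unfolding T_def sum_distrib_left by (intro sum.cong) auto
    then have "norm (T s) = \<bar>s - 1\<bar> * norm (\<Sum>v\<in>exponents. coefficient v * lambda_series (cubic_product B v) (of_real s))"
      by (simp only: norm_mult norm_of_real)
    then show ?thesis using s mult_left_mono[OF le, of "s - 1"] by simp
  qed
  then have ev: "\<forall>\<^sub>F s in at_right 1. norm (T s) \<le> (s - 1) * (3 ^ card B * K)"
    using eventually_at_right_less[of "1 :: real"] by (auto elim: eventually_mono)
  have "((\<lambda>s. (s - 1) * (3 ^ card B * K)) \<longlongrightarrow> (1 - 1) * (3 ^ card B * K)) (at_right 1)"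
    by (intro tendsto_intros)
  then have "((\<lambda>s. (s - 1) * (3 ^ card B * K)) \<longlongrightarrow> 0) (at_right 1)" by simp
  from Lim_null_comparison[OF ev this] have "(T \<longlongrightarrow> 0) (at_right 1)" .
  then have "(0 :: complex) = 1" using T1 tendsto_unique[OF trivial_limit_at_right_real] by blast
  then show False by simp
qed

section \<open>Ideals of the ring of integers\<close>

interpretation OK: cring "\<O>\<^sub>K" by (rule cring_ring_of_integers)

lemma OK_simps [simp]:
  "mult \<O>\<^sub>K = (*)" "one \<O>\<^sub>K = 1" "zero \<O>\<^sub>K = 0" "add \<O>\<^sub>K = (+)"
  by (simp_all add: ring_of_integers_def)

lemma range_eis_to_complex: "carrier \<O>\<^sub>K = range of_eis"
proof
  show "carrier \<O>\<^sub>K \<subseteq> range of_eis"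
  proof
    fix z assume "z \<in> carrier \<O>\<^sub>K"
    then obtain a b where "z = of_int a + of_int b * omega_K"
      unfolding carrier_ring_of_integers Z_omega_def by blast
    then have "z = of_eis (Eis a b)" by (simp add: of_eis_def)
    then show "z \<in> range of_eis" by blast
  qed
  show "range of_eis \<subseteq> carrier \<O>\<^sub>K"
    unfolding carrier_ring_of_integers Z_omega_def by (auto simp: of_eis_def)
qed

lemma of_eis_in_carrier [simp]: "of_eis x \<in> carrier \<O>\<^sub>K"
  by (simp add: range_eis_to_complex)

definition eis_ideal :: "eis \<Rightarrow> complex set" where
  "eis_ideal a = of_eis ` {x. a dvd x}"

lemma PIdl_eis: "PIdl\<^bsub>\<O>\<^sub>K\<^esub> (of_eis a) = eis_ideal a"
proof
  show "PIdl\<^bsub>\<O>\<^sub>K\<^esub> (of_eis a) \<subseteq> eis_ideal a"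
    unfolding cgenideal_def range_eis_to_complex eis_ideal_def
    by (auto simp flip: of_eis_mult)
  show "eis_ideal a \<subseteq> PIdl\<^bsub>\<O>\<^sub>K\<^esub> (of_eis a)"
  proof
    fix z assume "z \<in> eis_ideal a"
    then obtain x where "a dvd x" "z = of_eis x" unfolding eis_ideal_def by blast
    then obtain y where "x = a * y" by blast
    then have "z = of_eis y \<otimes>\<^bsub>\<O>\<^sub>K\<^esub> of_eis a"
      using \<open>z = of_eis x\<close> by (simp add: mult.commute)
    then show "z \<in> PIdl\<^bsub>\<O>\<^sub>K\<^esub> (of_eis a)"
      unfolding cgenideal_def using of_eis_in_carrier by blast
  qed
qed

lemma of_eis_in_ideal [simp]: "of_eis x \<in> eis_ideal a \<longleftrightarrow> a dvd x"
  by (auto simp: eis_ideal_def)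

lemma eis_ideal_subset: "eis_ideal a \<subseteq> eis_ideal b \<longleftrightarrow> b dvd a"
proof
  assume "eis_ideal a \<subseteq> eis_ideal b"
  moreover have "of_eis a \<in> eis_ideal a" by simp
  ultimately have "of_eis a \<in> eis_ideal b" by blast
  then show "b dvd a" by simp
next
  assume "b dvd a"
  then show "eis_ideal a \<subseteq> eis_ideal b" unfolding eis_ideal_def using dvd_trans by blast
qed

lemma of_eis_3: "3 = of_eis 3"
  by (simp add: of_eis_def)

lemma PIdl_3: "PIdl\<^bsub>\<O>\<^sub>K\<^esub> 3 = eis_ideal 3"
  unfolding of_eis_3 by (rule PIdl_eis)

lemma ideal_eis_ideal: "ideal (eis_ideal a) \<O>\<^sub>K"
  unfolding PIdl_eis[symmetric] by (rule OK.cgenideal_ideal) simp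

lemma ideal_is_principal:
  assumes "ideal I \<O>\<^sub>K"
  obtains a where "I = eis_ideal a"
proof -
  interpret I: ideal I "\<O>\<^sub>K" by fact
  define J where "J = {x. of_eis x \<in> I}"
  have I: "I = of_eis ` J"
    using I.a_subset unfolding J_def range_eis_to_complex by auto
  have add: "x + y \<in> J" if "x \<in> J" "y \<in> J" for x y
    using I.a_closed[of "of_eis x" "of_eis y"] that by (simp add: J_def)
  have mult: "x * y \<in> J" if "y \<in> J" for x y
    using I.I_l_closed[of "of_eis y" "of_eis x"] that by (simp add: J_def)
  have zero: "0 \<in> J" using I.zero_closed by (simp add: J_def)
  show ?thesis
  proof (cases "J = {0}")
    case True
    moreover have "{x :: eis. 0 dvd x} = {0}" by auto
    ultimately have "I = eis_ideal 0" unfolding I eis_ideal_def by (simp only:)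
    then show ?thesis by (rule that)
  next
    case False
    then have "\<exists>a. a \<in> J \<and> a \<noteq> 0" using zero by blast
    then obtain a where a: "a \<in> J" "a \<noteq> 0" "\<And>y. y \<in> J \<Longrightarrow> y \<noteq> 0 \<Longrightarrow> eis_norm a \<le> eis_norm y"
      using ex_has_least_nat[of "\<lambda>a. a \<in> J \<and> a \<noteq> 0" _ eis_norm] by metis
    have "a dvd x" if "x \<in> J" for x
    proof -
      have "x + (- (x div a)) * a \<in> J" using that a(1) add mult by blast
      also have "x + (- (x div a)) * a = x mod a" by (simp add: modulo_eis_def)
      finally have "x mod a = 0" using a(3) eis_norm_mod[OF a(2), of x] by force
      then show ?thesis by (simp add: dvd_eq_mod_eq_0)
    qed
    moreover have "x \<in> J" if "a dvd x" for x
      using that mult[OF a(1)] by (auto elim!: dvdE simp: mult.commute)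
    ultimately have "J = {x. a dvd x}" by auto
    then have "I = eis_ideal a" unfolding I eis_ideal_def by simp
    then show ?thesis by (rule that)
  qed
qed

lemma primeideal_eis_ideal:
  assumes "pprime p"
  shows "primeideal (eis_ideal p) \<O>\<^sub>K"
proof (rule primeidealI[OF ideal_eis_ideal cring_ring_of_integers])
  have "of_eis 1 \<notin> eis_ideal p"
    using pprime_not_dvd_1[OF assms] by (simp del: of_eis_hom)
  then show "carrier \<O>\<^sub>K \<noteq> eis_ideal p" using of_eis_in_carrier[of 1] by metis
  fix a b assume "a \<in> carrier \<O>\<^sub>K" "b \<in> carrier \<O>\<^sub>K" and ab: "a \<otimes>\<^bsub>\<O>\<^sub>K\<^esub> b \<in> eis_ideal p"
  then obtain x y where xy: "a = of_eis x" "b = of_eis y" by (auto simp: range_eis_to_complex)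
  then have "p dvd x * y" using ab by (simp flip: of_eis_mult)
  then show "a \<in> eis_ideal p \<or> b \<in> eis_ideal p" unfolding xy by (simp add: pprime_dvd_mult_iff[OF assms])
qed

lemma primeideal_generator:
  assumes "primeideal (eis_ideal a) \<O>\<^sub>K" "eis_ideal a \<noteq> {0}"
  shows "prime_elem a"
proof (rule prime_elemI)
  interpret P: primeideal "eis_ideal a" "\<O>\<^sub>K" by fact
  show "a \<noteq> 0" using assms(2) by (auto simp: eis_ideal_def)
  show "\<not> is_unit a"
  proof
    assume "is_unit a"
    then have "a dvd x" for x using dvd_trans one_dvd by blast
    then have "carrier \<O>\<^sub>K = eis_ideal a" by (simp add: eis_ideal_def range_eis_to_complex)
    then show False using P.I_notcarr by simp
  qed
  fix x y assume "a dvd x * y"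
  then have "of_eis x \<otimes>\<^bsub>\<O>\<^sub>K\<^esub> of_eis y \<in> eis_ideal a"
    by (simp flip: of_eis_mult)
  then have "of_eis x \<in> eis_ideal a \<or> of_eis y \<in> eis_ideal a"
    by (intro P.I_prime) auto
  then show "a dvd x \<or> a dvd y" by simp
qed

text \<open>A product of ideals lies in each factor, so a divisor contains 3. Conversely, in 3 = a c
  the element c generates the cofactor.\<close>

lemma ideal_dvd_3_iff: "ideal_dvd_K (eis_ideal a) (eis_ideal 3) \<longleftrightarrow> a dvd 3"
proof
  assume "a dvd 3"
  then obtain c where c: "3 = a * c" by blast
  have "eis_ideal 3 = eis_ideal a \<cdot>\<^bsub>\<O>\<^sub>K\<^esub> eis_ideal c"
  proof
    show "eis_ideal 3 \<subseteq> eis_ideal a \<cdot>\<^bsub>\<O>\<^sub>K\<^esub> eis_ideal c"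
    proof
      fix z assume "z \<in> eis_ideal 3"
      then obtain y where y: "z = of_eis y" "a * c dvd y" unfolding eis_ideal_def c by blast
      then obtain x where x: "z = of_eis (a * c * x)" by blast
      have "of_eis a \<otimes>\<^bsub>\<O>\<^sub>K\<^esub> of_eis (c * x) \<in> eis_ideal a \<cdot>\<^bsub>\<O>\<^sub>K\<^esub> eis_ideal c"
        by (intro ideal_prod.prod, simp, simp only: of_eis_in_ideal dvd_triv_left)
      then show "z \<in> eis_ideal a \<cdot>\<^bsub>\<O>\<^sub>K\<^esub> eis_ideal c" unfolding x by (simp add: mult.assoc)
    qed
  next
    show "eis_ideal a \<cdot>\<^bsub>\<O>\<^sub>K\<^esub> eis_ideal c \<subseteq> eis_ideal 3"
    proof
      fix z assume "z \<in> eis_ideal a \<cdot>\<^bsub>\<O>\<^sub>K\<^esub> eis_ideal c"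
      then show "z \<in> eis_ideal 3"
      proof (induction rule: ideal_prod.induct)
        case (prod i j)
        then obtain x y where "i = of_eis x" "a dvd x" "j = of_eis y" "c dvd y"
          by (auto simp: eis_ideal_def)
        then show ?case unfolding c by (simp add: mult_dvd_mono flip: of_eis_mult)
      next
        case (sum s1 s2)
        then obtain x y where "s1 = of_eis x" "3 dvd x" "s2 = of_eis y" "3 dvd y"
          by (auto simp: eis_ideal_def)
        then show ?case by (simp flip: of_eis_hom)
      qed
    qed
  qed
  then show "ideal_dvd_K (eis_ideal a) (eis_ideal 3)"
    unfolding ideal_dvd_K_def using ideal_eis_ideal by blast
next
  assume "ideal_dvd_K (eis_ideal a) (eis_ideal 3)"
  then obtain I where I: "ideal I \<O>\<^sub>K" "eis_ideal 3 = eis_ideal a \<cdot>\<^bsub>\<O>\<^sub>K\<^esub> I"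
    unfolding ideal_dvd_K_def by blast
  then have "eis_ideal 3 \<subseteq> eis_ideal a" using OK.ideal_prod_inter[OF ideal_eis_ideal I(1)] by blast
  then show "a dvd 3" by (simp add: eis_ideal_subset)
qed

text \<open>A prime whose norm is divisible by \<open>3\<close> is associated to \<open>1 - \<omega>\<close>, which divides \<open>3\<close>.\<close>
lemma prime_elem_norm_not_dvd_3:
  assumes "prime_elem a" "\<not> a dvd 3"
  shows "\<not> 3 dvd eis_norm a"
proof
  assume "3 dvd eis_norm a"
  then have "int 3 dvd int (eis_norm a)" by (simp only: of_nat_dvd_iff)
  then have "3 dvd eis1 a + eis2 a" using eis_norm_mod_3[of a] by simp
  then obtain t where t: "eis1 a + eis2 a = 3 * t" by blast
  have "a = Eis 1 (-1) * Eis (eis1 a - t) t" using t by (simp add: eis_eq_iff algebra_simps)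
  then have "is_unit (Eis 1 (-1)) \<or> is_unit (Eis (eis1 a - t) t)"
    using irreducibleD[OF prime_elem_imp_irreducible[OF assms(1)]] by blast
  moreover have "\<not> is_unit (Eis 1 (-1))" by (simp add: eis_is_unit_iff eis_norm_def)
  ultimately have "a dvd Eis 1 (-1)"
    using \<open>a = Eis 1 (-1) * Eis (eis1 a - t) t\<close> by (metis dvd_mult_unit_iff dvd_refl mult_unit_dvd_iff)
  moreover have "3 = Eis 1 (-1) * Eis 2 1" by (simp add: eis_eq_iff)
  then have "Eis 1 (-1) dvd 3" by (metis dvd_triv_left)
  ultimately show False using assms(2) dvd_trans by blast
qed

lemma prime_ideal_generator:
  assumes "prime_ideal_K P" "\<not> ideal_dvd_K P (PIdl\<^bsub>\<O>\<^sub>K\<^esub> 3)"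
  obtains p where "pprime p" "P = eis_ideal p"
proof -
  have P: "primeideal P \<O>\<^sub>K" "P \<noteq> {0}" using assms(1) by (auto simp: prime_ideal_K_def)
  then obtain a where a: "P = eis_ideal a" using ideal_is_principal primeideal.axioms(1) by blast
  then have pa: "prime_elem a" using primeideal_generator P by blast
  have "\<not> a dvd 3" using assms(2) unfolding a PIdl_3 ideal_dvd_3_iff .
  then obtain u where u: "is_unit u" "primary (u * a)"
    using primary_associate_exists prime_elem_norm_not_dvd_3[OF pa] by blast
  then have "pprime (u * a)" using pa by (simp add: pprime_def prime_elem_mult_unit_left)
  moreover have "P = eis_ideal (u * a)"
    unfolding a using u(1) by (simp add: eis_ideal_def mult_unit_dvd_iff')
  ultimately show ?thesis using that by blast
qed

lemma pprime_ideal: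
  assumes "pprime p"
  shows "prime_ideal_K (eis_ideal p)" "\<not> ideal_dvd_K (eis_ideal p) (PIdl\<^bsub>\<O>\<^sub>K\<^esub> 3)"
proof -
  have "of_eis p \<in> eis_ideal p" "of_eis p \<noteq> 0" using pprime_nonzero[OF assms] by auto
  then show "prime_ideal_K (eis_ideal p)"
    using primeideal_eis_ideal[OF assms] unfolding prime_ideal_K_def by blast
  show "\<not> ideal_dvd_K (eis_ideal p) (PIdl\<^bsub>\<O>\<^sub>K\<^esub> 3)"
    using pprime_not_dvd_3[OF assms] unfolding PIdl_3 ideal_dvd_3_iff .
qed

lemma eis_ideal_inj: "pprime p \<Longrightarrow> pprime q \<Longrightarrow> eis_ideal p = eis_ideal q \<longleftrightarrow> p = q"
  using eis_ideal_subset pprime_dvd_pprime by (metis order_refl)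

section \<open>Primary generators and residue symbols in the complex field\<close>

lemma cong_K_eis: "cong_K (of_eis x) (of_eis y) (eis_ideal a) \<longleftrightarrow> a dvd x - y"
  unfolding cong_K_def by (simp flip: of_eis_hom(4))

lemma primary_generator_eis_ideal:
  assumes "pprime p"
  shows "primary_generator (eis_ideal p) = of_eis p"
  unfolding primary_generator_def PIdl_3
proof (rule the_equality)
  have "cong_K (of_eis p) (of_eis 1) (eis_ideal 3)"
    unfolding cong_K_eis using assms by (simp add: pprime_def primary_def)
  then show "of_eis p \<in> carrier \<O>\<^sub>K \<and> eis_ideal p = PIdl\<^bsub>\<O>\<^sub>K\<^esub> (of_eis p) \<and>
      cong_K (of_eis p) 1 (eis_ideal 3)"
    by (simp add: PIdl_eis)
next
  fix \<pi>
  assume \<pi>: "\<pi> \<in> carrier \<O>\<^sub>K \<and> eis_ideal p = PIdl\<^bsub>\<O>\<^sub>K\<^esub> \<pi> \<and> cong_K \<pi> 1 (eis_ideal 3)"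
  then obtain x where x: "\<pi> = of_eis x" by (auto simp: range_eis_to_complex)
  have "eis_ideal p = eis_ideal x" using \<pi> unfolding x PIdl_eis by blast
  then have "x dvd p" "p dvd x" using eis_ideal_subset by blast+
  moreover have "cong_K (of_eis x) (of_eis 1) (eis_ideal 3)" using \<pi> x by simp
  then have "primary x" unfolding cong_K_eis primary_def .
  ultimately show "\<pi> = of_eis p"
    unfolding x using primary_associated_eq pprime_primary[OF assms] by blast
qed

lemma norm_K_eis: "norm_K (of_eis x) = real (eis_norm x)"
proof -
  have "of_eis x * cnj (of_eis x) = of_eis (of_nat (eis_norm x))"
    by (simp flip: of_eis_cnj of_eis_mult eis_mult_cnj)
  then show ?thesis by (simp add: norm_K_def of_eis_def)
qed

text \<open>The modulus is the second argument of the symbol but the first of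
  \<open>cubic_char\<close>. For distinct primes q does not divide p, so the value 0 of the
  character does not interfere.\<close>

lemma cubic_residue_symbol_eis:
  assumes "pprime p" "pprime q"
  shows "cubic_residue_symbol (of_eis p) (of_eis q)
    = (if p = q then 0 else of_eis (cubic_char q p))"
proof (cases "p = q")
  case False
  have ndvd: "\<not> q dvd p" using pprime_dvd_pprime[OF assms(2,1)] False by blast
  define k where "k = (eis_norm q - 1) div 3"
  have N: "eis_norm q = 3 * k + 1" using pprime_norm_eq[OF assms(2)] by (simp add: k_def)
  have k: "nat \<lfloor>(norm_K (of_eis q) - 1) / 3\<rfloor> = k" by (simp add: norm_K_eis N)
  have "(THE \<zeta>. \<zeta> \<in> field_K \<and> \<zeta> ^ 3 = 1 \<and> cong_K \<zeta> (of_eis p ^ k) (eis_ideal q))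
      = of_eis (cubic_char q p)"
  proof (rule the_equality)
    have "of_eis (cubic_char q p) \<in> field_K"
      using of_eis_in_carrier[of "cubic_char q p"] by (simp add: ring_of_integers_def)
    moreover have "of_eis (cubic_char q p) ^ 3 = 1"
      using cubic_char_cases(2)[OF assms(2) ndvd] by (simp flip: of_eis_power)
    moreover have "cong_K (of_eis (cubic_char q p)) (of_eis (p ^ k)) (eis_ideal q)"
      unfolding cong_K_eis k_def by (rule cubic_char_cases(3)[OF assms(2)])
    ultimately show "of_eis (cubic_char q p) \<in> field_K \<and> of_eis (cubic_char q p) ^ 3 = 1 \<and>
        cong_K (of_eis (cubic_char q p)) (of_eis p ^ k) (eis_ideal q)" by simp
  next
    fix \<zeta> assume \<zeta>: "\<zeta> \<in> field_K \<and> \<zeta> ^ 3 = 1 \<and> cong_K \<zeta> (of_eis p ^ k) (eis_ideal q)"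
    \<comment> \<open>Membership in the ring is part of \<open>cong_K\<close>; this is what brings
      \<open>\<zeta>\<close> back to an Eisenstein integer.\<close>
    then obtain z where z: "\<zeta> = of_eis z" by (auto simp: cong_K_def range_eis_to_complex)
    have "of_eis (z ^ 3) = of_eis 1" using \<zeta> z by simp
    then have "z ^ 3 = 1" unfolding of_eis_eq_iff .
    moreover have "cong_K (of_eis z) (of_eis (p ^ k)) (eis_ideal q)" using \<zeta> z by simp
    then have "q dvd z - p ^ k" unfolding cong_K_eis .
    ultimately have "cubic_char q p = z"
      using cubic_char_unique[OF assms(2)] ndvd by (simp add: k_def)
    then show "\<zeta> = of_eis (cubic_char q p)" using z by simp
  qed
  then show ?thesis using False by (simp add: cubic_residue_symbol_def k PIdl_eis)
qed (simp add: cubic_residue_symbol_def)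

lemma complex_cube_root_eis:
  assumes "(y :: complex) ^ 3 = 1"
  obtains z where "y = of_eis z" "z ^ 3 = 1"
proof -
  have w: "of_eis eis_omega = omega_K" by (simp add: of_eis_def eis_omega_def)
  have "(y - omega_K) * (y - (- 1 - omega_K)) = y * y + y - omega_K - omega_K * omega_K"
    by (simp add: algebra_simps)
  also have "\<dots> = y * y + y + 1" unfolding omega_K_square by simp
  finally have E: "(y - omega_K) * (y - (- 1 - omega_K)) = y * y + y + 1" .
  have "(y - 1) * ((y - omega_K) * (y - (- 1 - omega_K))) = y ^ 3 - 1"
    unfolding E by (simp add: power3_eq_cube algebra_simps)
  then have "y = 1 \<or> y = omega_K \<or> y = - 1 - omega_K" using assms by simp
  then have "y = of_eis 1 \<or> y = of_eis eis_omega \<or> y = of_eis (eis_omega\<^sup>2)"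
    unfolding eis_omega_sq by (simp add: w)
  then show ?thesis using that eis_cube_roots by metis
qed

section \<open>Symmetric cubic sign matrices\<close>

lemma pprimes_with_cubic_char_table:
  fixes n k :: nat
  assumes z: "\<And>i j. i < n \<Longrightarrow> j < n \<Longrightarrow> i \<noteq> j \<Longrightarrow> z i j ^ 3 = (1 :: eis)"
    and sym: "\<And>i j. i < n \<Longrightarrow> j < n \<Longrightarrow> i \<noteq> j \<Longrightarrow> z i j = z j i"
    and "k \<le> n"
  shows "\<exists>p. (\<forall>i<k. pprime (p i)) \<and> inj_on p {..<k} \<and>
    (\<forall>i<k. \<forall>j<k. i \<noteq> j \<longrightarrow> cubic_char (p j) (p i) = z i j)"
  using assms(3)
proof (induction k)
  case (Suc k)
  then obtain p where p: "\<And>i. i < k \<Longrightarrow> pprime (p i)" "inj_on p {..<k}"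
    "\<And>i j. i < k \<Longrightarrow> j < k \<Longrightarrow> i \<noteq> j \<Longrightarrow> cubic_char (p j) (p i) = z i j" by auto
  \<comment> \<open>Targets are attached to primes rather than to indices, so an index is recovered
    from its prime; this uses that the primes chosen so far are distinct.\<close>
  define g where "g q = z k (the_inv_into {..<k} p q)" for q
  have gp: "g (p i) = z k i" if "i < k" for i
    using that by (simp add: g_def the_inv_into_f_f[OF p(2)])
  obtain r where r: "pprime r" "r \<notin> p ` {..<k}" "\<And>q. q \<in> p ` {..<k} \<Longrightarrow> cubic_char q r = g q"
  proof (rule exists_pprime_cubic_char[of "p ` {..<k}" g])
    show "g q ^ 3 = 1" if "q \<in> p ` {..<k}" for q using that gp z Suc.prems by auto
  qed (use p(1) in auto)
  have rc: "cubic_char (p i) r = z k i" if "i < k" for i using r(3) gp that by auto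
  \<comment> \<open>Symbols modulo the new prime are beyond control when it is chosen. Reciprocity
    equates them with the prescribed ones, and the symmetry of \<open>z\<close> makes these the
    required values.\<close>
  have rr: "cubic_char r (p i) = z i k" if i: "i < k" for i
  proof -
    have "p i \<noteq> r" using r(2) i by auto
    then have "cubic_char r (p i) = cubic_char (p i) r" using cubic_reciprocity p(1)[OF i] r(1) by blast
    then show ?thesis using rc[OF i] sym[of k i] Suc.prems i by simp
  qed
  show ?case
  proof (intro exI[of _ "p(k := r)"] conjI allI impI)
    show "inj_on (p(k := r)) {..<Suc k}"
      using p(2) r(2) by (auto simp: inj_on_def lessThan_Suc)
    show "pprime ((p(k := r)) i)" if "i < Suc k" for i using that p(1) r(1) by (auto simp: less_Suc_eq)
    show "cubic_char ((p(k := r)) j) ((p(k := r)) i) = z i j" if "i < Suc k" "j < Suc k" "i \<noteq> j" for i j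
      using that p(3) rc rr by (auto simp: less_Suc_eq)
  qed
qed auto

lemma cubic_residue_matrix_entry:
  assumes "i < n" "j < n" "pprime (p i)" "pprime (p j)" "P i = eis_ideal (p i)" "P j = eis_ideal (p j)"
  shows "cubic_residue_matrix n P $$ (i, j) = (if p i = p j then 0 else of_eis (cubic_char (p j) (p i)))"
  using assms by (simp add: cubic_residue_matrix_def primary_generator_eis_ideal cubic_residue_symbol_eis)

theorem theorem2:
  fixes n :: nat and M :: "complex mat"
  assumes "n > 1" and "cubic_sign_matrix n M"
  shows "transpose_mat M = M \<longleftrightarrow>
    (\<exists>P :: nat \<Rightarrow> complex set.
       inj_on P {..<n} \<and>
       (\<forall>i<n. prime_ideal_K (P i) \<and> \<not> ideal_dvd_K (P i) (PIdl\<^bsub>\<O>\<^sub>K\<^esub> 3)) \<and>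
       M = cubic_residue_matrix n P)"
proof
  have M: "M \<in> carrier_mat n n" and M0: "\<And>i. i < n \<Longrightarrow> M $$ (i, i) = 0"
    and M1: "\<And>i j. i < n \<Longrightarrow> j < n \<Longrightarrow> i \<noteq> j \<Longrightarrow> M $$ (i, j) ^ 3 = 1"
    using assms(2) unfolding cubic_sign_matrix_def by (metis, metis, metis)
  have dim: "dim_row M = n" "dim_col M = n" using M by auto
  {
    assume "transpose_mat M = M"
    then have sym: "M $$ (i, j) = M $$ (j, i)" if "i < n" "j < n" for i j
      using that dim by (metis index_transpose_mat(1))
    \<comment> \<open>All complex cube roots of unity lie in the ring, so the off-diagonal entries
      can serve as targets for characters with values in \<open>eis\<close>.\<close>
    have "\<forall>i j. \<exists>z. i < n \<longrightarrow> j < n \<longrightarrow> i \<noteq> j \<longrightarrow> M $$ (i, j) = of_eis z \<and> z ^ 3 = 1"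
      using M1 complex_cube_root_eis by metis
    then obtain z where z: "\<And>i j. i < n \<Longrightarrow> j < n \<Longrightarrow> i \<noteq> j \<Longrightarrow> M $$ (i, j) = of_eis (z i j) \<and> z i j ^ 3 = 1"
      by metis
    have "z i j = z j i" if "i < n" "j < n" "i \<noteq> j" for i j
      using z[OF that] z[OF that(2,1) that(3)[symmetric]] sym[OF that(1,2)] by (metis of_eis_eq_iff)
    then obtain p where p: "\<And>i. i < n \<Longrightarrow> pprime (p i)" "inj_on p {..<n}"
      "\<And>i j. i < n \<Longrightarrow> j < n \<Longrightarrow> i \<noteq> j \<Longrightarrow> cubic_char (p j) (p i) = z i j"
      using pprimes_with_cubic_char_table[of n z n] z by blast
    define P where "P i = eis_ideal (p i)" for i
    have "M = cubic_residue_matrix n P"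
    proof (rule eq_matI)
      fix i j assume "i < dim_row (cubic_residue_matrix n P)" "j < dim_col (cubic_residue_matrix n P)"
      then have ij: "i < n" "j < n" by (auto simp: cubic_residue_matrix_def)
      have "cubic_residue_matrix n P $$ (i, j) = (if p i = p j then 0 else of_eis (cubic_char (p j) (p i)))"
        by (rule cubic_residue_matrix_entry) (use ij p(1) in \<open>auto simp: P_def\<close>)
      \<comment> \<open>Distinct primes confine the value 0 of the symbol to the diagonal, in
        agreement with \<open>M\<close>.\<close>
      moreover have "p i = p j \<longleftrightarrow> i = j" using p(2) ij by (auto simp: inj_on_def)
      ultimately show "M $$ (i, j) = cubic_residue_matrix n P $$ (i, j)"
        using M0 z p(3) ij by simp
    qed (auto simp: dim cubic_residue_matrix_def)
    moreover have "inj_on P {..<n}"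
      using p eis_ideal_inj unfolding inj_on_def P_def by blast
    ultimately show "\<exists>P. inj_on P {..<n} \<and>
       (\<forall>i<n. prime_ideal_K (P i) \<and> \<not> ideal_dvd_K (P i) (PIdl\<^bsub>\<O>\<^sub>K\<^esub> 3)) \<and> M = cubic_residue_matrix n P"
      using pprime_ideal p(1) unfolding P_def by blast
  next
    assume "\<exists>P. inj_on P {..<n} \<and>
       (\<forall>i<n. prime_ideal_K (P i) \<and> \<not> ideal_dvd_K (P i) (PIdl\<^bsub>\<O>\<^sub>K\<^esub> 3)) \<and> M = cubic_residue_matrix n P"
    then obtain P where P: "inj_on P {..<n}" "\<And>i. i < n \<Longrightarrow> prime_ideal_K (P i)"
      "\<And>i. i < n \<Longrightarrow> \<not> ideal_dvd_K (P i) (PIdl\<^bsub>\<O>\<^sub>K\<^esub> 3)" "M = cubic_residue_matrix n P" by blast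
    have "\<forall>i. \<exists>p. i < n \<longrightarrow> pprime p \<and> P i = eis_ideal p" using prime_ideal_generator P(2,3) by metis
    then obtain p where p: "\<And>i. i < n \<Longrightarrow> pprime (p i) \<and> P i = eis_ideal (p i)" by metis
    show "transpose_mat M = M"
    proof (rule eq_matI)
      fix i j assume "i < dim_row M" "j < dim_col M"
      then have ij: "i < n" "j < n" by (auto simp: dim)
      have e: "M $$ (i, j) = (if p i = p j then 0 else of_eis (cubic_char (p j) (p i)))"
        if "i < n" "j < n" for i j
        unfolding P(4) by (rule cubic_residue_matrix_entry) (use that p in auto)
      have "cubic_char (p j) (p i) = cubic_char (p i) (p j)" if "p i \<noteq> p j"
        using cubic_reciprocity p ij that by blast
      then show "transpose_mat M $$ (i, j) = M $$ (i, j)" using e ij by (auto simp: dim)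
    qed (auto simp: dim)
  }
qed

end
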